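(* Fix one of the four mobility averages (harmonic, geometric, arithmetic or entropic) described in the context, and let $(\psi_e,c_e^1,\dots,c_e^M)$ be a sufficiently smooth exact $\Omega$-periodic solution on $[0,T]$ of the Poisson--Nernst--Planck system. Let $(\psi^n,c^{1,n},\dots,c^{M,n})$ be the numerical solution of the semi-implicit Slotboom scheme with initial data $c^{l,0}=\mathcal{P}_h c^l_N(\cdot,0)$, $\psi^0=\mathcal{P}_h\psi_N(\cdot,0)$, and let $$e_\psi^n=\mathcal{P}_h\psi_N(\cdot,t^n)-\psi^n,\qquad e^{l,n}=\mathcal{P}_h c_N^l(\cdot,t^n)-c^{l,n},\quad l=1,\dots,M,$$ be the error grid functions. Let $C_1,C_2>0$ be fixed constants. Then there is a constant $C>0$, independent of $\Delta t$ and $h$, such that, under the linear refinement requirement $C_1h\le\Delta t\le C_2h$ and as $\Delta t,h\to0$ (that is, for all sufficiently small such $\Delta t,h$), for all $n\ge1$ with $t^n=n\Delta t\le T$, $$\sum_{l=1}^M\|e^{l,n}\|_2+\Big(\Delta t\sum_{l=1}^M\sum_{k=1}^n\|\nabla_h e^{l,k}\|_2^2\Big)^{1/2}+\|e_\psi^n\|_{H_h^2}\le C(\Delta t+h^2).$$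
   Context: **PDE.** $\Omega=(a,b)^3$ with periodic boundary conditions, $\kappa>0$ a constant, $q^l\in\mathbb{R}$ ($l=1,\dots,M$) the valences, $\rho^f=\rho^f(\mathbf{x})$ a given periodic function. The Poisson--Nernst--Planck system is $$\partial_t c^l=\nabla\cdot(\nabla c^l+q^lc^l\nabla\psi)\ (l=1,\dots,M),\qquad -\kappa\Delta\psi=\sum_{l=1}^M q^lc^l+\rho^f,$$ with initial data $c^l(\cdot,0)=c^l_{\rm in}$, compatibility $\int_\Omega(\sum_l q^lc^l_{\rm in}+\rho^f)\,d\mathbf{x}=0$ and normalization $\int_\Omega\psi\,d\mathbf{x}=0$. "Sufficiently smooth" means that the exact solution and $\rho^f$ have continuous space-time derivatives up to some sufficiently high fixed order $m$ (on the closed time interval $[0,T]$, periodic in space). **Grid.** $N=2K+1$ grid points per dimension, $h=(b-a)/N$, cell centres $x_i=a+(i-\frac12)h$, and likewise $y_j,z_k$. $\mathcal{C}_{\rm per}$ is the space of grid functions $u_{i,j,k}$ that are $N$-periodic in each index; $\mathring{\mathcal{C}}_{\rm per}$ is its subspace with zero mean $\overline u=\frac{h^3}{|\Omega|}\sum_{i,j,k=1}^N u_{i,j,k}=0$. Face-centred (staggered) periodic functions live at points $(i+\frac12,j,k)$, $(i,j+\frac12,k)$, $(i,j,k+\frac12)$. Put $D_xf_{i+1/2,j,k}=(f_{i+1,j,k}-f_{i,j,k})/h$ and $d_xf_{i,j,k}=(f_{i+1/2,j,k}-f_{i-1/2,j,k})/h$, similarly in $y,z$; $\nabla_hf=(D_xf,D_yf,D_zf)$,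 $\nabla_h\cdot\vec f=d_xf^x+d_yf^y+d_zf^z$, $\Delta_h=\nabla_h\cdot\nabla_h$. For a face-centred scalar $\mathcal{D}$, $\mathcal{D}\nabla_hf$ is the pointwise product on faces. **Norms.** $\|f\|_2^2=h^3\sum_{i,j,k=1}^N f_{i,j,k}^2$; $\|\nabla_hf\|_2^2=h^3\sum_{i,j,k=1}^N\big(|D_xf_{i+1/2,j,k}|^2+|D_yf_{i,j+1/2,k}|^2+|D_zf_{i,j,k+1/2}|^2\big)$; $\|f\|_{H_h^2}^2=\|f\|_2^2+\|\nabla_hf\|_2^2+\|\Delta_hf\|_2^2$. **Projections.** $\mathcal{P}_N$ is the Fourier projection onto trigonometric polynomials of degree at most $K$ on $\Omega$; $c_N^l=\mathcal{P}_Nc_e^l$, $\psi_N=\mathcal{P}_N\psi_e$, $\rho^f_N=\mathcal{P}_N\rho^f$. $\mathcal{P}_h$ is pointwise restriction to the grid points $(x_i,y_j,z_k)$. **Scheme (Slotboom scheme).** With $t^n=n\Delta t$, given $\psi^n\in\mathring{\mathcal{C}}_{\rm per}$ and $c^{l,n}\in\mathcal{C}_{\rm per}$, find $c^{l,n+1}\in\mathcal{C}_{\rm per}$, $\psi^{n+1}\in\mathring{\mathcal{C}}_{\rm per}$ such that $$\frac{c^{l,n+1}-c^{l,n}}{\Delta t}=\nabla_h\cdot\Big(e^{-q^l\psi^n}\nabla_h\big(c^{l,n+1}e^{q^l\psi^n}\big)\Big)\ (l=1,\dots,M),\qquad -\kappa\Delta_h\psi^{n+1}=\sum_{l=1}^Mq^lc^{l,n+1}+\rho^f,\quad\overline{\psi^{n+1}}=0,$$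 where the grid function $\rho^f$ is $\mathcal{P}_h\rho^f_N$ (so that the discrete right-hand side has zero mean). **Mobility averages.** With $S=q^l\psi^n$, the face value $e^{-q^l\psi^n}$ at $(i+\frac12,j,k)$ is one of: harmonic mean $\big(\frac{e^{S_{i+1,j,k}}+e^{S_{i,j,k}}}{2}\big)^{-1}$; geometric mean $e^{-(S_{i+1,j,k}+S_{i,j,k})/2}$; arithmetic mean $\frac{e^{-S_{i+1,j,k}}+e^{-S_{i,j,k}}}{2}$; entropic mean $\frac{S_{i+1,j,k}-S_{i,j,k}}{e^{S_{i+1,j,k}}-e^{S_{i,j,k}}}$ (equal to $e^{-S_{i,j,k}}$ when $S_{i+1,j,k}=S_{i,j,k}$). The $y$ and $z$ directions are analogous. *)

theory Defs
  imports "HOL-Analysis.Analysis"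
begin

section \<open>The continuous problem\<close>

text \<open>
  Functions on the torus are represented by \<open>(b - a)\<close>-periodic functions on all of \<open>\<real>\<^sup>3\<close>;
  space-time functions are curried, \<open>f t x\<close>. Species are indexed by \<open>1, \<dots>, M\<close>.
\<close>

definition cube :: "real \<Rightarrow> real \<Rightarrow> (real^3) set" where
  "cube a b = {x. \<forall>d. a < x $ d \<and> x $ d < b}"

definition space_periodic :: "real \<Rightarrow> (real^3 \<Rightarrow> real) \<Rightarrow> bool" where
  "space_periodic L f \<longleftrightarrow> (\<forall>x d. f (x + axis d L) = f x)"

text \<open>
  Existence and continuity on \<open>[0,T] \<times> \<real>\<^sup>3\<close> of all (mixed) space-time partial derivatives of
  order at most \<open>m\<close>; the time derivative is one-sided at \<open>0\<close> and \<open>T\<close>.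
\<close>

primrec C_spacetime :: "real \<Rightarrow> nat \<Rightarrow> (real \<Rightarrow> real^3 \<Rightarrow> real) \<Rightarrow> bool" where
  "C_spacetime T 0 f \<longleftrightarrow> continuous_on ({0..T} \<times> UNIV) (\<lambda>(t, x). f t x)"
| "C_spacetime T (Suc m) f \<longleftrightarrow>
     continuous_on ({0..T} \<times> UNIV) (\<lambda>(t, x). f t x) \<and>
     (\<exists>ft. (\<forall>t\<in>{0..T}. \<forall>x. ((\<lambda>s. f s x) has_real_derivative ft t x) (at t within {0..T})) \<and>
           C_spacetime T m ft) \<and>
     (\<forall>d. \<exists>fd. (\<forall>t\<in>{0..T}. \<forall>x. ((\<lambda>s. f t (x + s *\<^sub>R axis d 1)) has_real_derivative fd t x) (at 0)) \<and>
           C_spacetime T m fd)"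

definition partial_deriv :: "3 \<Rightarrow> (real^3 \<Rightarrow> real) \<Rightarrow> real^3 \<Rightarrow> real" where
  "partial_deriv d f x = deriv (\<lambda>s. f (x + s *\<^sub>R axis d 1)) 0"

definition grad :: "(real^3 \<Rightarrow> real) \<Rightarrow> real^3 \<Rightarrow> real^3" where
  "grad f x = (\<chi> d. partial_deriv d f x)"

definition diverg :: "(real^3 \<Rightarrow> real^3) \<Rightarrow> real^3 \<Rightarrow> real" where
  "diverg F x = (\<Sum>d\<in>UNIV. partial_deriv d (\<lambda>y. F y $ d) x)"

definition laplacian :: "(real^3 \<Rightarrow> real) \<Rightarrow> real^3 \<Rightarrow> real" where
  "laplacian f = diverg (grad f)"

definition PNP_solution ::
  "real \<Rightarrow> real \<Rightarrow> real \<Rightarrow> nat \<Rightarrow> (nat \<Rightarrow> real) \<Rightarrow> (real^3 \<Rightarrow> real) \<Rightarrow> real \<Rightarrow>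
   (nat \<Rightarrow> real^3 \<Rightarrow> real) \<Rightarrow> (real \<Rightarrow> real^3 \<Rightarrow> real) \<Rightarrow> (nat \<Rightarrow> real \<Rightarrow> real^3 \<Rightarrow> real) \<Rightarrow> bool" where
  "PNP_solution a b \<kappa> M q \<rho> T cin \<psi> c \<longleftrightarrow>
     integral (cube a b) (\<lambda>x. (\<Sum>l=1..M. q l * cin l x) + \<rho> x) = 0 \<and>
     (\<forall>l\<in>{1..M}. \<forall>x. c l 0 x = cin l x) \<and>
     (\<forall>t\<in>{0..T}.
        space_periodic (b - a) (\<psi> t) \<and>
        (\<forall>l\<in>{1..M}. space_periodic (b - a) (c l t)) \<and>
        (\<forall>l\<in>{1..M}. \<forall>x.
           ((\<lambda>s. c l s x) has_real_derivative
              diverg (\<lambda>y. grad (c l t) y + (q l * c l t y) *\<^sub>R grad (\<psi> t) y) x)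
           (at t within {0..T})) \<and>
        (\<forall>x. - \<kappa> * laplacian (\<psi> t) x = (\<Sum>l=1..M. q l * c l t x) + \<rho> x) \<and>
        integral (cube a b) (\<psi> t) = 0)"

text \<open>
  The Fourier projection keeps the modes with all three wave numbers in \<open>{-K..K}\<close>, so that there
  are \<open>N = 2K + 1\<close> modes per direction. For real \<open>f\<close> the truncated series is real, hence
  taking the real part only changes the type.
\<close>

definition fourier_phase :: "real \<Rightarrow> real \<Rightarrow> int^3 \<Rightarrow> real^3 \<Rightarrow> real" where
  "fourier_phase a b k x = 2 * pi / (b - a) * (\<Sum>d\<in>UNIV. real_of_int (k $ d) * x $ d)"

definition fourier_coeff :: "real \<Rightarrow> real \<Rightarrow> (real^3 \<Rightarrow> real) \<Rightarrow> int^3 \<Rightarrow> complex" where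
  "fourier_coeff a b f k =
     (1 / (b - a) ^ 3) *\<^sub>R
       integral (cube a b) (\<lambda>x. complex_of_real (f x) * cis (- fourier_phase a b k x))"

definition fourier_proj :: "real \<Rightarrow> real \<Rightarrow> nat \<Rightarrow> (real^3 \<Rightarrow> real) \<Rightarrow> real^3 \<Rightarrow> real" where
  "fourier_proj a b K f x =
     Re (\<Sum>k | \<forall>d. k $ d \<in> {- int K..int K}. fourier_coeff a b f k * cis (fourier_phase a b k x))"

section \<open>Grid functions\<close>

text \<open>
  A cell-centred function has type \<open>int^3 \<Rightarrow> real\<close>, its argument being the index \<open>(i,j,k)\<close>.
  A face-centred function \<open>F :: 3 \<Rightarrow> int^3 \<Rightarrow> real\<close> has at \<open>F d p\<close> its value on the face
  \<open>p + e\<^sub>d/2\<close>, e.g. at \<open>(i + 1/2, j, k)\<close> for \<open>d = 1\<close>.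
\<close>

definition cells :: "nat \<Rightarrow> (int^3) set" where
  "cells N = {p. \<forall>d. p $ d \<in> {1..int N}}"

lemma finite_index_box: "finite {p :: int^3. \<forall>d. p $ d \<in> {m..n}}"
proof -
  have "{p :: int^3. \<forall>d. p $ d \<in> {m..n}} \<subseteq> vec_lambda ` (UNIV \<rightarrow>\<^sub>E {m..n})"
  proof
    fix p :: "int^3" assume "p \<in> {p. \<forall>d. p $ d \<in> {m..n}}"
    then have "(\<lambda>d. p $ d) \<in> UNIV \<rightarrow>\<^sub>E {m..n}" by auto
    then show "p \<in> vec_lambda ` (UNIV \<rightarrow>\<^sub>E {m..n})"
      by (metis image_eqI vec_nth_inverse)
  qed
  then show ?thesis
    by (rule finite_subset) (intro finite_imageI finite_PiE; simp)
qed

lemma finite_cells: "finite (cells N)"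
  unfolding cells_def by (rule finite_index_box)

definition grid_periodic :: "nat \<Rightarrow> (int^3 \<Rightarrow> real) \<Rightarrow> bool" where
  "grid_periodic N u \<longleftrightarrow> (\<forall>p d. u (p + axis d (int N)) = u p)"

definition mesh :: "real \<Rightarrow> real \<Rightarrow> nat \<Rightarrow> real" where
  "mesh a b N = (b - a) / real N"

definition grid_mean :: "real \<Rightarrow> real \<Rightarrow> nat \<Rightarrow> (int^3 \<Rightarrow> real) \<Rightarrow> real" where
  "grid_mean a b N u = mesh a b N ^ 3 / (b - a) ^ 3 * (\<Sum>p\<in>cells N. u p)"

definition restrict_grid :: "real \<Rightarrow> real \<Rightarrow> nat \<Rightarrow> (real^3 \<Rightarrow> real) \<Rightarrow> int^3 \<Rightarrow> real" where
  "restrict_grid a b N f p = f (\<chi> d. a + (real_of_int (p $ d) - 1/2) * mesh a b N)"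

definition grad_h :: "real \<Rightarrow> (int^3 \<Rightarrow> real) \<Rightarrow> 3 \<Rightarrow> int^3 \<Rightarrow> real" where
  "grad_h h u d p = (u (p + axis d 1) - u p) / h"

definition div_h :: "real \<Rightarrow> (3 \<Rightarrow> int^3 \<Rightarrow> real) \<Rightarrow> int^3 \<Rightarrow> real" where
  "div_h h F p = (\<Sum>d\<in>UNIV. (F d p - F d (p - axis d 1)) / h)"

definition lap_h :: "real \<Rightarrow> (int^3 \<Rightarrow> real) \<Rightarrow> int^3 \<Rightarrow> real" where
  "lap_h h u = div_h h (grad_h h u)"

definition norm2_h :: "real \<Rightarrow> nat \<Rightarrow> (int^3 \<Rightarrow> real) \<Rightarrow> real" where
  "norm2_h h N u = sqrt (h ^ 3 * (\<Sum>p\<in>cells N. (u p)\<^sup>2))"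

definition grad_norm2_h :: "real \<Rightarrow> nat \<Rightarrow> (int^3 \<Rightarrow> real) \<Rightarrow> real" where
  "grad_norm2_h h N u = sqrt (h ^ 3 * (\<Sum>p\<in>cells N. \<Sum>d\<in>UNIV. \<bar>grad_h h u d p\<bar>\<^sup>2))"

definition H2_norm_h :: "real \<Rightarrow> nat \<Rightarrow> (int^3 \<Rightarrow> real) \<Rightarrow> real" where
  "H2_norm_h h N u =
     sqrt ((norm2_h h N u)\<^sup>2 + (grad_norm2_h h N u)\<^sup>2 + (norm2_h h N (lap_h h u))\<^sup>2)"

section \<open>The Slotboom scheme\<close>

datatype mobility_average = Harmonic | Geometric | Arithmetic | Entropic

text \<open>The average of \<open>exp (-S)\<close> over two neighbouring cells with values \<open>S = s\<close> and \<open>S = s'\<close>.\<close>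

fun mobility :: "mobility_average \<Rightarrow> real \<Rightarrow> real \<Rightarrow> real" where
  "mobility Harmonic s s' = inverse ((exp s' + exp s) / 2)"
| "mobility Geometric s s' = exp (- (s' + s) / 2)"
| "mobility Arithmetic s s' = (exp (- s') + exp (- s)) / 2"
| "mobility Entropic s s' = (if s' = s then exp (- s) else (s' - s) / (exp s' - exp s))"

definition face_mobility :: "mobility_average \<Rightarrow> (int^3 \<Rightarrow> real) \<Rightarrow> 3 \<Rightarrow> int^3 \<Rightarrow> real" where
  "face_mobility avg S d p = mobility avg (S p) (S (p + axis d 1))"

definition slotboom_step ::
  "mobility_average \<Rightarrow> real \<Rightarrow> real \<Rightarrow> nat \<Rightarrow> nat \<Rightarrow> (nat \<Rightarrow> real) \<Rightarrow> (int^3 \<Rightarrow> real) \<Rightarrow> real \<Rightarrow> real \<Rightarrow>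
   (int^3 \<Rightarrow> real) \<Rightarrow> (nat \<Rightarrow> int^3 \<Rightarrow> real) \<Rightarrow> (int^3 \<Rightarrow> real) \<Rightarrow> (nat \<Rightarrow> int^3 \<Rightarrow> real) \<Rightarrow> bool" where
  "slotboom_step avg a b N M q \<rho> \<kappa> dt \<psi> c \<psi>' c' \<longleftrightarrow>
     (let h = mesh a b N in
       (\<forall>l\<in>{1..M}. grid_periodic N (c' l)) \<and> grid_periodic N \<psi>' \<and>
       (\<forall>l\<in>{1..M}. \<forall>p.
          (c' l p - c l p) / dt =
          div_h h (\<lambda>d r. face_mobility avg (\<lambda>p. q l * \<psi> p) d r *
                           grad_h h (\<lambda>p. c' l p * exp (q l * \<psi> p)) d r) p) \<and>
       (\<forall>p. - \<kappa> * lap_h h \<psi>' p = (\<Sum>l=1..M. q l * c' l p) + \<rho> p) \<and>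
       grid_mean a b N \<psi>' = 0)"

text \<open>
  A numerical solution \<open>\<psi> n\<close>, \<open>c l n\<close> at the time levels \<open>n * dt \<le> T\<close>, started from
  \<open>\<psi>0\<close>, \<open>c0\<close>; later members of the sequences are irrelevant.
\<close>

definition slotboom_solution ::
  "mobility_average \<Rightarrow> real \<Rightarrow> real \<Rightarrow> nat \<Rightarrow> nat \<Rightarrow> (nat \<Rightarrow> real) \<Rightarrow> (int^3 \<Rightarrow> real) \<Rightarrow> real \<Rightarrow> real \<Rightarrow> real \<Rightarrow>
   (int^3 \<Rightarrow> real) \<Rightarrow> (nat \<Rightarrow> int^3 \<Rightarrow> real) \<Rightarrow>
   (nat \<Rightarrow> int^3 \<Rightarrow> real) \<Rightarrow> (nat \<Rightarrow> nat \<Rightarrow> int^3 \<Rightarrow> real) \<Rightarrow> bool" where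
  "slotboom_solution avg a b N M q \<rho> \<kappa> T dt \<psi>0 c0 \<psi> c \<longleftrightarrow>
     \<psi> 0 = \<psi>0 \<and> (\<forall>l\<in>{1..M}. c l 0 = c0 l) \<and>
     (\<forall>n. real (Suc n) * dt \<le> T \<longrightarrow>
        slotboom_step avg a b N M q \<rho> \<kappa> dt (\<psi> n) (\<lambda>l. c l n) (\<psi> (Suc n)) (\<lambda>l. c l (Suc n)))"

end

theory Submission
  imports Defs
begin

text \<open>
  The numerical solution is compared with the restriction of the exact solution to the grid. The
  Fourier projection differs from the latter by \<open>O(h\<^sup>4)\<close> in the maximum norm, and even in the
  discrete \<open>H\<^sup>2\<close> norm this costs only \<open>O(h\<^sup>2)\<close>.

  For each average the flux through a face is
  \<open>G(\<delta>) D c + (H(\<delta>) / h) (c + c') / 2\<close>, where \<open>\<delta>\<close> is the jump of \<open>q \<psi>\<close>, \<open>G = 1 + O(\<delta>\<^sup>2)\<close> is even and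
  \<open>H = \<delta> + O(\<delta>\<^sup>3)\<close> is odd. Symmetric Taylor expansion then gives a consistency error
  \<open>O(dt + h\<^sup>2)\<close>. Testing the error equation with the error itself and applying Gronwall's lemma gives
  the estimate, as long as the discrete gradient of the potential error \<open>\<phi>\<close> stays bounded.

  This bound is obtained by induction over the time steps, without any higher order expansion of the
  numerical solution. The estimate up to step \<open>n\<close> and the discrete Poisson equation give
  \<open>\<parallel>\<Delta>\<^sub>h \<phi>\<parallel> = O(dt + h\<^sup>2) = O(h)\<close>, and averaging over two-dimensional blocks of side \<open>\<epsilon>\<close> yields
  \<open>max \<bar>\<nabla>\<^sub>h \<phi>\<bar> \<le> (\<surd>\<epsilon> / h + O(h powr (-1/2))) * \<parallel>\<Delta>\<^sub>h \<phi>\<parallel>\<close>, which is at most \<open>1\<close> once \<open>\<epsilon>\<close> and then \<open>h\<close> are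
  small.
\<close>

section \<open>Integrals of periodic functions\<close>

text \<open>What closes the induction is the lag of the potential: the flux into level
  \<open>n + 1\<close> contains the new concentrations but the potential of level \<open>n\<close>,
  so the step consumes a gradient bound only where the error estimate is already available. The
  error of the flux is split into the numerical flux of the concentration error and the change of
  the flux of the exact concentration under a change of the potential. Differences of the weights
  thus multiply smooth exact data only, and no maximum bound of the numerical concentrations is
  called for. Since the flux depends on the potential through its jumps alone, its gradient is the
  one quantity to be controlled in the maximum norm. The obstacle is that this control is critical:
  a potential error with discrete Laplacian \<open>O(h)\<close> leaves no spare power of
  \<open>h\<close> in the leading term of the gradient bound, so its smallness has to come from the
  freely chosen averaging length. Comparing with the exact solution instead of its projection keeps
  consistency pointwise: it is read off from the differential equations.\<close>

definition closed_cube :: "real \<Rightarrow> real \<Rightarrow> (real^3) set" where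
  "closed_cube a b = cbox (vec a) (vec b)"

lemma mem_closed_cube: "x \<in> closed_cube a b \<longleftrightarrow> (\<forall>d. a \<le> x $ d \<and> x $ d \<le> b)"
  by (simp add: closed_cube_def mem_box_cart)

lemma integral_cube:
  fixes f :: "real^3 \<Rightarrow> 'a::banach"
  shows "integral (cube a b) f = integral (closed_cube a b) f"
proof -
  have "cube a b = box (vec a) (vec b)"
    by (auto simp: cube_def mem_box_cart)
  then show ?thesis by (simp add: integral_open_interval closed_cube_def)
qed

lemma content_closed_cube: "a \<le> b \<Longrightarrow> measure lborel (closed_cube a b) = (b - a) ^ 3"
  unfolding closed_cube_def by (subst content_cbox_if_cart) (auto simp: interval_eq_empty_cart)

text \<open>The translated cube is cut at \<open>x $ d = b\<close>. The overhanging slab, moved back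
  by one period, fills exactly the gap left next to \<open>x $ d = a\<close>. As \<open>s\<close> is
  at most one period, a single cut suffices.\<close>

lemma integral_periodic_shift:
  fixes f :: "real^3 \<Rightarrow> 'a::euclidean_space"
  assumes cont: "continuous_on UNIV f" and per: "\<And>x. f (x + axis d (b - a)) = f x"
    and s: "0 \<le> s" "s \<le> b - a"
  shows "integral (closed_cube a b) (\<lambda>x. f (x + axis d s)) = integral (closed_cube a b) f"
proof -
  have int: "f integrable_on cbox u v" for u v
    using cont continuous_on_subset by (intro integrable_continuous) blast
  have nth: "axis d r $ i = (if i = d then r else 0)" for r :: real and i
    by (simp add: axis_def)
  have mem: "x \<in> cbox (vec \<alpha> + axis d r) (vec \<beta> + axis d r') \<longleftrightarrow>
      (\<alpha> + r \<le> x $ d \<and> x $ d \<le> \<beta> + r') \<and> (\<forall>i. i \<noteq> d \<longrightarrow> \<alpha> \<le> x $ i \<and> x $ i \<le> \<beta>)" for x and \<alpha> \<beta> r r' :: real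
    unfolding mem_box_cart by (auto simp: nth)
  have axis0: "axis d 0 = (0 :: real^3)" by (simp add: vec_eq_iff axis_def)
  note mem0 = mem[where r = 0, unfolded axis0 add_0_right] mem[where r' = 0, unfolded axis0 add_0_right]
    mem[where r = 0 and r' = 0, unfolded axis0 add_0_right]
  have bas: "axis d 1 \<in> (Basis :: (real^3) set)" by (auto simp: Basis_vec_def)
  have split: "integral (cbox u v) f =
      integral (cbox u v \<inter> {x. x $ d \<le> c}) f + integral (cbox u v \<inter> {x. x $ d \<ge> c}) f" for u v :: "real^3" and c
    using integral_split[OF int bas, of u v c] by (simp add: inner_axis)
  have shift: "integral (cbox u v) (\<lambda>x. f (x + axis d r)) = integral (cbox (u + axis d r) (v + axis d r)) f" for u v r
    using integral_shift_cbox_plus[of u v f "axis d r"] by (simp add: o_def add.commute)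
  have "integral (closed_cube a b) (\<lambda>x. f (x + axis d s)) =
        integral (cbox (vec a + axis d s) (vec b + axis d s)) f"
    by (simp add: closed_cube_def shift)
  also have "\<dots> = integral (cbox (vec a + axis d s) (vec b + axis d s) \<inter> {x. x $ d \<le> b}) f +
        integral (cbox (vec a + axis d s) (vec b + axis d s) \<inter> {x. x $ d \<ge> b}) f"
    by (rule split)
  also have "cbox (vec a + axis d s) (vec b + axis d s) \<inter> {x. x $ d \<le> b} = cbox (vec a + axis d s) (vec b)"
    using s unfolding set_eq_iff Int_iff mem_Collect_eq mem mem0 by auto
  also have "cbox (vec a + axis d s) (vec b + axis d s) \<inter> {x. x $ d \<ge> b}
      = cbox (vec a + axis d (b - a)) (vec b + axis d s)"
    using s unfolding set_eq_iff Int_iff mem_Collect_eq mem mem0 by auto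
  also have "\<dots> = cbox (vec a + axis d (b - a)) ((vec b + axis d (s - (b - a))) + axis d (b - a))"
    by (rule arg_cong2[where f = cbox, OF refl]) (simp add: vec_eq_iff nth)
  also have "integral \<dots> f = integral (cbox (vec a) (vec b + axis d (s - (b - a)))) f"
    by (subst shift[symmetric]) (simp add: per)
  also have "cbox (vec a) (vec b + axis d (s - (b - a))) = closed_cube a b \<inter> {x. x $ d \<le> a + s}"
    using s unfolding closed_cube_def set_eq_iff Int_iff mem_Collect_eq mem mem0 by auto
  also have "cbox (vec a + axis d s) (vec b) = closed_cube a b \<inter> {x. x $ d \<ge> a + s}"
    using s unfolding closed_cube_def set_eq_iff Int_iff mem_Collect_eq mem mem0 by auto
  finally show ?thesis
    using split[of "vec a" "vec b" "a + s"] by (simp add: closed_cube_def)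
qed

text \<open>Moving the base point along the line turns derivatives at parameter 0 into derivatives
  at every parameter. \<open>C_spacetime\<close> supplies the former; differentiation under the
  integral and Taylor expansion want the latter.\<close>

lemma has_vector_derivative_along_axis:
  fixes F :: "real^3 \<Rightarrow> 'a::real_normed_vector"
  assumes "\<And>x. ((\<lambda>s. F (x + s *\<^sub>R axis d 1)) has_vector_derivative F' x) (at 0)"
  shows "((\<lambda>s. F (x + s *\<^sub>R axis d 1)) has_vector_derivative F' (x + s *\<^sub>R axis d 1)) (at s within S)"
proof -
  have "((\<lambda>r. F (x + s *\<^sub>R axis d 1 + r *\<^sub>R axis d 1)) \<circ> (\<lambda>r. r - s) has_vector_derivative
      1 *\<^sub>R F' (x + s *\<^sub>R axis d 1)) (at s)"
    by (rule vector_diff_chain_at) (auto intro!: derivative_eq_intros assms)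
  then have "((\<lambda>r. F (x + r *\<^sub>R axis d 1)) has_vector_derivative F' (x + s *\<^sub>R axis d 1)) (at s)"
    by (simp add: o_def algebra_simps)
  then show ?thesis by (rule has_vector_derivative_at_within)
qed

lemma scaleR_axis: "s *\<^sub>R axis d (r::real) = axis d (s * r)"
  by (simp add: vec_eq_iff axis_def)

text \<open>The integral of the translate of \<open>F\<close> by \<open>s\<close> along axis
  \<open>d\<close> is differentiated at 0 in two ways: under the integral sign it gives the integral
  of \<open>F'\<close>, while translation invariance makes it constant in \<open>s\<close>. This
  takes the place of an iterated integral with the fundamental theorem of calculus.\<close>

lemma integral_periodic_derivative:
  fixes F :: "real^3 \<Rightarrow> 'a::euclidean_space"
  assumes ab: "a < b"
    and cont: "continuous_on UNIV F" and per: "\<And>x. F (x + axis d (b - a)) = F x"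
    and der: "\<And>x. ((\<lambda>s. F (x + s *\<^sub>R axis d 1)) has_vector_derivative F' x) (at 0)"
    and cont': "continuous_on UNIV F'"
  shows "integral (closed_cube a b) F' = 0"
proof -
  let ?U = "cbox 0 (b - a)"
  have "((\<lambda>s. integral (cbox (vec a) (vec b)) (\<lambda>x. F (x + s *\<^sub>R axis d 1))) has_vector_derivative
      integral (cbox (vec a) (vec b)) (\<lambda>x. F' (x + 0 *\<^sub>R axis d 1))) (at 0 within ?U)"
  proof (rule leibniz_rule_vector_derivative)
    show "((\<lambda>s. F (x + s *\<^sub>R axis d 1)) has_vector_derivative F' (x + s *\<^sub>R axis d 1)) (at s within ?U)" for s x
      by (rule has_vector_derivative_along_axis[OF der])
    show "(\<lambda>x. F (x + s *\<^sub>R axis d 1)) integrable_on cbox (vec a) (vec b)" for s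
      by (intro integrable_continuous continuous_on_compose2[OF cont] continuous_intros) auto
    show "continuous_on (?U \<times> cbox (vec a) (vec b)) (\<lambda>(s, x). F' (x + s *\<^sub>R axis d 1))"
      unfolding split_beta
      by (intro continuous_on_compose2[OF cont'] continuous_intros) auto
  qed (use ab in auto)
  then have 1: "((\<lambda>s. integral (closed_cube a b) (\<lambda>x. F (x + s *\<^sub>R axis d 1))) has_vector_derivative
      integral (closed_cube a b) F') (at 0 within ?U)"
    by (simp add: closed_cube_def)
  have 2: "((\<lambda>s. integral (closed_cube a b) (\<lambda>x. F (x + s *\<^sub>R axis d 1))) has_vector_derivative 0) (at 0 within ?U)"
  proof (rule has_vector_derivative_transform)
    show "((\<lambda>s. integral (closed_cube a b) F) has_vector_derivative 0) (at 0 within ?U)"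
      by (rule has_vector_derivative_const)
    show "integral (closed_cube a b) (\<lambda>x. F (x + s *\<^sub>R axis d 1)) = integral (closed_cube a b) F"
      if "s \<in> ?U" for s
      using integral_periodic_shift[OF cont per, of s] that by (simp add: scaleR_axis)
  qed (use ab in auto)
  show ?thesis
    by (rule vector_derivative_unique_within_closed_interval[OF _ _ 1 2]) (use ab in auto)
qed

section \<open>Fourier coefficients\<close>

text \<open>Complex-valued and without the volume factor, so that it applies directly to the limit
  of the partial sums, which is not known to be real until it is identified with
  \<open>f\<close>.\<close>

definition fourier_coeff_complex :: "real \<Rightarrow> real \<Rightarrow> (real^3 \<Rightarrow> complex) \<Rightarrow> int^3 \<Rightarrow> complex" where
  "fourier_coeff_complex a b f k =
     integral (closed_cube a b) (\<lambda>x. f x * cis (- fourier_phase a b k x))"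

lemma fourier_coeff_eq:
  "fourier_coeff a b f k = (1 / (b - a) ^ 3) *\<^sub>R fourier_coeff_complex a b (\<lambda>x. of_real (f x)) k"
  by (simp add: fourier_coeff_def fourier_coeff_complex_def integral_cube)

lemma fourier_phase_axis:
  "fourier_phase a b k (x + axis d s) = fourier_phase a b k x + 2 * pi / (b - a) * of_int (k $ d) * s"
proof -
  have "(\<Sum>i\<in>UNIV. real_of_int (k $ i) * (x + axis d s) $ i) =
    (\<Sum>i\<in>UNIV. real_of_int (k $ i) * x $ i) + (\<Sum>i\<in>UNIV. if i = d then real_of_int (k $ i) * s else 0)"
    unfolding sum.distrib[symmetric] by (intro sum.cong) (auto simp: axis_def algebra_simps)
  then show ?thesis by (simp add: fourier_phase_def algebra_simps)
qed

lemma fourier_phase_add: "fourier_phase a b (k + j) x = fourier_phase a b k x + fourier_phase a b j x"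
  and fourier_phase_diff: "fourier_phase a b (k - j) x = fourier_phase a b k x - fourier_phase a b j x"
  and fourier_phase_0: "fourier_phase a b 0 x = 0"
  by (simp_all add: fourier_phase_def algebra_simps sum.distrib sum_subtractf)

lemma continuous_on_fourier_phase [continuous_intros]: "continuous_on S (fourier_phase a b k)"
  unfolding fourier_phase_def by (intro continuous_intros)

lemma continuous_on_cis_fourier_phase:
  "continuous_on S (\<lambda>x. cis (fourier_phase a b k x))" "continuous_on S (\<lambda>x. cis (- fourier_phase a b k x))"
  unfolding cis_conv_exp by (intro continuous_intros)+

lemma cis_fourier_phase_periodic:
  assumes "a \<noteq> b"
  shows "cis (fourier_phase a b k (x + axis d (b - a))) = cis (fourier_phase a b k x)"
proof -
  have "cis (fourier_phase a b k (x + axis d (b - a))) = cis (fourier_phase a b k x + 2 * pi * of_int (k $ d))"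
    using assms by (simp add: fourier_phase_axis)
  also have "\<dots> = cis (fourier_phase a b k x)"
    unfolding cis_mult[symmetric] by (simp add: cis_multiple_2pi)
  finally show ?thesis .
qed

lemma cis_fourier_phase_periodic_minus:
  assumes "a \<noteq> b"
  shows "cis (- fourier_phase a b k (x + axis d (b - a))) = cis (- fourier_phase a b k x)"
  using cis_fourier_phase_periodic[OF assms, of k x d] by (metis cis_cnj)

text \<open>Along an axis with \<open>k $ d\<close> nonzero, translation by half a wavelength
  changes the sign of the integrand but not the integral, which is therefore its own
  negative.\<close>

lemma integral_cis_fourier_phase:
  assumes "a < b"
  shows "integral (closed_cube a b) (\<lambda>x. cis (fourier_phase a b k x)) = (if k = 0 then of_real ((b - a) ^ 3) else 0)"
proof (cases "k = 0")
  case True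
  then show ?thesis using assms content_closed_cube[of a b]
    by (simp add: fourier_phase_0 closed_cube_def scaleR_conv_of_real)
next
  case False
  then obtain d where d: "k $ d \<noteq> 0" by (auto simp: vec_eq_iff)
  define s where "s = (b - a) / (2 * \<bar>of_int (k $ d)\<bar>)"
  have k1: "\<bar>real_of_int (k $ d)\<bar> \<ge> 1" using d by linarith
  have s: "0 \<le> s" "s \<le> b - a"
    using assms k1 by (auto simp: s_def divide_simps mult_le_cancel_left1)
  have "2 * pi / (b - a) * of_int (k $ d) * s = (if k $ d > 0 then pi else - pi)"
    using assms d by (auto simp: s_def divide_simps)
  then have c: "cis (2 * pi / (b - a) * of_int (k $ d) * s) = -1"
    by (auto simp: complex_eq_iff)
  have "integral (closed_cube a b) (\<lambda>x. cis (fourier_phase a b k x)) =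
        integral (closed_cube a b) (\<lambda>x. cis (fourier_phase a b k (x + axis d s)))"
    using assms s by (intro integral_periodic_shift[symmetric] continuous_on_cis_fourier_phase cis_fourier_phase_periodic) auto
  also have "\<dots> = integral (closed_cube a b) (\<lambda>x. - cis (fourier_phase a b k x))"
    unfolding fourier_phase_axis cis_mult[symmetric] c by simp
  finally show ?thesis using False by simp
qed

text \<open>Integration by parts: the integrand collected at the start of the proof is the
  derivative of the periodic function \<open>f x * cis (- fourier_phase a b k x)\<close>, so its
  integral vanishes.\<close>

lemma fourier_coeff_complex_derivative:
  assumes ab: "a < b"
    and f: "continuous_on UNIV f" "\<And>x. f (x + axis d (b - a)) = f x"
    and der: "\<And>x. ((\<lambda>s. f (x + s *\<^sub>R axis d 1)) has_vector_derivative f' x) (at 0)"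
    and f': "continuous_on UNIV f'"
  shows "fourier_coeff_complex a b f' k =
    \<i> * of_real (2 * pi / (b - a) * of_int (k $ d)) * fourier_coeff_complex a b f k"
proof -
  define w where "w = 2 * pi / (b - a) * of_int (k $ d)"
  have "integral (closed_cube a b) (\<lambda>x. f' x * cis (- fourier_phase a b k x)
          - \<i> * of_real w * (f x * cis (- fourier_phase a b k x))) = 0"
  proof (rule integral_periodic_derivative[OF ab])
    show "continuous_on UNIV (\<lambda>x. f x * cis (- fourier_phase a b k x))"
      by (intro continuous_intros f continuous_on_cis_fourier_phase)
    show "f (x + axis d (b - a)) * cis (- fourier_phase a b k (x + axis d (b - a))) = f x * cis (- fourier_phase a b k x)" for x
      using ab by (simp add: f cis_fourier_phase_periodic_minus)
    show "continuous_on UNIV (\<lambda>x. f' x * cis (- fourier_phase a b k x)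
          - \<i> * of_real w * (f x * cis (- fourier_phase a b k x)))"
      by (intro continuous_intros f f' continuous_on_cis_fourier_phase)
    have cis_der: "((\<lambda>s. cis (- fourier_phase a b k (x + s *\<^sub>R axis d 1))) has_vector_derivative
        - \<i> * of_real w * cis (- fourier_phase a b k x)) (at 0)" for x
    proof -
      have "((\<lambda>s. exp (\<i> * of_real (- (fourier_phase a b k x + w * s)))) has_vector_derivative
        (\<i> * of_real (- w)) * exp (\<i> * of_real (- fourier_phase a b k x))) (at 0)"
      proof -
        have "((\<lambda>z. exp (\<i> * (- (of_real (fourier_phase a b k x) + of_real w * z)))) has_field_derivative
            (\<i> * of_real (- w)) * exp (\<i> * of_real (- fourier_phase a b k x))) (at (of_real 0))"
          by (auto intro!: derivative_eq_intros)
        from has_vector_derivative_real_field[OF this] show ?thesis by simp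
      qed
      then show ?thesis by (simp add: scaleR_axis fourier_phase_axis cis_conv_exp w_def)
    qed
    show "((\<lambda>s. f (x + s *\<^sub>R axis d 1) * cis (- fourier_phase a b k (x + s *\<^sub>R axis d 1))) has_vector_derivative
        f' x * cis (- fourier_phase a b k x) - \<i> * of_real w * (f x * cis (- fourier_phase a b k x))) (at 0)" for x
      using has_vector_derivative_mult[OF der[of x] cis_der[of x]] by (simp add: algebra_simps)
  qed
  moreover have "(\<lambda>x. f' x * cis (- fourier_phase a b k x)) integrable_on closed_cube a b"
    "(\<lambda>x. \<i> * of_real w * (f x * cis (- fourier_phase a b k x))) integrable_on closed_cube a b"
    unfolding closed_cube_def
    by (intro integrable_continuous continuous_intros continuous_on_cis_fourier_phase continuous_on_subset[OF f(1)] continuous_on_subset[OF f'] subset_UNIV)+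
  ultimately show ?thesis
    by (simp add: integral_diff fourier_coeff_complex_def w_def)
qed

lemma norm_fourier_coeff_complex_le:
  assumes "a \<le> b" "continuous_on UNIV f" "\<And>x. norm (f x) \<le> B"
  shows "norm (fourier_coeff_complex a b f k) \<le> B * (b - a) ^ 3"
proof -
  have "0 \<le> B" using assms(3)[of 0] norm_ge_zero order_trans by blast
  moreover have "(\<lambda>x. f x * cis (- fourier_phase a b k x)) integrable_on cbox (vec a) (vec b)"
    by (intro integrable_continuous continuous_intros continuous_on_cis_fourier_phase continuous_on_subset[OF assms(2)] subset_UNIV)
  ultimately have "norm (fourier_coeff_complex a b f k) \<le> B * measure lborel (cbox (vec a) (vec b :: real^3))"
    unfolding fourier_coeff_complex_def closed_cube_def
    by (rule integrable_bound) (simp add: norm_mult assms)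
  then show ?thesis using content_closed_cube[OF assms(1)] by (simp add: closed_cube_def)
qed

lemma card_index_box: "card {p :: int^3. \<forall>d. p $ d \<in> {m..n}} = nat (n - m + 1) ^ 3"
proof -
  have "bij_betw vec_lambda (UNIV \<rightarrow>\<^sub>E {m..n}) {p :: int^3. \<forall>d. p $ d \<in> {m..n}}"
    by (rule bij_betwI[where g = "\<lambda>p d. p $ d"]) auto
  then have "card {p :: int^3. \<forall>d. p $ d \<in> {m..n}} = card ((UNIV :: 3 set) \<rightarrow>\<^sub>E {m..n})"
    by (simp add: bij_betw_same_card)
  also have "\<dots> = nat (n - m + 1) ^ 3"
    by (simp add: card_PiE)
  finally show ?thesis .
qed

lemma periodic_axis_of_int:
  fixes f :: "real^3 \<Rightarrow> 'a"
  assumes "\<And>x. f (x + axis d L) = f x"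
  shows "f (x + axis d (of_int k * L)) = f x"
proof -
  have nat: "f (x + axis d (of_nat n * L)) = f x" for n x
  proof (induction n arbitrary: x)
    case (Suc n)
    have "x + axis d (of_nat (Suc n) * L) = (x + axis d (of_nat n * L)) + axis d L"
      by (simp add: vec_eq_iff axis_def algebra_simps)
    then show ?case using Suc assms by metis
  qed (simp add: vec_eq_iff axis_def, simp add: axis_def zero_vec_def[symmetric])
  show ?thesis
  proof (cases "k \<ge> 0")
    case True
    then show ?thesis using nat[of x "nat k"] by simp
  next
    case False
    then have "(x + axis d (of_int k * L)) + axis d (of_nat (nat (- k)) * L) = x"
      by (simp add: vec_eq_iff axis_def)
    then show ?thesis using nat[of "x + axis d (of_int k * L)" "nat (- k)"] by metis
  qed
qed

lemma periodic_representative: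
  assumes "a < b"
  obtains y where "y \<in> closed_cube a b"
    "\<And>f :: real^3 \<Rightarrow> 'a. (\<And>x d. f (x + axis d (b - a)) = f x) \<Longrightarrow> f y = f x"
proof
  define m where "m d = - \<lfloor>(x $ d - a) / (b - a)\<rfloor>" for d
  define y where "y = x + axis 1 (of_int (m 1) * (b - a)) + axis 2 (of_int (m 2) * (b - a)) + axis 3 (of_int (m 3) * (b - a))"
  have y: "y $ d = x $ d + of_int (m d) * (b - a)" for d
    using exhaust_3[of d] by (auto simp: y_def axis_def)
  show "y \<in> closed_cube a b"
    unfolding mem_closed_cube
  proof
    fix d
    have "of_int (- m d) \<le> (x $ d - a) / (b - a)" "(x $ d - a) / (b - a) < of_int (- m d) + 1"
      by (simp_all add: m_def)
    then show "a \<le> y $ d \<and> y $ d \<le> b"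
      using assms by (simp add: y field_simps)
  qed
  show "f y = f x" if "\<And>x d. f (x + axis d (b - a)) = f x" for f :: "real^3 \<Rightarrow> 'a"
    unfolding y_def by (simp add: periodic_axis_of_int that)
qed

text \<open>
  The powers of \<open>\<Prod>d. (1 + cos (2 \<pi> (x\<^sub>d - x0\<^sub>d) / (b - a))) / 2\<close> are trigonometric polynomials, hence
  orthogonal to \<open>w\<close>, and concentrate at \<open>x0\<close>. This replaces Fubini's theorem and one-dimensional
  Fourier series.
\<close>

lemma fourier_coeff_complex_eq_0_interior:
  assumes ab: "a < b" and cont: "continuous_on UNIV w"
    and zero: "\<And>k. fourier_coeff_complex a b w k = 0"
    and x0: "x0 \<in> cube a b"
  shows "w x0 = 0"
proof (rule ccontr)
  assume nz: "w x0 \<noteq> 0"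
  define \<theta> where "\<theta> d x = 2 * pi / (b - a) * (x $ d - x0 $ d)" for d and x :: "real^3"
  define T where "T x = (\<Prod>d\<in>UNIV. (1 + cos (\<theta> d x)) / 2)" for x
  have \<theta>_cont [continuous_intros]: "continuous_on S (\<theta> d)" for S d
    unfolding \<theta>_def by (intro continuous_intros)
  have T_cont [continuous_intros]: "continuous_on S T" for S
    unfolding T_def by (intro continuous_intros) auto
  have T01: "0 \<le> T x" "T x \<le> 1" for x
  proof -
    have *: "0 \<le> (1 + cos (\<theta> d x)) / 2" "(1 + cos (\<theta> d x)) / 2 \<le> 1" for d
      using cos_le_one[of "\<theta> d x"] cos_ge_minus_one[of "\<theta> d x"] by (simp_all del: cos_ge_minus_one)
    show "0 \<le> T x" unfolding T_def by (intro prod_nonneg * ballI)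
    show "T x \<le> 1" unfolding T_def by (intro prod_le_1 conjI *)
  qed

  \<comment> \<open>\<open>Z\<close> holds the weights \<open>g\<close> for which
    \<open>w * g\<close> still has no Fourier coefficient. Multiplication by one factor of
    \<open>T\<close> keeps a weight in \<open>Z\<close>, because the cosine merely moves the wave
    number \<open>k\<close> to its two neighbours along axis \<open>d\<close>.\<close>
  define Z where "Z = {g :: real^3 \<Rightarrow> real. continuous_on UNIV g \<and>
      (\<forall>k. integral (closed_cube a b) (\<lambda>x. w x * of_real (g x) * cis (- fourier_phase a b k x)) = 0)}"
  have Z_int: "(\<lambda>x. w x * of_real (g x) * cis (- fourier_phase a b k x)) integrable_on closed_cube a b"
    if "g \<in> Z" for g k
    unfolding closed_cube_def using that
    by (intro integrable_continuous continuous_intros continuous_on_cis_fourier_phase continuous_on_subset[OF cont])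
       (auto simp: Z_def intro: continuous_on_subset)
  have Z_step: "(\<lambda>x. g x * ((1 + cos (\<theta> d x)) / 2)) \<in> Z" if g: "g \<in> Z" for g d
  proof -
    have ph: "fourier_phase a b (axis d 1) x = 2 * pi / (b - a) * x $ d" for x
    proof -
      have "(\<Sum>i\<in>UNIV. real_of_int (axis d 1 $ i) * x $ i) = (\<Sum>i\<in>UNIV. if i = d then x $ i else 0)"
        by (intro sum.cong) (auto simp: axis_def)
      then show ?thesis by (simp add: fourier_phase_def)
    qed
    define \<beta> where "\<beta> = 2 * pi / (b - a) * x0 $ d"
    have \<theta>: "\<theta> d x = fourier_phase a b (axis d 1) x - \<beta>" for x
      by (simp add: \<theta>_def ph \<beta>_def right_diff_distrib)
    have cosc: "complex_of_real (cos t) = (cis t + cis (- t)) / 2" for t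
      by (simp add: complex_eq_iff)
    have expand: "w x * of_real (g x * ((1 + cos (\<theta> d x)) / 2)) * cis (- fourier_phase a b k x) =
       1 / 2 * (w x * of_real (g x) * cis (- fourier_phase a b k x))
       + cis (- \<beta>) / 4 * (w x * of_real (g x) * cis (- fourier_phase a b (k - axis d 1) x))
       + cis \<beta> / 4 * (w x * of_real (g x) * cis (- fourier_phase a b (k + axis d 1) x))" for k x
    proof -
      have eqs: "cis (\<theta> d x) * cis (- fourier_phase a b k x) = cis (- \<beta>) * cis (- fourier_phase a b (k - axis d 1) x)"
        "cis (- \<theta> d x) * cis (- fourier_phase a b k x) = cis \<beta> * cis (- fourier_phase a b (k + axis d 1) x)"
        by (simp_all add: cis_mult \<theta> fourier_phase_add fourier_phase_diff algebra_simps)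
      have "w x * of_real (g x * ((1 + cos (\<theta> d x)) / 2)) * cis (- fourier_phase a b k x) =
        1 / 2 * (w x * of_real (g x) * cis (- fourier_phase a b k x))
        + 1 / 4 * (w x * of_real (g x) * (cis (\<theta> d x) * cis (- fourier_phase a b k x)))
        + 1 / 4 * (w x * of_real (g x) * (cis (- \<theta> d x) * cis (- fourier_phase a b k x)))"
        by (simp add: cosc field_simps)
      then show ?thesis unfolding eqs by (simp add: mult_ac)
    qed
    have int0: "integral (closed_cube a b) (\<lambda>x. 1 / 2 * (w x * of_real (g x) * cis (- fourier_phase a b k x))
       + cis (- \<beta>) / 4 * (w x * of_real (g x) * cis (- fourier_phase a b (k - axis d 1) x))
       + cis \<beta> / 4 * (w x * of_real (g x) * cis (- fourier_phase a b (k + axis d 1) x))) = 0" for k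
    proof -
      have "((\<lambda>x. w x * of_real (g x) * cis (- fourier_phase a b j x)) has_integral 0) (closed_cube a b)" for j
        using g integrable_integral[OF Z_int[OF g, of j]] by (simp add: Z_def)
      from has_integral_add[OF has_integral_add[OF has_integral_mult_right[OF this, of "1/2" k]
          has_integral_mult_right[OF this, of "cis (-\<beta>) / 4" "k - axis d 1"]]
          has_integral_mult_right[OF this, of "cis \<beta> / 4" "k + axis d 1"]]
      show ?thesis by (simp add: integral_unique)
    qed
    show ?thesis
      unfolding Z_def mem_Collect_eq expand int0
      using g by (auto simp: Z_def intro!: continuous_intros)
  qed
  have Z_T: "(\<lambda>x. g x * T x) \<in> Z" if "g \<in> Z" for g
  proof -
    have "(\<lambda>x. g x * (\<Prod>d\<in>D. (1 + cos (\<theta> d x)) / 2)) \<in> Z" if "finite D" for D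
      using that
    proof induction
      case (insert d D)
      from Z_step[OF insert.IH, of d] insert.hyps show ?case by (simp add: mult_ac)
    qed (use \<open>g \<in> Z\<close> in simp)
    from this[of UNIV] show ?thesis by (simp add: T_def)
  qed
  have Z_pow: "(\<lambda>x. T x ^ n) \<in> Z" for n
  proof (induction n)
    case 0
    show ?case using zero by (simp add: Z_def fourier_coeff_complex_def)
  next
    case (Suc n)
    from Z_T[OF this] show ?case by (simp add: mult.commute)
  qed

  \<comment> \<open>The component of \<open>w\<close> in the direction of \<open>w x0\<close> is a
    real function with \<open>u x0 = |w x0|^2 > 0\<close>, for which a sign argument is
    possible.\<close>
  define u where "u x = Re (cnj (w x0) * w x)" for x
  have u_cont [continuous_intros]: "continuous_on S u" for S
    unfolding u_def by (intro continuous_intros continuous_on_subset[OF cont]) auto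
  have u_int: "((\<lambda>x. u x * T x ^ n) has_integral 0) (closed_cube a b)" for n
  proof -
    have "((\<lambda>x. w x * of_real (T x ^ n) * cis (- fourier_phase a b 0 x)) has_integral 0) (closed_cube a b)"
      using Z_pow[of n] integrable_integral[OF Z_int[OF Z_pow[of n], of 0]] by (simp add: Z_def)
    then have "((\<lambda>x. Re (cnj (w x0) * (w x * of_real (T x ^ n)))) has_integral Re (cnj (w x0) * 0)) (closed_cube a b)"
      by (intro has_integral_Re has_integral_mult_right) (simp add: fourier_phase_0)
    then show ?thesis by (simp add: u_def mult.assoc[symmetric] flip: of_real_power)
  qed
  define \<epsilon> where "\<epsilon> = u x0 / 2"
  have "u x0 = (cmod (w x0))\<^sup>2"
    by (simp add: u_def cmod_power2) (simp add: power2_eq_square)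
  then have u0: "u x0 > 0" using nz by simp
  then have \<epsilon>: "\<epsilon> > 0" "u x0 > \<epsilon>" by (simp_all add: \<epsilon>_def)
  have comp: "compact (closed_cube a b)" by (simp add: closed_cube_def)
  have x0_in: "x0 \<in> closed_cube a b" using x0 by (auto simp: cube_def mem_closed_cube less_imp_le)
  obtain B where B: "\<And>x. x \<in> closed_cube a b \<Longrightarrow> \<bar>u x\<bar> \<le> B"
    using compact_imp_bounded[OF compact_continuous_image[OF u_cont comp]]
    by (auto simp: bounded_iff)
  have B0: "B \<ge> 0" using B[OF x0_in] by linarith
  \<comment> \<open>On the closed cube \<open>T\<close> attains its maximum at \<open>x0\<close>
    alone: as \<open>x0\<close> is interior, no other point of the cube differs from it by a full
    period along an axis.\<close>
  have T_lt: "T x < 1" if x: "x \<in> closed_cube a b" "x \<noteq> x0" for x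
  proof -
    obtain d where d: "x $ d \<noteq> x0 $ d" using x(2) by (auto simp: vec_eq_iff)
    have "cos (\<theta> d x) \<noteq> 1"
    proof
      assume "cos (\<theta> d x) = 1"
      then obtain j :: int where "\<theta> d x = of_int j * 2 * pi"
        using cos_one_2pi_int by auto
      then have "2 * pi * ((x $ d - x0 $ d) / (b - a)) = 2 * pi * of_int j"
        by (simp add: \<theta>_def mult_ac)
      then have "(x $ d - x0 $ d) / (b - a) = of_int j"
        unfolding mult_cancel_left by simp
      then have j: "x $ d - x0 $ d = of_int j * (b - a)"
        using ab by (simp add: divide_eq_eq)
      have "\<bar>x $ d - x0 $ d\<bar> < b - a"
        using x(1)[unfolded mem_closed_cube, rule_format, of d] x0[unfolded cube_def mem_Collect_eq, rule_format, of d]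
        by linarith
      then have "\<bar>real_of_int j\<bar> * (b - a) < 1 * (b - a)" using ab by (simp add: j abs_mult)
      then have "\<bar>real_of_int j\<bar> < 1" using ab by (simp only: mult_less_cancel_right_pos diff_gt_0_iff_gt)
      then have "j = 0" by linarith
      with j d show False by simp
    qed
    then have lt: "(1 + cos (\<theta> d x)) / 2 < 1" by (simp add: less_le)
    have *: "0 \<le> (1 + cos (\<theta> d x)) / 2" "(1 + cos (\<theta> d x)) / 2 \<le> 1" for d
      using cos_le_one[of "\<theta> d x"] cos_ge_minus_one[of "\<theta> d x"] by (simp_all del: cos_ge_minus_one)
    have "T x = (1 + cos (\<theta> d x)) / 2 * (\<Prod>d\<in>UNIV - {d}. (1 + cos (\<theta> d x)) / 2)"
      unfolding T_def by (rule prod.remove) auto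
    also have "\<dots> \<le> (1 + cos (\<theta> d x)) / 2 * 1"
      by (intro mult_left_mono prod_le_1 conjI *)
    finally show ?thesis using lt by simp
  qed
  define V where "V = {x. u x > \<epsilon>}"
  have V: "open V" unfolding V_def by (intro open_Collect_less continuous_intros)
  obtain r1 where r1: "0 \<le> r1" "r1 < 1" "\<And>x. x \<in> closed_cube a b - V \<Longrightarrow> T x \<le> r1"
  proof (cases "closed_cube a b - V = {}")
    case True
    then show ?thesis using that[of 0] by auto
  next
    case False
    have "compact (closed_cube a b - V)" using comp V by (rule compact_diff)
    from continuous_attains_sup[OF this False T_cont] obtain y where
      y: "y \<in> closed_cube a b - V" "\<And>x. x \<in> closed_cube a b - V \<Longrightarrow> T x \<le> T y" by auto
    have "y \<noteq> x0" using y(1) \<epsilon> by (auto simp: V_def)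
    then show ?thesis using that[of "T y"] T01 T_lt y by auto
  qed
  define r0 where "r0 = (1 + r1) / 2"
  have r0: "r1 < r0" "r0 < 1" "0 < r0" using r1 by (auto simp: r0_def)
  define W where "W = V \<inter> {x. r0 < T x} \<inter> cube a b"
  have cube_box: "cube a b = box (vec a) (vec b)" by (auto simp: cube_def mem_box_cart)
  have "open W" unfolding W_def cube_box by (intro open_Int V open_Collect_less continuous_intros open_box)
  moreover have "x0 \<in> W"
    using x0 \<epsilon> r0 by (auto simp: W_def V_def T_def \<theta>_def)
  ultimately obtain c e where ce: "x0 \<in> box c e" "cbox c e \<subseteq> W"
    by (metis open_contains_cbox)
  define v where "v = measure lborel (cbox c e)"
  have v: "v > 0" using ce(1) unfolding v_def
    by (subst content_pos_lt_eq) (auto simp: mem_box intro: less_trans)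
  define vol where "vol = (b - a) ^ 3"
  \<comment> \<open>Against \<open>u\<close> every power of \<open>T\<close> integrates to 0. On the
    small box around \<open>x0\<close> the integrand is at least \<open>\<epsilon> * r0 ^ n\<close>,
    elsewhere in \<open>V\<close> it is nonnegative, and outside \<open>V\<close> it is at least
    \<open>- B * r1 ^ n\<close>. As \<open>r1 < r0\<close>, a large \<open>n\<close> gives a
    contradiction.\<close>
  have ineq: "\<epsilon> * r0 ^ n * v \<le> B * vol * r1 ^ n" for n
  proof -
    have sub: "cbox c e \<subseteq> closed_cube a b"
      using ce(2) by (auto simp: W_def cube_def mem_closed_cube less_imp_le subset_iff)
    have "((\<lambda>x. \<epsilon> * r0 ^ n) has_integral (v *\<^sub>R (\<epsilon> * r0 ^ n))) (cbox c e)"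
      unfolding v_def by (rule has_integral_const)
    then have 1: "((\<lambda>x. if x \<in> cbox c e then \<epsilon> * r0 ^ n else 0) has_integral (v *\<^sub>R (\<epsilon> * r0 ^ n))) (closed_cube a b)"
      using sub by (simp add: has_integral_restrict)
    have 2: "((\<lambda>x. B * r1 ^ n) has_integral (vol *\<^sub>R (B * r1 ^ n))) (closed_cube a b)"
      using has_integral_const[of "B * r1 ^ n" "vec a :: real^3" "vec b"] content_closed_cube[of a b] ab
      by (simp add: closed_cube_def vol_def)
    have "v *\<^sub>R (\<epsilon> * r0 ^ n) - vol *\<^sub>R (B * r1 ^ n) \<le> 0"
    proof (rule has_integral_le[OF has_integral_diff[OF 1 2] u_int[of n]])
      fix x assume x: "x \<in> closed_cube a b"
      have rn: "0 \<le> B * r1 ^ n" using B0 r1 by simp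
      show "(if x \<in> cbox c e then \<epsilon> * r0 ^ n else 0) - B * r1 ^ n \<le> u x * T x ^ n"
      proof (cases "x \<in> V")
        case True
        then have "\<epsilon> \<le> u x" by (simp add: V_def)
        then have p: "0 \<le> u x * T x ^ n" using \<epsilon> T01[of x] by simp
        have "\<epsilon> * r0 ^ n \<le> u x * T x ^ n" if "x \<in> cbox c e"
          using that ce(2) \<open>\<epsilon> \<le> u x\<close> \<epsilon> r0 by (intro mult_mono power_mono) (auto simp: W_def)
        with p rn show ?thesis by (auto split: if_splits)
      next
        case False
        then have nx: "x \<notin> cbox c e" using ce(2) by (auto simp: W_def)
        have "\<bar>u x * T x ^ n\<bar> \<le> B * r1 ^ n"
          unfolding abs_mult using x False B0 r1 T01[of x]
          by (intro mult_mono B) (auto simp: power_abs intro!: power_mono)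
        then show ?thesis using nx by simp
      qed
    qed
    then show ?thesis by (simp add: mult_ac)
  qed
  define q where "q = \<epsilon> * v / (B * vol + 1)"
  have vol: "vol > 0" using ab by (simp add: vol_def)
  have q: "q > 0" using \<epsilon> v B0 vol by (auto simp: q_def intro!: divide_pos_pos add_nonneg_pos)
  obtain n where n: "(r1 / r0) ^ n < q"
    using real_arch_pow_inv[OF q, of "r1 / r0"] r0 by auto
  have pos: "B * vol + 1 > 0" using B0 vol by (auto intro!: add_nonneg_pos)
  have "\<epsilon> * v \<le> B * vol * (r1 / r0) ^ n"
    using ineq[of n] r0 by (simp add: power_divide field_simps)
  also have "\<dots> \<le> (B * vol + 1) * (r1 / r0) ^ n"
    using r0 r1 by (intro mult_right_mono) auto
  also have "\<dots> < (B * vol + 1) * q" using n pos by simp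
  also have "\<dots> = \<epsilon> * v" using pos by (simp add: q_def)
  finally show False by simp
qed

text \<open>Density of the open cube in the closed one extends the interior result to the faces, and
  periodicity moves any point into the closed cube.\<close>

lemma fourier_coeff_complex_eq_0_imp:
  assumes ab: "a < b" and cont: "continuous_on UNIV w"
    and per: "\<And>x d. w (x + axis d (b - a)) = w x"
    and zero: "\<And>k. fourier_coeff_complex a b w k = 0"
  shows "w x = 0"
proof -
  obtain y where y: "y \<in> closed_cube a b" "w y = w x"
    using periodic_representative[OF ab] per by metis
  have "closure (cube a b) = closed_cube a b"
  proof -
    have "cube a b = box (vec a) (vec b)" by (auto simp: cube_def mem_box_cart)
    moreover have "box (vec a) (vec b :: real^3) \<noteq> {}"
      using ab by (simp add: interval_eq_empty_cart not_le)
    ultimately show ?thesis by (simp add: closure_box closed_cube_def)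
  qed
  then have "w y = 0"
    using continuous_constant_on_closure[of "cube a b" w 0 y] y(1)
      fourier_coeff_complex_eq_0_interior[OF ab cont zero] continuous_on_subset[OF cont]
    by auto
  with y show ?thesis by simp
qed

section \<open>Accuracy of the Fourier projection\<close>

lemma C_spacetime_imp_continuous:
  "C_spacetime T m f \<Longrightarrow> continuous_on ({0..T} \<times> UNIV) (\<lambda>(t, x). f t x)"
  by (cases m) auto

lemma C_spacetime_continuous_space:
  assumes "C_spacetime T m f" "t \<in> {0..T}"
  shows "continuous_on UNIV (f t)"
proof -
  have "continuous_on UNIV (\<lambda>x. (\<lambda>(t, x). f t x) (t, x))"
    using assms(2)
    by (intro continuous_on_compose2[OF C_spacetime_imp_continuous[OF assms(1)]] continuous_intros) auto
  then show ?thesis by simp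
qed

lemma C_spacetime_bounded:
  assumes C: "C_spacetime T m f" and per: "\<And>t. t \<in> {0..T} \<Longrightarrow> space_periodic L (f t)" and L: "L > 0"
  obtains B where "B > 0" "\<And>t x. t \<in> {0..T} \<Longrightarrow> \<bar>f t x\<bar> \<le> B"
proof -
  have "compact ((\<lambda>(t, x). f t x) ` ({0..T} \<times> closed_cube 0 L))"
    by (intro compact_continuous_image continuous_on_subset[OF C_spacetime_imp_continuous[OF C]] compact_Times)
       (auto simp: closed_cube_def)
  from compact_imp_bounded[OF this] obtain B where
    B: "B > 0" "\<And>t x. t \<in> {0..T} \<Longrightarrow> x \<in> closed_cube 0 L \<Longrightarrow> \<bar>f t x\<bar> \<le> B"
    by (force simp: bounded_pos)
  have "\<bar>f t x\<bar> \<le> B" if t: "t \<in> {0..T}" for t x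
  proof -
    obtain y where "y \<in> closed_cube 0 L" "f t y = f t x"
      using periodic_representative[OF L, of x] per[OF t] unfolding space_periodic_def by (metis diff_zero)
    with B(2)[OF t] show ?thesis by metis
  qed
  with B(1) show ?thesis by (rule that)
qed

lemma space_periodic_derivative:
  assumes "space_periodic L f"
    and "\<And>x. ((\<lambda>s. f (x + s *\<^sub>R axis d 1)) has_real_derivative fd x) (at 0)"
  shows "space_periodic L fd"
  unfolding space_periodic_def
proof (intro allI)
  fix x i
  have "f (x + axis i L + s *\<^sub>R axis d 1) = f (x + s *\<^sub>R axis d 1)" for s
    using assms(1) unfolding space_periodic_def by (metis add.commute add.left_commute)
  then have "((\<lambda>s. f (x + s *\<^sub>R axis d 1)) has_real_derivative fd (x + axis i L)) (at 0)"
    using assms(2)[of "x + axis i L"] by simp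
  then show "fd (x + axis i L) = fd x"
    using assms(2) by (rule DERIV_unique)
qed

text \<open>Each derivative in direction \<open>d\<close> yields one factor of the frequency, and
  the last derivative is merely bounded. Compactness of \<open>[0,T]\<close> times a period cell
  makes the bound uniform in time.\<close>

lemma fourier_coeff_complex_decay:
  assumes ab: "a < b" and "C_spacetime T m f"
    and "\<And>t. t \<in> {0..T} \<Longrightarrow> space_periodic (b - a) (f t)"
  shows "\<exists>B. \<forall>t\<in>{0..T}. \<forall>k.
    \<bar>2 * pi / (b - a) * of_int (k $ d)\<bar> ^ m * norm (fourier_coeff_complex a b (\<lambda>x. of_real (f t x)) k) \<le> B"
  using assms(2,3)
proof (induction m arbitrary: f)
  case 0
  obtain B where B: "B > 0" "\<And>t x. t \<in> {0..T} \<Longrightarrow> \<bar>f t x\<bar> \<le> B"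
    using C_spacetime_bounded[OF 0] ab by (metis diff_gt_0_iff_gt)
  have "norm (fourier_coeff_complex a b (\<lambda>x. of_real (f t x)) k) \<le> B * (b - a) ^ 3" if "t \<in> {0..T}" for t k
    using ab B(2) that C_spacetime_continuous_space[OF 0(1) that]
    by (intro norm_fourier_coeff_complex_le continuous_intros) auto
  then show ?case by (intro exI[of _ "B * (b - a) ^ 3"]) auto
next
  case (Suc m)
  obtain fd where fd: "\<And>t x. t \<in> {0..T} \<Longrightarrow> ((\<lambda>s. f t (x + s *\<^sub>R axis d 1)) has_real_derivative fd t x) (at 0)"
    and Cfd: "C_spacetime T m fd"
    using Suc.prems(1) by (auto simp: Ball_def) metis
  have "space_periodic (b - a) (fd t)" if "t \<in> {0..T}" for t
    using space_periodic_derivative[OF Suc.prems(2) fd] that by blast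
  from Suc.IH[OF Cfd this] obtain B where
    B: "\<And>t k. t \<in> {0..T} \<Longrightarrow> \<bar>2 * pi / (b - a) * of_int (k $ d)\<bar> ^ m * norm (fourier_coeff_complex a b (\<lambda>x. of_real (fd t x)) k) \<le> B"
    by blast
  have "fourier_coeff_complex a b (\<lambda>x. of_real (fd t x)) k =
    \<i> * of_real (2 * pi / (b - a) * of_int (k $ d)) * fourier_coeff_complex a b (\<lambda>x. of_real (f t x)) k"
    if t: "t \<in> {0..T}" for t k
  proof (rule fourier_coeff_complex_derivative[OF ab])
    show "((\<lambda>s. complex_of_real (f t (x + s *\<^sub>R axis d 1))) has_vector_derivative of_real (fd t x)) (at 0)" for x
      using fd[OF t, of x] has_vector_derivative_of_real has_real_derivative_iff_has_vector_derivative by blast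
    show "of_real (f t (x + axis d (b - a))) = complex_of_real (f t x)" for x
      using Suc.prems(2)[OF t] by (simp add: space_periodic_def)
  qed (intro continuous_intros C_spacetime_continuous_space[OF _ t]; fact)+
  then have "norm (fourier_coeff_complex a b (\<lambda>x. of_real (fd t x)) k) =
      \<bar>2 * pi / (b - a) * of_int (k $ d)\<bar> * norm (fourier_coeff_complex a b (\<lambda>x. of_real (f t x)) k)"
    if "t \<in> {0..T}" for t k
    using that by (simp only: norm_mult norm_of_real norm_ii mult_1)
  with B show ?case
    by (intro exI[of _ B]) (auto simp: mult_ac)
qed

lemma fourier_coeff_complex_diff:
  assumes "continuous_on UNIV f" "continuous_on UNIV g"
  shows "fourier_coeff_complex a b (\<lambda>x. f x - g x) k = fourier_coeff_complex a b f k - fourier_coeff_complex a b g k"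
proof -
  have "(\<lambda>x. u x * cis (- fourier_phase a b k x)) integrable_on cbox (vec a) (vec b)" if "continuous_on UNIV u" for u
    using that by (intro integrable_continuous continuous_intros continuous_on_cis_fourier_phase) (auto intro: continuous_on_subset)
  with assms show ?thesis
    by (simp add: fourier_coeff_complex_def left_diff_distrib integral_diff closed_cube_def)
qed

lemma fourier_coeff_complex_trig_poly:
  assumes "a < b" "finite I"
  shows "fourier_coeff_complex a b (\<lambda>x. \<Sum>k\<in>I. C k * cis (fourier_phase a b k x)) j =
    (if j \<in> I then C j * of_real ((b - a) ^ 3) else 0)"
proof -
  have int: "((\<lambda>x. C k * cis (fourier_phase a b (k - j) x)) has_integral
      (C k * (if k = j then of_real ((b - a) ^ 3) else 0))) (closed_cube a b)" for k
  proof (rule has_integral_mult_right)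
    have "(\<lambda>x. cis (fourier_phase a b (k - j) x)) integrable_on closed_cube a b"
      unfolding closed_cube_def by (intro integrable_continuous continuous_on_cis_fourier_phase)
    then show "((\<lambda>x. cis (fourier_phase a b (k - j) x)) has_integral (if k = j then of_real ((b - a) ^ 3) else 0)) (closed_cube a b)"
      using integral_cis_fourier_phase[OF assms(1), of "k - j"] by (simp add: has_integral_iff)
  qed
  have cis_eq: "cis (fourier_phase a b k x) * cis (- fourier_phase a b j x) = cis (fourier_phase a b (k - j) x)" for k x
    by (simp add: cis_mult fourier_phase_diff)
  have "fourier_coeff_complex a b (\<lambda>x. \<Sum>k\<in>I. C k * cis (fourier_phase a b k x)) j =
    integral (closed_cube a b) (\<lambda>x. \<Sum>k\<in>I. C k * cis (fourier_phase a b (k - j) x))"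
    unfolding fourier_coeff_complex_def sum_distrib_right mult.assoc cis_eq ..
  also have "\<dots> = (\<Sum>k\<in>I. C k * (if k = j then of_real ((b - a) ^ 3) else 0))"
    by (rule integral_unique[OF has_integral_sum[OF assms(2) int]])
  also have "\<dots> = (\<Sum>k\<in>I. if k = j then C j * of_real ((b - a) ^ 3) else 0)"
    by (intro sum.cong) auto
  finally show ?thesis using assms(2) by simp
qed

text \<open>A discrete integral test: the increments of the partial Fourier sums are bounded by
  inverse fifth powers, and domination by differences of inverse fourth powers makes the tail
  telescope.\<close>

lemma inverse_fourth_power_telescope:
  assumes "K \<ge> (1::nat)"
  shows "1 / real (Suc K) ^ 5 \<le> 1 / real K ^ 4 - 1 / real (Suc K) ^ 4"
proof -
  define x where "x = real K"
  have x: "x \<ge> 1" using assms by (simp add: x_def)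
  have "x ^ 4 \<le> (x + 1) * ((x + 1) ^ 4 - x ^ 4)"
  proof -
    have "(x + 1) * ((x + 1) ^ 4 - x ^ 4) - x ^ 4 = 3 * x ^ 4 + 10 * x ^ 3 + 10 * x ^ 2 + 5 * x + 1"
      by algebra
    moreover have "\<dots> \<ge> 0" using x by (intro add_nonneg_nonneg) auto
    ultimately show ?thesis by linarith
  qed
  then have "1 / (x + 1) ^ 5 \<le> ((x + 1) ^ 4 - x ^ 4) / (x ^ 4 * (x + 1) ^ 4)"
    using x by (simp add: divide_simps) (simp add: algebra_simps power_numeral_reduce)
  also have "\<dots> = 1 / x ^ 4 - 1 / (x + 1) ^ 4"
    using x by (simp add: divide_simps)
  finally show ?thesis by (simp add: x_def add.commute)
qed

text \<open>
  Eight derivatives make the coefficients decay like the eighth power of the largest wave number \<open>j\<close>;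
  as at most \<open>O(j\<^sup>3)\<close> modes have that largest wave number, the tail beyond \<open>K\<close> is \<open>O(1 / K ^ 4)\<close>.
\<close>

lemma fourier_proj_error:
  assumes ab: "a < b" and C: "C_spacetime T 8 f"
    and per: "\<And>t. t \<in> {0..T} \<Longrightarrow> space_periodic (b - a) (f t)"
  obtains B where "B \<ge> 0"
    "\<And>t K x. t \<in> {0..T} \<Longrightarrow> K \<ge> 1 \<Longrightarrow> \<bar>f t x - fourier_proj a b K (f t) x\<bar> \<le> B / real K ^ 4"
proof -
  define c where "c t k = fourier_coeff_complex a b (\<lambda>x. of_real (f t x)) k" for t k
  define L where "L = b - a"
  have L: "L > 0" using ab by (simp add: L_def)
  have "\<exists>B. \<forall>t\<in>{0..T}. \<forall>k. \<bar>2 * pi / L * of_int (k $ d)\<bar> ^ 8 * norm (c t k) \<le> B" for d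
    unfolding c_def L_def by (rule fourier_coeff_complex_decay[OF ab C per])
  then obtain Bd where Bd: "\<And>d t k. t \<in> {0..T} \<Longrightarrow> \<bar>2 * pi / L * of_int (k $ d)\<bar> ^ 8 * norm (c t k) \<le> Bd d"
    by metis
  define B2 where "B2 = (\<Sum>d\<in>UNIV. \<bar>Bd d\<bar>) * (L / (2 * pi)) ^ 8 / L ^ 3"
  have B2: "B2 \<ge> 0" using L by (auto simp: B2_def intro!: mult_nonneg_nonneg sum_nonneg)
  have decay: "norm (c t k / of_real (L ^ 3)) \<le> B2 / j ^ 8" if t: "t \<in> {0..T}" and j: "j > 0" "j \<le> \<bar>of_int (k $ d)\<bar>" for t k d j
  proof -
    have "(2 * pi / L * j) ^ 8 * norm (c t k) \<le> \<bar>2 * pi / L * of_int (k $ d)\<bar> ^ 8 * norm (c t k)"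
      using j L by (intro mult_right_mono power_mono) (auto simp: abs_mult intro!: divide_right_mono)
    also have "\<dots> \<le> Bd d" by (rule Bd[OF t])
    also have "\<dots> \<le> \<bar>Bd d\<bar>" by simp
    also have "\<dots> \<le> (\<Sum>d\<in>UNIV. \<bar>Bd d\<bar>)"
      by (rule member_le_sum) auto
    finally have "norm (c t k) \<le> (\<Sum>d\<in>UNIV. \<bar>Bd d\<bar>) / (2 * pi / L * j) ^ 8"
      using j L by (simp add: pos_le_divide_eq mult.commute)
    also have "\<dots> = (\<Sum>d\<in>UNIV. \<bar>Bd d\<bar>) * (L / (2 * pi)) ^ 8 / j ^ 8"
      by (simp add: power_mult_distrib power_divide)
    finally show ?thesis
      using L by (simp add: norm_divide norm_power B2_def divide_right_mono field_simps)
  qed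
  define I where "I K = {k :: int^3. \<forall>d. k $ d \<in> {- int K..int K}}" for K
  have fin: "finite (I K)" for K unfolding I_def by (rule finite_index_box)
  define S where "S t K x = (\<Sum>k\<in>I K. c t k / of_real (L ^ 3) * cis (fourier_phase a b k x))" for t K x
  \<comment> \<open>The box of size \<open>K + 1\<close> has
    \<open>(2 K + 3)^3 <= 27 (K + 1)^3\<close> modes, and each one outside the box of size
    \<open>K\<close> contributes at most \<open>B2 / (K + 1)^8\<close>.\<close>
  define D where "D = 27 * B2"
  have D: "D \<ge> 0" using B2 by (simp add: D_def)
  have step: "norm (S t (Suc K) x - S t K x) \<le> D / real (Suc K) ^ 5" if t: "t \<in> {0..T}" for t K x
  proof -
    have sub: "I K \<subseteq> I (Suc K)"
    proof
      fix k assume "k \<in> I K"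
      then have "- int K \<le> k $ d \<and> k $ d \<le> int K" for d by (simp add: I_def)
      then have "- int (Suc K) \<le> k $ d \<and> k $ d \<le> int (Suc K)" for d by (smt (verit) of_nat_Suc)
      then show "k \<in> I (Suc K)" by (simp add: I_def)
    qed
    have "S t (Suc K) x - S t K x = (\<Sum>k\<in>I (Suc K) - I K. c t k / of_real (L ^ 3) * cis (fourier_phase a b k x))"
      unfolding S_def by (rule sum_diff[OF fin sub, symmetric])
    also have "norm \<dots> \<le> (\<Sum>k\<in>I (Suc K) - I K. B2 / real (Suc K) ^ 8)"
    proof (rule sum_norm_le)
      fix k assume "k \<in> I (Suc K) - I K"
      then obtain d where "\<not> k $ d \<in> {- int K..int K}" by (auto simp: I_def)
      then have "\<bar>k $ d\<bar> \<ge> int (Suc K)" by auto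
      then have "real (Suc K) \<le> \<bar>of_int (k $ d)\<bar>" by linarith
      moreover have "real (Suc K) > 0" by simp
      ultimately have "norm (c t k / of_real (L ^ 3)) \<le> B2 / real (Suc K) ^ 8" by (intro decay[OF t])
      then show "norm (c t k / of_real (L ^ 3) * cis (fourier_phase a b k x)) \<le> B2 / real (Suc K) ^ 8"
        by (simp only: norm_mult norm_cis mult_1_right)
    qed
    also have "\<dots> \<le> real (card (I (Suc K))) * (B2 / real (Suc K) ^ 8)"
    proof -
      have "card (I (Suc K) - I K) \<le> card (I (Suc K))" by (intro card_mono fin) auto
      then show ?thesis unfolding sum_constant using B2 by (intro mult_right_mono divide_nonneg_nonneg) auto
    qed
    also have "\<dots> \<le> (3 * real (Suc K)) ^ 3 * (B2 / real (Suc K) ^ 8)"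
    proof (rule mult_right_mono)
      have "card (I (Suc K)) = (2 * K + 3) ^ 3"
      proof -
        have "nat (int (Suc K) - - int (Suc K) + 1) = 2 * K + 3" by linarith
        then show ?thesis unfolding I_def card_index_box by (simp only:)
      qed
      also have "\<dots> \<le> (3 * Suc K) ^ 3" by (intro power_mono) auto
      finally show "real (card (I (Suc K))) \<le> (3 * real (Suc K)) ^ 3"
        by (metis of_nat_le_iff of_nat_mult of_nat_numeral of_nat_power)
    qed (use B2 in auto)
    also have "\<dots> = D / real (Suc K) ^ 5"
      by (simp add: D_def power_mult_distrib divide_simps del: of_nat_Suc flip: power_add)
    finally show ?thesis .
  qed
  have tel: "norm (S t (K + j) x - S t K x) \<le> D / real K ^ 4 - D / real (K + j) ^ 4"
    if t: "t \<in> {0..T}" and K: "K \<ge> 1" for t K j x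
  proof (induction j)
    case (Suc j)
    have "norm (S t (K + Suc j) x - S t K x) \<le> norm (S t (Suc (K + j)) x - S t (K + j) x) + norm (S t (K + j) x - S t K x)"
      using norm_triangle_ineq[of "S t (Suc (K + j)) x - S t (K + j) x" "S t (K + j) x - S t K x"] by simp
    also have "norm (S t (Suc (K + j)) x - S t (K + j) x) \<le> D * (1 / real (Suc (K + j)) ^ 5)"
      using step[OF t, of "K + j" x] by simp
    also have "\<dots> \<le> D * (1 / real (K + j) ^ 4 - 1 / real (Suc (K + j)) ^ 4)"
      using K D by (intro mult_left_mono inverse_fourth_power_telescope) auto
    also note Suc
    finally show ?case by (simp add: right_diff_distrib)
  qed simp
  have tail: "norm (S t n x - S t K x) \<le> D / real K ^ 4" if "t \<in> {0..T}" "K \<ge> 1" "n \<ge> K" for t K n x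
    using tel[OF that(1,2), of "n - K" x] that(3) D
    by (smt (verit) divide_nonneg_nonneg le_add_diff_inverse of_nat_0_le_iff zero_le_power)
  have small: "\<exists>K\<ge>1. \<forall>n\<ge>K. E / real n ^ 4 < e" if "e > 0" "E \<ge> 0" for e E :: real
  proof -
    obtain K0 :: nat where K0: "E / e < real K0" using reals_Archimedean2 by blast
    have "E / real n ^ 4 < e" if n: "n \<ge> K0 + 1" for n
    proof -
      have le: "E / real n ^ 4 \<le> E / real n"
        using n \<open>E \<ge> 0\<close> by (intro divide_left_mono self_le_power) auto
      have "E < e * real K0"
        using K0 \<open>e > 0\<close> by (simp add: divide_less_eq mult.commute)
      also have "\<dots> \<le> e * real n" using n \<open>e > 0\<close> by (intro mult_left_mono) auto
      finally have "E / real n < e" using n by (simp add: divide_less_eq)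
      with le show ?thesis by simp
    qed
    then show ?thesis by (intro exI[of _ "K0 + 1"]) auto
  qed
  have err: "\<bar>f t x - fourier_proj a b K (f t) x\<bar> \<le> D / real K ^ 4" if t: "t \<in> {0..T}" and K: "K \<ge> 1" for t K x
  proof -
    have fcont: "continuous_on UNIV (\<lambda>x. complex_of_real (f t x))"
      by (intro continuous_intros C_spacetime_continuous_space[OF C t])
    have Scont: "continuous_on UNIV (S t n)" for n
      unfolding S_def by (intro continuous_intros continuous_on_cis_fourier_phase)
    have "Cauchy (\<lambda>n. S t n x)" for x
      unfolding Cauchy_altdef2
    proof (intro allI impI)
      fix e :: real assume "e > 0"
      from small[OF this D] obtain n where "n \<ge> 1" "D / real n ^ 4 < e" by auto
      with tail[OF t, of n] show "\<exists>n. \<forall>m\<ge>n. dist (S t m x) (S t n x) < e"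
        unfolding dist_norm using le_less_trans by blast
    qed
    then have conv: "convergent (\<lambda>n. S t n x)" for x by (simp add: Cauchy_convergent)
    define g where "g x = lim (\<lambda>n. S t n x)" for x
    have lim: "(\<lambda>n. S t n x) \<longlonglongrightarrow> g x" for x
      using conv unfolding g_def by (simp add: convergent_LIMSEQ_iff)
    have gS: "norm (g x - S t n x) \<le> D / real n ^ 4" if "n \<ge> 1" for n x
    proof (rule Lim_norm_ubound)
      show "(\<lambda>m. S t m x - S t n x) \<longlonglongrightarrow> g x - S t n x" by (intro tendsto_intros lim)
      show "\<forall>\<^sub>F m in sequentially. norm (S t m x - S t n x) \<le> D / real n ^ 4"
        using tail[OF t that] by (intro eventually_sequentiallyI[of n])
    qed simp
    have "uniform_limit UNIV (S t) g sequentially"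
    proof (rule uniform_limitI)
      fix e :: real assume "e > 0"
      from small[OF this D] obtain n where n: "n \<ge> 1" "\<And>m. m \<ge> n \<Longrightarrow> D / real m ^ 4 < e" by blast
      then show "\<forall>\<^sub>F n in sequentially. \<forall>x\<in>UNIV. dist (S t n x) (g x) < e"
        using gS by (intro eventually_sequentiallyI[of n]) (metis dist_commute dist_norm le_less_trans order_trans)
    qed
    then have gcont: "continuous_on UNIV g"
      by (rule uniform_limit_theorem[rotated]) (simp_all add: Scont)
    have gper: "g (x + axis d (b - a)) = g x" for x d
      unfolding g_def S_def using ab by (simp add: cis_fourier_phase_periodic)
    \<comment> \<open>The uniform limit \<open>g\<close> of the partial sums is identified with
      \<open>f\<close> by uniqueness of Fourier coefficients: the \<open>j\<close>-th coefficient of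
      \<open>g - f\<close> equals that of \<open>g - S t n\<close> as soon as the box of size
      \<open>n\<close> contains \<open>j\<close>, and the latter is
      \<open>O(1 / n^4)\<close>.\<close>
    have "g x - of_real (f t x) = 0" for x
    proof (rule fourier_coeff_complex_eq_0_imp[OF ab])
      show "continuous_on UNIV (\<lambda>x. g x - complex_of_real (f t x))"
        by (intro continuous_intros gcont C_spacetime_continuous_space[OF C t])
      show "g (x + axis d (b - a)) - of_real (f t (x + axis d (b - a))) = g x - complex_of_real (f t x)" for x d
        using per[OF t] by (simp add: gper space_periodic_def)
      show "fourier_coeff_complex a b (\<lambda>x. g x - complex_of_real (f t x)) j = 0" for j
      proof (rule ccontr)
        define z where "z = fourier_coeff_complex a b (\<lambda>x. g x - complex_of_real (f t x)) j"
        assume "fourier_coeff_complex a b (\<lambda>x. g x - complex_of_real (f t x)) j \<noteq> 0"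
        then have z: "norm z > 0" by (simp add: z_def)
        obtain n0 where n0: "n0 \<ge> 1" "\<And>n. n \<ge> n0 \<Longrightarrow> (D * L ^ 3) / real n ^ 4 < norm z"
          using small[OF z, of "D * L ^ 3"] D L by auto
        define n where "n = n0 + nat (Max (range (\<lambda>d. \<bar>j $ d\<bar>)))"
        have "\<bar>j $ d\<bar> \<le> int n" for d
        proof -
          have "\<bar>j $ d\<bar> \<le> Max (range (\<lambda>d. \<bar>j $ d\<bar>))" by (rule Max_ge) auto
          then show ?thesis using abs_ge_zero[of "j $ d"] unfolding n_def by linarith
        qed
        then have j: "j \<in> I n" unfolding I_def by (auto simp: abs_le_iff minus_le_iff)
        have "fourier_coeff_complex a b (S t n) j = c t j"
          using fourier_coeff_complex_trig_poly[OF ab fin, of "\<lambda>k. c t k / of_real (L ^ 3)" n j] j L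
          by (simp add: S_def[abs_def] L_def)
        then have "z = fourier_coeff_complex a b (\<lambda>x. g x - S t n x) j"
          unfolding z_def fourier_coeff_complex_diff[OF gcont fcont] fourier_coeff_complex_diff[OF gcont Scont]
          by (simp add: c_def)
        also have "norm \<dots> \<le> D / real n ^ 4 * (b - a) ^ 3"
          using ab n0(1) by (intro norm_fourier_coeff_complex_le continuous_intros gcont Scont gS) (auto simp: n_def)
        also have "\<dots> = (D * L ^ 3) / real n ^ 4" by (simp add: L_def)
        also have "\<dots> < norm z" by (rule n0) (simp add: n_def)
        finally show False by simp
      qed
    qed
    then have fg: "f t x = Re (g x)" by (metis Re_complex_of_real eq_iff_diff_eq_0)
    have "fourier_proj a b K (f t) x = Re (S t K x)"
      unfolding fourier_proj_def S_def I_def fourier_coeff_eq c_def L_def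
      by (simp add: scaleR_conv_of_real)
    then have "\<bar>f t x - fourier_proj a b K (f t) x\<bar> = \<bar>Re (g x - S t K x)\<bar>" by (simp add: fg)
    also have "\<dots> \<le> D / real K ^ 4" using abs_Re_le_cmod gS[OF K] order_trans by blast
    finally show ?thesis .
  qed
  show ?thesis using that[OF D err] .
qed

section \<open>Discrete calculus on the periodic grid\<close>

lemma grid_periodicD: "grid_periodic N u \<Longrightarrow> u (p + axis d (int N)) = u p"
  by (simp add: grid_periodic_def)

lemma grid_periodic_shift: "grid_periodic N u \<Longrightarrow> grid_periodic N (\<lambda>p. u (p + k))"
  unfolding grid_periodic_def by (metis add.assoc add.commute)

lemma grid_periodic_shift_minus: "grid_periodic N u \<Longrightarrow> grid_periodic N (\<lambda>p. u (p - k))"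
  using grid_periodic_shift[of N u "- k"] by simp

lemma grid_periodic_comp2:
  "grid_periodic N u \<Longrightarrow> grid_periodic N v \<Longrightarrow> grid_periodic N (\<lambda>p. f (u p) (v p))"
  by (simp add: grid_periodic_def)

lemma grid_periodic_comp:
  "grid_periodic N u \<Longrightarrow> grid_periodic N (\<lambda>p. f (u p))"
  by (simp add: grid_periodic_def)

lemma grid_periodic_grad_h: "grid_periodic N u \<Longrightarrow> grid_periodic N (grad_h h u d)"
  unfolding grad_h_def
  by (intro grid_periodic_comp2[where f = "\<lambda>x y. (x - y) / h"] grid_periodic_shift)

lemma card_cells: "card (cells N) = N ^ 3"
proof -
  have "bij_betw vec_lambda (UNIV \<rightarrow>\<^sub>E {1..int N}) (cells N)"
    unfolding cells_def by (rule bij_betwI[where g = "\<lambda>p d. p $ d"]) auto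
  then have "card (cells N) = card ((UNIV :: 3 set) \<rightarrow>\<^sub>E {1..int N})"
    by (simp add: bij_betw_same_card)
  then show ?thesis by (simp add: card_PiE)
qed

lemma sum_cells_shift_axis:
  assumes per: "grid_periodic N u"
  shows "(\<Sum>p\<in>cells N. u (p + axis d 1)) = (\<Sum>p\<in>cells N. u p)"
proof -
  \<comment> \<open>\<open>g\<close> is the shift with wrap-around inside the box. It agrees with
    the true shift up to a period, which \<open>u\<close> does not see.\<close>
  define g where "g p = (if p $ d = int N then p + axis d 1 - axis d (int N) else p + axis d 1)" for p :: "int^3"
  define g' where "g' p = (if p $ d = 1 then p - axis d 1 + axis d (int N) else p - axis d 1)" for p :: "int^3"
  have nth: "axis d r $ i = (if i = d then r else 0)" for r :: int and i
    by (simp add: axis_def)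
  have "bij_betw g (cells N) (cells N)"
  proof (rule bij_betwI[where g = g'])
    show "g \<in> cells N \<rightarrow> cells N"
    proof
      fix p assume p: "p \<in> cells N"
      have "1 \<le> g p $ i \<and> g p $ i \<le> int N" for i
        using p[unfolded cells_def, simplified, rule_format, of i]
        by (auto simp: g_def nth)
      then show "g p \<in> cells N" by (simp add: cells_def)
    qed
    show "g' \<in> cells N \<rightarrow> cells N"
    proof
      fix p assume p: "p \<in> cells N"
      have "1 \<le> g' p $ i \<and> g' p $ i \<le> int N" for i
        using p[unfolded cells_def, simplified, rule_format, of i]
        by (auto simp: g'_def nth)
      then show "g' p \<in> cells N" by (simp add: cells_def)
    qed
    show "g' (g p) = p" if "p \<in> cells N" for p
      using that[unfolded cells_def, simplified, rule_format, of d] by (auto simp: g_def g'_def nth)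
    show "g (g' p) = p" if "p \<in> cells N" for p
      using that[unfolded cells_def, simplified, rule_format, of d] by (auto simp: g_def g'_def nth)
  qed
  moreover have "u (p + axis d 1) = u (g p)" for p
    using grid_periodicD[OF per, of "p + axis d 1 - axis d (int N)" d] by (simp add: g_def)
  ultimately show ?thesis
    by (simp add: sum.reindex_bij_betw)
qed

lemma sum_cells_shift:
  assumes per: "grid_periodic N u"
  shows "(\<Sum>p\<in>cells N. u (p + k)) = (\<Sum>p\<in>cells N. u p)"
proof -
  have axis_nat: "(\<Sum>p\<in>cells N. u (p + axis d (int n))) = (\<Sum>p\<in>cells N. u p)" if "grid_periodic N u" for u d n
    using that
  proof (induction n)
    case 0
    have zero: "axis d 0 = (0 :: int^3)" by (simp add: vec_eq_iff axis_def)
    show ?case by (simp only: int_ops(1) zero add_0_right)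
  next
    case (Suc n)
    have eq: "p + axis d (int (Suc n)) = (p + axis d 1) + axis d (int n)" for p :: "int^3"
      by (simp add: vec_eq_iff axis_def)
    show ?case
      unfolding eq using sum_cells_shift_axis[OF grid_periodic_shift[OF Suc.prems, of "axis d (int n)"], of d] Suc
      by simp
  qed
  have axis_int: "(\<Sum>p\<in>cells N. u (p + axis d n)) = (\<Sum>p\<in>cells N. u p)" if u: "grid_periodic N u" for u d n
  proof (cases "n \<ge> 0")
    case True
    then show ?thesis using axis_nat[OF u, of d "nat n"] by simp
  next
    case False
    then have "axis d (int (nat (- n))) + axis d n = (0 :: int^3)" by (simp add: vec_eq_iff axis_def)
    then have "p + axis d (int (nat (- n))) + axis d n = p" for p :: "int^3" by (simp only: add.assoc add_0_right)
    then show ?thesis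
      using axis_nat[OF grid_periodic_shift[OF u, of "axis d n"], of d "nat (- n)"] by (simp only:)
  qed
  have "k = axis 1 (k $ 1) + axis 2 (k $ 2) + axis 3 (k $ 3)"
    by (simp add: vec_eq_iff forall_3 axis_def)
  then have "(\<Sum>p\<in>cells N. u (p + k)) = (\<Sum>p\<in>cells N. u (p + axis 1 (k $ 1) + axis 2 (k $ 2) + axis 3 (k $ 3)))"
    by (metis (no_types, lifting) add.assoc)
  also have "\<dots> = (\<Sum>p\<in>cells N. u (p + axis 2 (k $ 2) + axis 3 (k $ 3)))"
    by (rule axis_int[OF grid_periodic_shift[OF grid_periodic_shift[OF per]]])
  also have "\<dots> = (\<Sum>p\<in>cells N. u (p + axis 3 (k $ 3)))"
    by (rule axis_int[OF grid_periodic_shift[OF per]])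
  also have "\<dots> = (\<Sum>p\<in>cells N. u p)"
    by (rule axis_int[OF per])
  finally show ?thesis .
qed

lemma sum_cells_reflect_shift:
  assumes per: "grid_periodic N u"
  shows "(\<Sum>k\<in>cells N. u (p + k)) = (\<Sum>k\<in>cells N. u k)"
  using sum_cells_shift[OF per, of p] by (simp add: add.commute)

definition inner_h :: "real \<Rightarrow> nat \<Rightarrow> (int^3 \<Rightarrow> real) \<Rightarrow> (int^3 \<Rightarrow> real) \<Rightarrow> real" where
  "inner_h h N u v = h ^ 3 * (\<Sum>p\<in>cells N. u p * v p)"

lemma norm2_h_squared: "h \<ge> 0 \<Longrightarrow> (norm2_h h N u)\<^sup>2 = h ^ 3 * (\<Sum>p\<in>cells N. (u p)\<^sup>2)"
  by (simp add: norm2_h_def sum_nonneg)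

lemma norm2_h_nonneg: "h \<ge> 0 \<Longrightarrow> norm2_h h N u \<ge> 0"
  by (simp add: norm2_h_def sum_nonneg)

lemma inner_h_self: "h \<ge> 0 \<Longrightarrow> inner_h h N u u = (norm2_h h N u)\<^sup>2"
  by (simp add: norm2_h_squared inner_h_def) (simp add: power2_eq_square)

lemma norm2_h_eq_L2_set: "h \<ge> 0 \<Longrightarrow> norm2_h h N u = sqrt (h ^ 3) * L2_set u (cells N)"
  by (simp add: norm2_h_def L2_set_def real_sqrt_mult)

lemma norm2_h_triangle: "h \<ge> 0 \<Longrightarrow> norm2_h h N (\<lambda>p. u p + v p) \<le> norm2_h h N u + norm2_h h N v"
  using L2_set_triangle_ineq[of u v "cells N"]
  by (simp add: norm2_h_eq_L2_set mult_left_mono flip: distrib_left)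

lemma norm2_h_le_max:
  assumes "h \<ge> 0" "B \<ge> 0" "\<And>p. \<bar>u p\<bar> \<le> B"
  shows "norm2_h h N u \<le> sqrt ((h * real N) ^ 3) * B"
proof -
  have "(\<Sum>p\<in>cells N. (u p)\<^sup>2) \<le> (\<Sum>p\<in>cells N. B\<^sup>2)"
    using assms by (intro sum_mono) (metis abs_le_square_iff abs_of_nonneg)
  then have "h ^ 3 * (\<Sum>p\<in>cells N. (u p)\<^sup>2) \<le> (h * real N) ^ 3 * B\<^sup>2"
    using assms by (simp add: card_cells power_mult_distrib mult_left_mono mult.assoc)
  then have "norm2_h h N u \<le> sqrt ((h * real N) ^ 3 * B\<^sup>2)"
    unfolding norm2_h_def by (rule real_sqrt_le_mono)
  then show ?thesis using assms by (simp add: real_sqrt_mult)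
qed

lemma norm2_h_scale: "h \<ge> 0 \<Longrightarrow> norm2_h h N (\<lambda>p. c * u p) = \<bar>c\<bar> * norm2_h h N u"
  by (simp add: norm2_h_def power_mult_distrib real_sqrt_mult flip: sum_distrib_left)

lemma norm2_h_sum:
  assumes "h \<ge> 0" "finite I"
  shows "norm2_h h N (\<lambda>p. \<Sum>i\<in>I. u i p) \<le> (\<Sum>i\<in>I. norm2_h h N (u i))"
  using assms(2)
proof induction
  case (insert i I)
  then show ?case using norm2_h_triangle[OF assms(1), of N "u i" "\<lambda>p. \<Sum>i\<in>I. u i p"] by simp
qed (simp add: norm2_h_def)

lemma inner_h_Cauchy_Schwarz: "h \<ge> 0 \<Longrightarrow> \<bar>inner_h h N u v\<bar> \<le> norm2_h h N u * norm2_h h N v"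
proof -
  assume h: "h \<ge> 0"
  have "\<bar>\<Sum>p\<in>cells N. u p * v p\<bar> \<le> (\<Sum>p\<in>cells N. \<bar>u p\<bar> * \<bar>v p\<bar>)"
    by (rule order_trans[OF sum_abs]) (simp add: abs_mult)
  also have "\<dots> \<le> L2_set u (cells N) * L2_set v (cells N)"
    by (rule L2_set_mult_ineq)
  finally have "h ^ 3 * \<bar>\<Sum>p\<in>cells N. u p * v p\<bar> \<le> h ^ 3 * (L2_set u (cells N) * L2_set v (cells N))"
    using h by (intro mult_left_mono) auto
  also have "h ^ 3 = sqrt (h ^ 3) * sqrt (h ^ 3)" using h by simp
  finally show ?thesis using h by (simp add: inner_h_def abs_mult norm2_h_eq_L2_set mult_ac)
qed

lemma norm2_h_shift:
  "grid_periodic N u \<Longrightarrow> norm2_h h N (\<lambda>p. u (p + k)) = norm2_h h N u"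
  unfolding norm2_h_def
  by (subst sum_cells_shift[of N "\<lambda>p. (u p)\<^sup>2"]) (auto intro: grid_periodic_comp)

lemma grad_norm2_h_squared:
  assumes "h \<ge> 0"
  shows "(grad_norm2_h h N u)\<^sup>2 = (\<Sum>d\<in>UNIV. (norm2_h h N (grad_h h u d))\<^sup>2)"
proof -
  have "(grad_norm2_h h N u)\<^sup>2 = h ^ 3 * (\<Sum>p\<in>cells N. \<Sum>d\<in>UNIV. (grad_h h u d p)\<^sup>2)"
    using assms by (simp add: grad_norm2_h_def sum_nonneg)
  also have "\<dots> = (\<Sum>d\<in>UNIV. (norm2_h h N (grad_h h u d))\<^sup>2)"
    by (subst sum.swap) (simp add: norm2_h_squared assms sum_distrib_left)
  finally show ?thesis .
qed

lemma inner_h_shift: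
  assumes "grid_periodic N u" "grid_periodic N v"
  shows "inner_h h N (\<lambda>p. u (p - k)) v = inner_h h N u (\<lambda>p. v (p + k))"
proof -
  have "(\<Sum>p\<in>cells N. u (p - k) * v p) = (\<Sum>p\<in>cells N. u (p + k - k) * v (p + k))"
    by (rule sum_cells_shift[of N "\<lambda>p. u (p - k) * v p", symmetric])
       (intro grid_periodic_comp2[where f = "(*)"] grid_periodic_shift_minus assms)
  then show ?thesis by (simp add: inner_h_def)
qed

section \<open>Summation by parts and second differences\<close>

lemma summation_by_parts_axis:
  assumes "grid_periodic N u" "grid_periodic N v"
  shows "inner_h h N (\<lambda>p. (u p - u (p - axis d 1)) / h) v = - inner_h h N u (grad_h h v d)"
proof -
  have "inner_h h N (\<lambda>p. (u p - u (p - axis d 1)) / h) v =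
     (inner_h h N u v - inner_h h N (\<lambda>p. u (p - axis d 1)) v) / h"
    by (simp add: inner_h_def sum_subtractf diff_divide_distrib left_diff_distrib right_diff_distrib flip: sum_divide_distrib)
  also have "\<dots> = (inner_h h N u v - inner_h h N u (\<lambda>p. v (p + axis d 1))) / h"
    by (simp add: inner_h_shift assms)
  also have "\<dots> = - inner_h h N u (grad_h h v d)"
    by (simp add: inner_h_def grad_h_def sum_subtractf diff_divide_distrib right_diff_distrib flip: sum_divide_distrib)
  finally show ?thesis .
qed

lemma inner_h_sum_left: "inner_h h N (\<lambda>p. \<Sum>i\<in>I. u i p) v = (\<Sum>i\<in>I. inner_h h N (u i) v)"
  unfolding inner_h_def sum_distrib_right sum_distrib_left by (rule sum.swap)

lemma inner_h_commute: "inner_h h N u v = inner_h h N v u"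
  by (simp add: inner_h_def mult.commute)

lemma summation_by_parts:
  assumes "\<And>d. grid_periodic N (F d)" "grid_periodic N v"
  shows "inner_h h N (div_h h F) v = - (\<Sum>d\<in>UNIV. inner_h h N (F d) (grad_h h v d))"
  unfolding div_h_def[abs_def] inner_h_sum_left
  by (simp add: summation_by_parts_axis assms sum_negf)

text \<open>The discrete form of the identity between the \<open>L^2\<close> norms of Hessian and
  Laplacian on the torus. Differences commute, so two summations by parts turn each squared mixed
  difference into the product of the pure second differences \<open>\<delta> e\<close> and
  \<open>\<delta> d\<close>, and these products add up to the square of their sum.\<close>

lemma sum_norm2_h_second_differences:
  assumes per: "grid_periodic N u" and h: "h \<ge> 0"
  shows "(\<Sum>d\<in>UNIV. \<Sum>e\<in>UNIV. (norm2_h h N (grad_h h (grad_h h u e) d))\<^sup>2) = (norm2_h h N (lap_h h u))\<^sup>2"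
proof -
  define \<delta> where "\<delta> d p = (grad_h h u d p - grad_h h u d (p - axis d 1)) / h" for d p
  have per_d: "grid_periodic N (grad_h h u d)" for d by (intro grid_periodic_grad_h per)
  have per_\<delta>: "grid_periodic N (\<delta> d)" for d
    unfolding \<delta>_def by (intro grid_periodic_comp2[where f = "\<lambda>x y. (x - y) / h"] grid_periodic_shift_minus per_d)
  have "(norm2_h h N (grad_h h (grad_h h u e) d))\<^sup>2 = inner_h h N (\<delta> e) (\<delta> d)" for d e
  proof -
    have comm: "(\<lambda>p. (grad_h h (grad_h h u e) d p - grad_h h (grad_h h u e) d (p - axis d 1)) / h) = grad_h h (\<delta> d) e"
      by (auto simp: fun_eq_iff grad_h_def \<delta>_def diff_divide_distrib add_divide_distrib algebra_simps)
    have "(norm2_h h N (grad_h h (grad_h h u e) d))\<^sup>2 = inner_h h N (grad_h h (grad_h h u e) d) (grad_h h (grad_h h u e) d)"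
      using h by (simp add: inner_h_self)
    also have "\<dots> = - inner_h h N (grad_h h (\<delta> d) e) (grad_h h u e)"
    proof -
      have "inner_h h N (\<lambda>p. (grad_h h (grad_h h u e) d p - grad_h h (grad_h h u e) d (p - axis d 1)) / h) (grad_h h u e)
          = - inner_h h N (grad_h h (grad_h h u e) d) (grad_h h (grad_h h u e) d)"
        by (intro summation_by_parts_axis grid_periodic_grad_h per)
      then show ?thesis unfolding comm by simp
    qed
    also have "\<dots> = - inner_h h N (grad_h h u e) (grad_h h (\<delta> d) e)" by (simp add: inner_h_commute)
    also have "\<dots> = inner_h h N (\<delta> e) (\<delta> d)"
    proof -
      have "inner_h h N (\<lambda>p. (grad_h h u e p - grad_h h u e (p - axis e 1)) / h) (\<delta> d)
          = - inner_h h N (grad_h h u e) (grad_h h (\<delta> d) e)"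
        by (intro summation_by_parts_axis per_d per_\<delta>)
      then show ?thesis by (simp add: \<delta>_def[abs_def])
    qed
    finally show ?thesis .
  qed
  moreover have "(norm2_h h N (lap_h h u))\<^sup>2 = (\<Sum>e\<in>UNIV. \<Sum>d\<in>UNIV. inner_h h N (\<delta> e) (\<delta> d))"
  proof -
    have "lap_h h u = (\<lambda>p. \<Sum>d\<in>UNIV. \<delta> d p)" by (simp add: lap_h_def div_h_def \<delta>_def fun_eq_iff)
    then have "(norm2_h h N (lap_h h u))\<^sup>2 = inner_h h N (\<lambda>p. \<Sum>e\<in>UNIV. \<delta> e p) (\<lambda>p. \<Sum>d\<in>UNIV. \<delta> d p)"
      using h by (simp add: inner_h_self)
    also have "\<dots> = (\<Sum>e\<in>UNIV. \<Sum>d\<in>UNIV. inner_h h N (\<delta> e) (\<delta> d))"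
      by (subst inner_h_sum_left, subst inner_h_commute, subst inner_h_sum_left, simp add: inner_h_commute)
    finally show ?thesis .
  qed
  ultimately show ?thesis by (subst sum.swap) simp
qed

lemma norm2_h_second_difference_le:
  assumes "grid_periodic N u" "h \<ge> 0"
  shows "norm2_h h N (grad_h h (grad_h h u e) d) \<le> norm2_h h N (lap_h h u)"
proof -
  have "(norm2_h h N (grad_h h (grad_h h u e) d))\<^sup>2 \<le> (\<Sum>e\<in>UNIV. (norm2_h h N (grad_h h (grad_h h u e) d))\<^sup>2)"
    by (rule member_le_sum) auto
  also have "\<dots> \<le> (\<Sum>d\<in>UNIV. \<Sum>e\<in>UNIV. (norm2_h h N (grad_h h (grad_h h u e) d))\<^sup>2)"
    by (rule member_le_sum) (auto intro: sum_nonneg)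
  also have "\<dots> = (norm2_h h N (lap_h h u))\<^sup>2"
    by (rule sum_norm2_h_second_differences[OF assms])
  finally show ?thesis using norm2_h_nonneg[OF assms(2)] by (simp add: power2_le_iff_abs_le)
qed

lemma norm2_h_grad_h_le: "h \<ge> 0 \<Longrightarrow> norm2_h h N (grad_h h u d) \<le> grad_norm2_h h N u"
proof -
  assume h: "h \<ge> 0"
  have "(norm2_h h N (grad_h h u d))\<^sup>2 \<le> (\<Sum>d\<in>UNIV. (norm2_h h N (grad_h h u d))\<^sup>2)"
    by (rule member_le_sum) auto
  also have "\<dots> = (grad_norm2_h h N u)\<^sup>2" by (simp add: grad_norm2_h_squared h)
  finally show ?thesis
    by (rule power2_le_imp_le) (use h in \<open>simp add: grad_norm2_h_def sum_nonneg\<close>)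
qed

section \<open>Translations and the discrete Poincare inequality\<close>

lemma norm2_h_translate_axis:
  assumes per: "grid_periodic N u" and h: "h > 0"
  shows "norm2_h h N (\<lambda>p. u (p + axis d (int n)) - u p) \<le> real n * h * norm2_h h N (grad_h h u d)"
proof (induction n)
  case 0
  have zero: "axis d 0 = (0 :: int^3)" by (simp add: vec_eq_iff axis_def)
  show ?case by (simp only: int_ops(1) zero add_0_right) (simp add: norm2_h_def)
next
  case (Suc n)
  have eq: "p + axis d (int (Suc n)) = p + axis d (int n) + axis d 1" for p :: "int^3"
    by (simp add: vec_eq_iff axis_def)
  have "(\<lambda>p. u (p + axis d (int (Suc n))) - u p) =
    (\<lambda>p. h * grad_h h u d (p + axis d (int n)) + (u (p + axis d (int n)) - u p))"
    unfolding eq using h by (simp add: grad_h_def)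
  then have "norm2_h h N (\<lambda>p. u (p + axis d (int (Suc n))) - u p) \<le>
     norm2_h h N (\<lambda>p. h * grad_h h u d (p + axis d (int n))) + norm2_h h N (\<lambda>p. u (p + axis d (int n)) - u p)"
    using h by (simp only: norm2_h_triangle less_imp_le)
  also have "norm2_h h N (\<lambda>p. h * grad_h h u d (p + axis d (int n))) = h * norm2_h h N (grad_h h u d)"
    using h norm2_h_shift[OF grid_periodic_grad_h[OF per], of h h d "axis d (int n)"] by (simp add: norm2_h_scale)
  also note Suc
  finally show ?case by (simp add: algebra_simps)
qed

text \<open>The translation by \<open>k\<close> is walked along the three axes in turn, at most
  \<open>N\<close> unit steps each. A unit step costs \<open>h\<close> times a difference quotient,
  whose norm is translation invariant.\<close>

lemma norm2_h_translate:
  assumes per: "grid_periodic N u" and h: "h > 0" and k: "k \<in> cells N"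
  shows "norm2_h h N (\<lambda>p. u (p + k) - u p) \<le> h * real N * (\<Sum>d\<in>UNIV. norm2_h h N (grad_h h u d))"
proof -
  have ax: "norm2_h h N (\<lambda>p. u (p + axis d (k $ d)) - u p) \<le> h * real N * norm2_h h N (grad_h h u d)" for d
  proof -
    have kd: "1 \<le> k $ d" "k $ d \<le> int N" using k by (auto simp: cells_def)
    have "norm2_h h N (\<lambda>p. u (p + axis d (k $ d)) - u p) \<le> real (nat (k $ d)) * h * norm2_h h N (grad_h h u d)"
      using norm2_h_translate_axis[OF per h, of d "nat (k $ d)"] kd by simp
    also have "\<dots> \<le> real N * h * norm2_h h N (grad_h h u d)"
      using kd h by (intro mult_right_mono norm2_h_nonneg) auto
    finally show ?thesis by (simp add: mult.commute)
  qed
  define A where "A d = axis d (k $ d)" for d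
  have kA: "p + k = p + A 3 + A 2 + A 1" for p
    by (simp add: A_def vec_eq_iff forall_3 axis_def)
  have shift: "norm2_h h N (\<lambda>p. u (p + j + A d) - u (p + j)) = norm2_h h N (\<lambda>p. u (p + A d) - u p)" for j d
    by (rule norm2_h_shift[where u = "\<lambda>p. u (p + A d) - u p"])
       (intro grid_periodic_comp2[where f = "(-)"] grid_periodic_shift per)
  have "(\<lambda>p. u (p + k) - u p) = (\<lambda>p. (u (p + (A 3 + A 2) + A 1) - u (p + (A 3 + A 2))) + ((u (p + A 3 + A 2) - u (p + A 3)) + (u (p + A 3) - u p)))"
    unfolding kA by (simp add: add.assoc)
  then have "norm2_h h N (\<lambda>p. u (p + k) - u p) \<le> norm2_h h N (\<lambda>p. u (p + (A 3 + A 2) + A 1) - u (p + (A 3 + A 2)))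
      + norm2_h h N (\<lambda>p. (u (p + A 3 + A 2) - u (p + A 3)) + (u (p + A 3) - u p))"
    using h by (simp only: norm2_h_triangle less_imp_le)
  also have "norm2_h h N (\<lambda>p. (u (p + A 3 + A 2) - u (p + A 3)) + (u (p + A 3) - u p)) \<le>
     norm2_h h N (\<lambda>p. u (p + A 3 + A 2) - u (p + A 3)) + norm2_h h N (\<lambda>p. u (p + A 3) - u p)"
    using h by (intro norm2_h_triangle) auto
  finally show ?thesis
    using ax[of 1] ax[of 2] ax[of 3] unfolding shift by (simp add: A_def sum_3 distrib_left)
qed

lemma sum_squares_le_3: "(\<Sum>d\<in>(UNIV :: 3 set). f d)\<^sup>2 \<le> 3 * (\<Sum>d\<in>UNIV. (f d)\<^sup>2)" for f :: "3 \<Rightarrow> real"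
  using sum_squared_le_sum_of_squares[of f UNIV] by simp

text \<open>The squared differences \<open>u (p + k) - u p\<close> are summed over all offsets
  \<open>k\<close> in one period. Expanding the square leaves a multiple of the sum of squares minus
  twice the squared sum, so the mean of \<open>u\<close> appears without being subtracted
  beforehand. The factor 3/2 is half of the 3 that Cauchy-Schwarz over the axes produces.\<close>

lemma poincare_h:
  assumes per: "grid_periodic N u" and h: "h > 0" and N: "N \<ge> 1"
  shows "(norm2_h h N u)\<^sup>2 \<le> (h ^ 3 * (\<Sum>p\<in>cells N. u p))\<^sup>2 / (h * real N) ^ 3
           + 3 / 2 * (h * real N)\<^sup>2 * (grad_norm2_h h N u)\<^sup>2"
proof -
  define S2 where "S2 = (\<Sum>p\<in>cells N. (u p)\<^sup>2)"
  define S1 where "S1 = (\<Sum>p\<in>cells N. u p)"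
  define G where "G = (grad_norm2_h h N u)\<^sup>2"
  have "(\<Sum>k\<in>cells N. (norm2_h h N (\<lambda>p. u (p + k) - u p))\<^sup>2) \<le> (\<Sum>k\<in>cells N. 3 * (h * real N)\<^sup>2 * G)"
  proof (rule sum_mono)
    fix k assume "k \<in> cells N"
    then have "(norm2_h h N (\<lambda>p. u (p + k) - u p))\<^sup>2 \<le> (h * real N * (\<Sum>d\<in>UNIV. norm2_h h N (grad_h h u d)))\<^sup>2"
      using h by (intro power_mono norm2_h_translate per norm2_h_nonneg) auto
    also have "\<dots> = (h * real N)\<^sup>2 * (\<Sum>d\<in>UNIV. norm2_h h N (grad_h h u d))\<^sup>2" by (simp add: power_mult_distrib)
    also have "\<dots> \<le> (h * real N)\<^sup>2 * (3 * (\<Sum>d\<in>UNIV. (norm2_h h N (grad_h h u d))\<^sup>2))"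
      by (intro mult_left_mono sum_squares_le_3) auto
    also have "\<dots> = 3 * (h * real N)\<^sup>2 * G" using h by (simp add: G_def grad_norm2_h_squared)
    finally show "(norm2_h h N (\<lambda>p. u (p + k) - u p))\<^sup>2 \<le> 3 * (h * real N)\<^sup>2 * G" .
  qed
  also have "\<dots> = real N ^ 3 * (3 * (h * real N)\<^sup>2 * G)" by (simp add: card_cells)
  finally have upper: "(\<Sum>k\<in>cells N. (norm2_h h N (\<lambda>p. u (p + k) - u p))\<^sup>2) \<le> real N ^ 3 * (3 * (h * real N)\<^sup>2 * G)" .
  have "(\<Sum>k\<in>cells N. \<Sum>p\<in>cells N. (u (p + k) - u p)\<^sup>2) =
     (\<Sum>k\<in>cells N. \<Sum>p\<in>cells N. (u (p + k))\<^sup>2) + (\<Sum>k\<in>cells N. \<Sum>p\<in>cells N. (u p)\<^sup>2) - (\<Sum>k\<in>cells N. \<Sum>p\<in>cells N. 2 * u p * u (p + k))"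
    by (simp add: power2_diff sum.distrib sum_subtractf mult.commute mult.left_commute)
  also have "(\<Sum>k\<in>cells N. \<Sum>p\<in>cells N. (u (p + k))\<^sup>2) = real N ^ 3 * S2"
    using sum_cells_shift[OF grid_periodic_comp[OF per, of "\<lambda>x. x\<^sup>2"]] by (simp add: card_cells S2_def)
  also have "(\<Sum>k\<in>cells N. \<Sum>p\<in>cells N. (u p)\<^sup>2) = real N ^ 3 * S2" by (simp add: card_cells S2_def)
  also have "(\<Sum>k\<in>cells N. \<Sum>p\<in>cells N. 2 * u p * u (p + k)) = 2 * S1\<^sup>2"
  proof -
    have "(\<Sum>k\<in>cells N. \<Sum>p\<in>cells N. 2 * u p * u (p + k)) = (\<Sum>p\<in>cells N. 2 * u p * (\<Sum>k\<in>cells N. u (p + k)))"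
      by (subst sum.swap) (simp add: sum_distrib_left)
    also have "\<dots> = 2 * S1\<^sup>2"
      by (simp add: sum_cells_reflect_shift[OF per] S1_def power2_eq_square sum_distrib_left sum_distrib_right mult_ac)
    finally show ?thesis .
  qed
  finally have "(\<Sum>k\<in>cells N. (norm2_h h N (\<lambda>p. u (p + k) - u p))\<^sup>2) = h ^ 3 * (2 * real N ^ 3 * S2 - 2 * S1\<^sup>2)"
    using h by (simp add: norm2_h_squared flip: sum_distrib_left)
  with upper have "h ^ 3 * (2 * real N ^ 3 * S2 - 2 * S1\<^sup>2) \<le> real N ^ 3 * (3 * (h * real N)\<^sup>2 * G)" by simp
  then have "real N ^ 3 * (2 * (h ^ 3 * S2)) \<le> 2 * h ^ 3 * S1\<^sup>2 + real N ^ 3 * (3 * (h * real N)\<^sup>2 * G)"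
    by (simp add: algebra_simps)
  then have "2 * (h ^ 3 * S2) \<le> (2 * h ^ 3 * S1\<^sup>2 + real N ^ 3 * (3 * (h * real N)\<^sup>2 * G)) / real N ^ 3"
    using N by (simp add: pos_le_divide_eq mult.commute)
  also have "\<dots> = 2 * ((h ^ 3 * S1)\<^sup>2 / (h * real N) ^ 3) + 3 * (h * real N)\<^sup>2 * G"
    using N h by (simp add: field_simps power2_eq_square power3_eq_cube)
  finally show ?thesis
    using h by (simp add: norm2_h_squared S2_def S1_def G_def)
qed

section \<open>Maximum bounds from averages over planar blocks\<close>

lemma sum_square_block_le:
  fixes v :: "int^3 \<Rightarrow> real"
  assumes per: "grid_periodic N v" and nn: "\<And>p. v p \<ge> 0" and R: "R \<le> N"
  shows "(\<Sum>i<R. \<Sum>j<R. v (p + axis 1 (int i) + axis 2 (int j))) \<le> (\<Sum>p\<in>cells N. v p)"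
proof -
  \<comment> \<open>The vector of ones moves the block into \<open>cells N\<close>, whose indices
    start at 1. Injectivity there means that a block of side at most \<open>N\<close> meets no cell
    twice modulo the period.\<close>
  define f where "f = (\<lambda>(i, j). (\<chi> d. 1) + axis 1 (int i) + axis 2 (int j) :: int^3)"
  have nth: "f (i, j) $ 1 = 1 + int i" "f (i, j) $ 2 = 1 + int j" "f (i, j) $ 3 = 1" for i j
    by (simp_all add: f_def axis_def)
  have inj: "inj_on f ({..<R} \<times> {..<R})"
  proof (rule inj_onI)
    fix x y assume eq: "f x = f y"
    obtain i j i' j' where xy: "x = (i, j)" "y = (i', j')" by (cases x, cases y) auto
    from eq have "f x $ 1 = f y $ 1" "f x $ 2 = f y $ 2" by simp_all
    then show "x = y" unfolding xy nth by simp
  qed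
  have sub: "f ` ({..<R} \<times> {..<R}) \<subseteq> cells N"
    using R by (auto simp: cells_def forall_3 nth)
  have "(\<Sum>i<R. \<Sum>j<R. v (p + axis 1 (int i) + axis 2 (int j))) =
     (\<Sum>x\<in>{..<R} \<times> {..<R}. v (p - (\<chi> d. 1) + f x))"
    by (simp add: sum.cartesian_product f_def case_prod_unfold algebra_simps)
  also have "\<dots> = (\<Sum>k\<in>f ` ({..<R} \<times> {..<R}). v (p - (\<chi> d. 1) + k))"
    by (simp add: sum.reindex[OF inj])
  also have "\<dots> \<le> (\<Sum>k\<in>cells N. v (p - (\<chi> d. 1) + k))"
    by (intro sum_mono2 finite_cells sub nn)
  also have "\<dots> = (\<Sum>p\<in>cells N. v p)" by (rule sum_cells_reflect_shift[OF per])
  finally show ?thesis .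
qed

lemma sum_line_le:
  fixes v :: "int^3 \<Rightarrow> real"
  assumes per: "grid_periodic N v" and nn: "\<And>p. v p \<ge> 0" and R: "1 \<le> R" "R \<le> N"
  shows "(\<Sum>i<R. v (p + axis 1 (int i))) \<le> (\<Sum>p\<in>cells N. v p)"
proof -
  have zero: "axis d 0 = (0 :: int^3)" for d by (simp add: vec_eq_iff axis_def)
  have "v (p + axis 1 (int i)) \<le> (\<Sum>j<R. v (p + axis 1 (int i) + axis 2 (int j)))" for i
  proof -
    have "v (p + axis 1 (int i) + axis 2 (int 0)) \<le> (\<Sum>j<R. v (p + axis 1 (int i) + axis 2 (int j)))"
      using R nn by (intro member_le_sum) auto
    then show ?thesis by (simp only: int_ops(1) zero add_0_right)
  qed
  then have "(\<Sum>i<R. v (p + axis 1 (int i))) \<le> (\<Sum>i<R. \<Sum>j<R. v (p + axis 1 (int i) + axis 2 (int j)))"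
    by (intro sum_mono)
  also have "\<dots> \<le> (\<Sum>p\<in>cells N. v p)" by (rule sum_square_block_le[OF per nn R(2)])
  finally show ?thesis .
qed

lemma abs_diff_line_le:
  assumes h: "h > 0" and n: "n \<le> R"
  shows "\<bar>g (p + axis d (int n)) - g p\<bar> \<le> h * (\<Sum>i<R. \<bar>grad_h h g d (p + axis d (int i))\<bar>)"
proof -
  have "\<bar>g (p + axis d (int n)) - g p\<bar> \<le> h * (\<Sum>i<n. \<bar>grad_h h g d (p + axis d (int i))\<bar>)"
  proof (induction n)
    case 0
    have zero: "axis d 0 = (0 :: int^3)" for d by (simp add: vec_eq_iff axis_def)
    show ?case by (simp only: int_ops(1) zero add_0_right) simp
  next
    case (Suc n)
    have eq: "p + axis d (int (Suc n)) = p + axis d (int n) + axis d 1"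
      by (simp add: vec_eq_iff axis_def)
    have "h * \<bar>grad_h h g d (p + axis d (int n))\<bar> = \<bar>g (p + axis d (int (Suc n))) - g (p + axis d (int n))\<bar>"
      unfolding eq grad_h_def using h by simp
    then show ?case using Suc unfolding sum.lessThan_Suc distrib_left by linarith
  qed
  also have "\<dots> \<le> h * (\<Sum>i<R. \<bar>grad_h h g d (p + axis d (int i))\<bar>)"
    using h n by (intro mult_left_mono sum_mono2) auto
  finally show ?thesis .
qed

lemma sum_abs_le_sqrt_card:
  fixes f :: "'a \<Rightarrow> real"
  assumes "(\<Sum>x\<in>A. (f x)\<^sup>2) \<le> X"
  shows "(\<Sum>x\<in>A. \<bar>f x\<bar>) \<le> sqrt (real (card A)) * sqrt X"
proof -
  have "(\<Sum>x\<in>A. \<bar>1\<bar> * \<bar>f x\<bar>) \<le> L2_set (\<lambda>_. 1) A * L2_set f A" by (rule L2_set_mult_ineq)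
  also have "\<dots> \<le> sqrt (real (card A)) * sqrt X"
    using assms by (intro mult_mono) (auto simp: L2_set_def sum_nonneg)
  finally show ?thesis by simp
qed

text \<open>
  The averaging length \<open>R * h\<close> is free: with \<open>R * h\<close> small but independent of \<open>h\<close>, the
  factor \<open>sqrt (R * h) / h\<close> of the first difference is a small multiple of \<open>1 / h\<close>.
\<close>

lemma grid_max_le:
  assumes per: "grid_periodic N g" and h: "h > 0" and R: "1 \<le> R" "R \<le> N"
  shows "\<bar>g p\<bar> \<le> sqrt (real R * h) / h * norm2_h h N (grad_h h g 1) + norm2_h h N (grad_h h g 2) / sqrt h
      + norm2_h h N g / (real R * h * sqrt h)"
proof -
  define A where "A u = sqrt (\<Sum>p\<in>cells N. (u p)\<^sup>2)" for u :: "int^3 \<Rightarrow> real"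
  have per_d: "grid_periodic N (grad_h h g d)" for d by (intro grid_periodic_grad_h per)
  have line: "(\<Sum>i<R. \<bar>u (p + axis 1 (int i))\<bar>) \<le> sqrt (real R) * A u" if "grid_periodic N u" for u
    using sum_abs_le_sqrt_card[OF sum_line_le[OF grid_periodic_comp[OF that, of "\<lambda>x. x\<^sup>2"] _ R, of p]]
    by (simp add: A_def)
  have block: "(\<Sum>i<R. \<Sum>j<R. \<bar>u (p + axis 1 (int i) + axis 2 (int j))\<bar>) \<le> real R * A u" if "grid_periodic N u" for u
  proof -
    have "(\<Sum>x\<in>{..<R} \<times> {..<R}. (case x of (i, j) \<Rightarrow> u (p + axis 1 (int i) + axis 2 (int j)))\<^sup>2) \<le> (\<Sum>p\<in>cells N. (u p)\<^sup>2)"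
      using sum_square_block_le[OF grid_periodic_comp[OF that, of "\<lambda>x. x\<^sup>2"] _ R(2), of p]
      by (simp add: sum.cartesian_product case_prod_unfold)
    from sum_abs_le_sqrt_card[OF this] show ?thesis
      by (simp add: A_def sum.cartesian_product case_prod_unfold)
  qed
  \<comment> \<open>The path from \<open>p\<close> makes \<open>i\<close> steps along axis 1 and
    then \<open>j\<close> steps along axis 2. The first leg lies on one fixed line and costs
    \<open>h * sqrt R * A\<close>; the second legs are averaged over the \<open>R\<close> lines of
    the block, which lowers their cost to \<open>h * A\<close>.\<close>
  have "\<bar>g p\<bar> \<le> \<bar>g (p + axis 1 (int i) + axis 2 (int j))\<bar>
      + h * (\<Sum>j<R. \<bar>grad_h h g 2 (p + axis 1 (int i) + axis 2 (int j))\<bar>) + h * (sqrt (real R) * A (grad_h h g 1))"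
    if "i < R" "j < R" for i j
  proof -
    have "\<bar>g (p + axis 1 (int i)) - g p\<bar> \<le> h * (\<Sum>i<R. \<bar>grad_h h g 1 (p + axis 1 (int i))\<bar>)"
      using that by (intro abs_diff_line_le h) auto
    also have "\<dots> \<le> h * (sqrt (real R) * A (grad_h h g 1))"
      using h by (intro mult_left_mono line per_d) auto
    finally have "\<bar>g (p + axis 1 (int i)) - g p\<bar> \<le> h * (sqrt (real R) * A (grad_h h g 1))" .
    moreover have "\<bar>g (p + axis 1 (int i) + axis 2 (int j)) - g (p + axis 1 (int i))\<bar> \<le>
       h * (\<Sum>j<R. \<bar>grad_h h g 2 (p + axis 1 (int i) + axis 2 (int j))\<bar>)"
      using that by (intro abs_diff_line_le h) auto
    ultimately show ?thesis by linarith
  qed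
  then have "(\<Sum>i<R. \<Sum>j<R. \<bar>g p\<bar>) \<le> (\<Sum>i<R. \<Sum>j<R. \<bar>g (p + axis 1 (int i) + axis 2 (int j))\<bar>
      + h * (\<Sum>j<R. \<bar>grad_h h g 2 (p + axis 1 (int i) + axis 2 (int j))\<bar>) + h * (sqrt (real R) * A (grad_h h g 1)))"
    by (intro sum_mono) auto
  also have "\<dots> = (\<Sum>i<R. \<Sum>j<R. \<bar>g (p + axis 1 (int i) + axis 2 (int j))\<bar>)
      + real R * h * (\<Sum>i<R. \<Sum>j<R. \<bar>grad_h h g 2 (p + axis 1 (int i) + axis 2 (int j))\<bar>)
      + real R * real R * (h * (sqrt (real R) * A (grad_h h g 1)))"
    by (simp add: sum.distrib sum_distrib_left mult_ac)
  also have "\<dots> \<le> real R * A g + real R * h * (real R * A (grad_h h g 2)) + real R * real R * (h * (sqrt (real R) * A (grad_h h g 1)))"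
    using h by (intro add_mono mult_left_mono block per per_d) auto
  finally have "real R * real R * \<bar>g p\<bar> \<le> real R * real R * (A g / real R + h * A (grad_h h g 2) + h * (sqrt (real R) * A (grad_h h g 1)))"
    using R by (simp add: algebra_simps)
  then have main: "\<bar>g p\<bar> \<le> A g / real R + h * A (grad_h h g 2) + h * (sqrt (real R) * A (grad_h h g 1))"
    using R by simp
  \<comment> \<open>\<open>A\<close> omits the weight \<open>h^3\<close> of the discrete norm;
    dividing by its square root produces the powers of \<open>h\<close> in the claim.\<close>
  have s: "sqrt (h ^ 3) = h * sqrt h" using h by (simp add: real_sqrt_mult power3_eq_cube)
  have A: "A u = norm2_h h N u / (h * sqrt h)" for u
    using h by (simp add: norm2_h_def A_def real_sqrt_mult s)
  have sq: "sqrt h * sqrt h = h" using h by simp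
  have "h * (sqrt (real R) * A (grad_h h g 1)) = sqrt (real R * h) / h * norm2_h h N (grad_h h g 1)"
    using h sq by (simp add: A real_sqrt_mult divide_simps)
  moreover have "h * A (grad_h h g 2) = norm2_h h N (grad_h h g 2) / sqrt h" using h by (simp add: A)
  moreover have "A g / real R = norm2_h h N g / (real R * h * sqrt h)" by (simp add: A mult_ac)
  ultimately show ?thesis using main by linarith
qed

section \<open>Mobility averages\<close>

lemma cosh_le_3: "\<bar>x\<bar> \<le> 1 \<Longrightarrow> cosh (x::real) \<le> 3"
proof -
  assume x: "\<bar>x\<bar> \<le> 1"
  have "exp x \<le> 3" "exp (- x) \<le> 3" by (rule order_trans[OF _ exp_le]; use x in simp)+
  then have "exp x + exp (- x) \<le> 3 + 3" by (rule add_mono)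
  then show ?thesis by (simp add: cosh_field_def)
qed

lemma abs_sinh_le:
  assumes "\<bar>x\<bar> \<le> (1::real)" shows "\<bar>sinh x\<bar> \<le> 3 * \<bar>x\<bar>"
proof -
  have "norm (sinh x - sinh 0) \<le> 3 * norm (x - 0)"
  proof (rule field_differentiable_bound[of "{-1..1::real}"])
    show "(sinh has_field_derivative cosh z) (at z within {-1..1})" for z :: real
      by (auto intro!: derivative_eq_intros)
    show "norm (cosh z) \<le> 3" if "z \<in> {-1..1}" for z :: real
      using cosh_le_3[of z] cosh_real_ge_1[of z] that by auto
  qed (use assms in auto)
  then show ?thesis by simp
qed

lemma cosh_minus_1_le:
  assumes "\<bar>x\<bar> \<le> (1::real)" shows "cosh x - 1 \<le> 9 / 2 * x\<^sup>2"
proof -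
  have "cosh x - 1 = 2 * (sinh (x / 2))\<^sup>2"
    using cosh_double[of "x / 2"] cosh_square_eq[of "x / 2"] by simp
  moreover have "\<bar>sinh (x / 2)\<bar>\<^sup>2 \<le> (3 * \<bar>x / 2\<bar>)\<^sup>2"
    using assms by (intro power_mono abs_sinh_le) auto
  ultimately show ?thesis by (simp add: power_mult_distrib power_divide)
qed

lemma sinh_le_mult_cosh:
  assumes "0 \<le> (t::real)" shows "sinh t \<le> t * cosh t"
proof -
  have "0 * cosh 0 - sinh 0 \<le> t * cosh t - sinh t"
  proof (rule DERIV_nonneg_imp_nondecreasing[OF assms, where f = "\<lambda>t. t * cosh t - sinh t"])
    fix x :: real assume "0 \<le> x"
    moreover have "((\<lambda>t. t * cosh t - sinh t) has_real_derivative x * sinh x) (at x)"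
      by (auto intro!: derivative_eq_intros)
    ultimately show "\<exists>y. ((\<lambda>t. t * cosh t - sinh t) has_real_derivative y) (at x) \<and> 0 \<le> y" by auto
  qed
  then show ?thesis by simp
qed

lemma le_sinh: "0 \<le> (t::real) \<Longrightarrow> t \<le> sinh t"
  using real_le_x_sinh[of t] by (simp add: sinh_field_def exp_minus)

text \<open>Everything follows from \<open>t <= sinh t <= t cosh t\<close>: the numerator
  \<open>t cosh t - sinh t\<close> is at most \<open>t (cosh t - 1)\<close>, hence cubic in
  \<open>t\<close>. The second quotient is the derivative of \<open>t coth t\<close>, the function
  behind the entropic average.\<close>

lemma mult_coth_bounds:
  assumes "0 < (t::real)" "t \<le> 1"
  shows "\<bar>t * cosh t / sinh t - 1\<bar> \<le> 9 / 2 * t\<^sup>2"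
    and "\<bar>(cosh t * sinh t - t) / (sinh t)\<^sup>2\<bar> \<le> 18 * t"
proof -
  have s: "t \<le> sinh t" "sinh t \<le> t * cosh t" using assms by (auto intro: le_sinh sinh_le_mult_cosh)
  have c: "cosh t - 1 \<le> 9 / 2 * t\<^sup>2" "cosh t \<le> 3" "1 \<le> cosh t"
    using assms cosh_minus_1_le[of t] cosh_le_3[of t] cosh_real_ge_1[of t] by (simp_all del: cosh_real_ge_1)
  have tc: "t * (cosh t - 1) \<le> 9 / 2 * t ^ 3"
    using mult_left_mono[OF c(1), of t] assms by (simp add: power2_eq_square power3_eq_cube)
  have eq: "t * cosh t / sinh t - 1 = (t * cosh t - sinh t) / sinh t"
    using s assms by (simp add: diff_divide_distrib)
  have nonneg: "0 \<le> (t * cosh t - sinh t) / sinh t" using s assms by simp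
  have "(t * cosh t - sinh t) / sinh t \<le> (9 / 2 * t ^ 3) / t"
    using s tc assms by (intro frac_le) (auto simp: algebra_simps)
  also have "\<dots> = 9 / 2 * t\<^sup>2" using assms by (simp add: power2_eq_square power3_eq_cube)
  finally show "\<bar>t * cosh t / sinh t - 1\<bar> \<le> 9 / 2 * t\<^sup>2" unfolding eq abs_of_nonneg[OF nonneg] .
  have "cosh t * sinh t - t = cosh t * (sinh t - t) + t * (cosh t - 1)" by (simp add: algebra_simps)
  also have "\<dots> \<le> 3 * (t * (cosh t - 1)) + t * (cosh t - 1)"
    using s c by (intro add_right_mono mult_mono) (auto simp: algebra_simps)
  also have "\<dots> \<le> 18 * t ^ 3" using tc by simp
  finally have "cosh t * sinh t - t \<le> 18 * t ^ 3" .
  moreover have "0 \<le> cosh t * sinh t - t"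
    using mult_mono[of 1 "cosh t" t "sinh t"] s c assms by simp
  ultimately have "\<bar>(cosh t * sinh t - t) / (sinh t)\<^sup>2\<bar> \<le> (18 * t ^ 3) / t\<^sup>2"
    using s assms by (simp add: frac_le power_mono)
  also have "\<dots> = 18 * t" using assms by (simp add: power2_eq_square power3_eq_cube)
  finally show "\<bar>(cosh t * sinh t - t) / (sinh t)\<^sup>2\<bar> \<le> 18 * t" .
qed

text \<open>Mean value theorem on a half-open interval: at 0 the quotient has the form 0/0, and
  comparison with that point is made separately through the first bound of
  \<open>mult_coth_bounds\<close>.\<close>

lemma mult_coth_lipschitz:
  assumes "0 < x" "x \<le> r" "0 < y" "y \<le> r" "r \<le> (1::real)"
  shows "\<bar>x * cosh x / sinh x - y * cosh y / sinh y\<bar> \<le> 18 * r * \<bar>x - y\<bar>"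
proof -
  have "norm (x * cosh x / sinh x - y * cosh y / sinh y) \<le> 18 * r * norm (x - y)"
  proof (rule field_differentiable_bound[of "{0<..r}"])
    fix z assume z: "z \<in> {0<..r}"
    then have sz: "sinh z \<noteq> 0" by auto
    have e: "cosh z * cosh z = 1 + sinh z * sinh z" using cosh_square_eq[of z] by (simp add: power2_eq_square)
    have "((\<lambda>z. z * cosh z / sinh z) has_real_derivative
       ((cosh z + z * sinh z) * sinh z - z * cosh z * cosh z) / (sinh z * sinh z)) (at z within {0<..r})"
      using sz by (auto intro!: derivative_eq_intros)
    also have "(cosh z + z * sinh z) * sinh z - z * cosh z * cosh z = cosh z * sinh z - z"
      using e by (simp add: algebra_simps)
    finally show "((\<lambda>z. z * cosh z / sinh z) has_real_derivative (cosh z * sinh z - z) / (sinh z)\<^sup>2) (at z within {0<..r})"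
      by (simp add: power2_eq_square)
    show "norm ((cosh z * sinh z - z) / (sinh z)\<^sup>2) \<le> 18 * r"
      using mult_coth_bounds(2)[of z] z assms by auto
  qed (use assms in auto)
  then show ?thesis by simp
qed

text \<open>These two are \<open>G\<close> and \<open>H\<close> of the overview. Expanding
  \<open>u' exp \<delta> - u\<close> in the difference and the mean of \<open>u\<close> and
  \<open>u'\<close> gives the coefficients \<open>(exp \<delta> + 1) / 2\<close> and
  \<open>exp \<delta> - 1\<close>, each multiplied by the average between \<open>0\<close> and
  \<open>\<delta>\<close>.\<close>

definition diffusion_weight :: "mobility_average \<Rightarrow> real \<Rightarrow> real" where
  "diffusion_weight avg \<delta> = mobility avg 0 \<delta> * (exp \<delta> + 1) / 2"

definition drift_weight :: "mobility_average \<Rightarrow> real \<Rightarrow> real" where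
  "drift_weight avg \<delta> = mobility avg 0 \<delta> * (exp \<delta> - 1)"

text \<open>Each average is homogeneous of degree -1 in the pair \<open>exp s\<close>,
  \<open>exp s'\<close>, so the level of the potential factors out and only its jump
  remains.\<close>

lemma mobility_translate: "mobility avg s s' = exp (- s) * mobility avg 0 (s' - s)"
proof (cases avg)
  case Harmonic
  have "exp s' + exp s = exp s * (exp (s' - s) + 1)" by (simp add: distrib_left flip: exp_add)
  then have "mobility avg s s' = inverse (exp s * ((exp (s' - s) + 1) / 2))" by (simp add: Harmonic)
  also have "\<dots> = inverse (exp s) * inverse ((exp (s' - s) + 1) / 2)" by (rule inverse_mult_distrib)
  finally show ?thesis by (simp add: Harmonic exp_minus)
next
  case Entropic
  have "exp s' - exp s = exp s * (exp (s' - s) - 1)" by (simp add: right_diff_distrib flip: exp_add)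
  then show ?thesis by (simp add: Entropic exp_minus divide_inverse)
next
  case Geometric
  have "- (s' + s) / 2 = - s + - (s' - s) / 2" by (simp add: field_simps)
  then show ?thesis by (simp add: Geometric flip: exp_add)
next
  case Arithmetic
  have "exp (- s') = exp (- s) * exp (- (s' - s))" by (simp flip: exp_add)
  then show ?thesis by (simp add: Arithmetic distrib_left)
qed

lemma mobility_mult_difference:
  "mobility avg s s' * (u' * exp s' - u * exp s) =
    diffusion_weight avg (s' - s) * (u' - u) + drift_weight avg (s' - s) * (u' + u) / 2"
proof -
  have e: "exp s' = exp s * exp (s' - s)" by (simp flip: exp_add)
  have "mobility avg s s' * (u' * exp s' - u * exp s) =
      (exp (- s) * exp s) * (mobility avg 0 (s' - s) * (u' * exp (s' - s) - u))"
    unfolding mobility_translate[of avg s s'] e by (simp add: algebra_simps)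
  also have "exp (- s) * exp s = 1" by (simp flip: exp_add)
  finally show ?thesis
    unfolding diffusion_weight_def drift_weight_def by (simp add: algebra_simps add_divide_distrib diff_divide_distrib)
qed

text \<open>The harmonic average leaves the diffusion uncorrected. The entropic one gives
  \<open>x coth x\<close> at \<open>x = \<delta> / 2\<close> together with the drift weight
  \<open>\<delta>\<close> itself, which is the Scharfetter-Gummel flux.\<close>

lemma diffusion_weight_simps:
  "diffusion_weight Harmonic \<delta> = 1"
  "diffusion_weight Geometric \<delta> = cosh (\<delta> / 2)"
  "diffusion_weight Arithmetic \<delta> = (1 + cosh \<delta>) / 2"
  "diffusion_weight Entropic \<delta> = (if \<delta> = 0 then 1 else \<delta> / 2 * cosh (\<delta> / 2) / sinh (\<delta> / 2))"
proof -
  have e: "exp \<delta> = exp (\<delta> / 2) * exp (\<delta> / 2)" by (simp flip: exp_add)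
  have pos: "exp \<delta> + 1 > 0" by (intro add_pos_pos) auto
  show "diffusion_weight Harmonic \<delta> = 1" using pos by (simp add: diffusion_weight_def field_simps)
  show "diffusion_weight Geometric \<delta> = cosh (\<delta> / 2)"
    by (simp add: diffusion_weight_def cosh_field_def e exp_minus field_simps)
  show "diffusion_weight Arithmetic \<delta> = (1 + cosh \<delta>) / 2"
    by (simp add: diffusion_weight_def cosh_field_def exp_minus field_simps)
  show "diffusion_weight Entropic \<delta> = (if \<delta> = 0 then 1 else \<delta> / 2 * cosh (\<delta> / 2) / sinh (\<delta> / 2))"
  proof (cases "\<delta> = 0")
    case False
    define E where "E = exp (\<delta> / 2)"
    have E: "E > 0" "E * E \<noteq> 1" using False e by (auto simp: E_def)
    have "diffusion_weight Entropic \<delta> = \<delta> / (E * E - 1) * (E * E + 1) / 2"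
      using False by (simp add: diffusion_weight_def e E_def)
    also have "\<dots> = \<delta> / 2 * ((E * E + 1) / (E * E - 1))" by simp
    finally have "diffusion_weight Entropic \<delta> = \<delta> / 2 * ((E * E + 1) / (E * E - 1))" .
    moreover have "\<delta> / 2 * cosh (\<delta> / 2) / sinh (\<delta> / 2) = \<delta> / 2 * ((E + 1 / E) / (E - 1 / E))"
      by (simp add: cosh_field_def sinh_field_def exp_minus E_def inverse_eq_divide)
    moreover have "(E + 1 / E) / (E - 1 / E) = (E * E + 1) / (E * E - 1)"
    proof -
      have "E + 1 / E = (E * E + 1) / E" "E - 1 / E = (E * E - 1) / E" using E by (simp_all add: field_simps)
      then show ?thesis using E by simp
    qed
    ultimately show ?thesis using False by (simp only: if_False)
  qed (simp add: diffusion_weight_def)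
qed

lemma drift_weight_simps:
  "drift_weight Harmonic \<delta> = 2 * (exp \<delta> - 1) / (exp \<delta> + 1)"
  "drift_weight Geometric \<delta> = 2 * sinh (\<delta> / 2)"
  "drift_weight Arithmetic \<delta> = sinh \<delta>"
  "drift_weight Entropic \<delta> = \<delta>"
proof -
  have e: "exp \<delta> = exp (\<delta> / 2) * exp (\<delta> / 2)" by (simp flip: exp_add)
  show "drift_weight Harmonic \<delta> = 2 * (exp \<delta> - 1) / (exp \<delta> + 1)"
    by (simp add: drift_weight_def)
  show "drift_weight Geometric \<delta> = 2 * sinh (\<delta> / 2)"
    by (simp add: drift_weight_def sinh_field_def e exp_minus field_simps)
  show "drift_weight Arithmetic \<delta> = sinh \<delta>"
    by (simp add: drift_weight_def sinh_field_def exp_minus field_simps)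
  show "drift_weight Entropic \<delta> = \<delta>" by (simp add: drift_weight_def)
qed

lemma weights_0 [simp]: "diffusion_weight avg 0 = 1" "drift_weight avg 0 = 0"
  by (cases avg; simp add: diffusion_weight_simps drift_weight_simps)+

lemma diffusion_weight_even: "diffusion_weight avg (- \<delta>) = diffusion_weight avg \<delta>"
  by (cases avg) (simp_all add: diffusion_weight_simps)

lemma drift_weight_odd: "drift_weight avg (- \<delta>) = - drift_weight avg \<delta>"
proof (cases avg)
  case Harmonic
  have pos: "exp \<delta> + 1 > 0" by (intro add_pos_pos) auto
  have "2 * (1 / E - 1) / (1 / E + 1) = - (2 * (E - 1) / (E + 1))" if "E > 0" for E :: real
  proof -
    have eqs: "1 / E - 1 = (1 - E) / E" "1 / E + 1 = (E + 1) / E" using that by (simp_all add: field_simps)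
    show ?thesis unfolding eqs using that by (simp add: divide_simps)
  qed
  then show ?thesis by (simp add: Harmonic drift_weight_simps exp_minus inverse_eq_divide)
qed (simp_all add: drift_weight_simps)

text \<open>An even weight has derivative 0 at 0, hence a Lipschitz constant on
  \<open>[-r, r]\<close> proportional to \<open>r\<close>. The generous 18 covers all four averages.
  The entropic one is treated on nonnegative arguments first and carried over by evenness.\<close>

lemma diffusion_weight_lipschitz:
  assumes "\<bar>x\<bar> \<le> r" "\<bar>y\<bar> \<le> r" "r \<le> 1"
  shows "\<bar>diffusion_weight avg x - diffusion_weight avg y\<bar> \<le> 18 * r * \<bar>x - y\<bar>"
proof -
  have r: "0 \<le> r" using assms by linarith
  have bound: "norm (f x - f y) \<le> 18 * r * norm (x - y)"
    if "\<And>z. (f has_real_derivative f' z) (at z)" "\<And>z. \<bar>z\<bar> \<le> 1 \<Longrightarrow> \<bar>f' z\<bar> \<le> 18 * \<bar>z\<bar>" for f f'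
  proof (rule field_differentiable_bound[of "{-r..r}" f f'])
    show "norm (f' z) \<le> 18 * r" if "z \<in> {-r..r}" for z
    proof -
      have "norm (f' z) \<le> 18 * \<bar>z\<bar>" using \<open>\<And>z. \<bar>z\<bar> \<le> 1 \<Longrightarrow> \<bar>f' z\<bar> \<le> 18 * \<bar>z\<bar>\<close>[of z] that assms by auto
      then show ?thesis using that by auto
    qed
  qed (use assms that(1) in \<open>auto intro: has_field_derivative_at_within\<close>)
  show ?thesis
  proof (cases avg)
    case Harmonic
    then show ?thesis using r by (simp add: diffusion_weight_simps)
  next
    case Geometric
    have "norm (cosh (x / 2) - cosh (y / 2)) \<le> 18 * r * norm (x - y)"
    proof (rule bound[where f = "\<lambda>x. cosh (x / 2)"])
      show "((\<lambda>x. cosh (x / 2)) has_real_derivative sinh (z / 2) / 2) (at z)" for z :: real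
        by (auto intro!: derivative_eq_intros)
      show "\<bar>sinh (z / 2) / 2\<bar> \<le> 18 * \<bar>z\<bar>" if "\<bar>z\<bar> \<le> 1" for z :: real
        using abs_sinh_le[of "z / 2"] that by simp
    qed
    then show ?thesis by (simp add: Geometric diffusion_weight_simps)
  next
    case Arithmetic
    have "norm ((1 + cosh x) / 2 - (1 + cosh y) / 2) \<le> 18 * r * norm (x - y)"
    proof (rule bound[where f = "\<lambda>x. (1 + cosh x) / 2"])
      show "((\<lambda>x. (1 + cosh x) / 2) has_real_derivative sinh z / 2) (at z)" for z :: real
        by (auto intro!: derivative_eq_intros)
      show "\<bar>sinh z / 2\<bar> \<le> 18 * \<bar>z\<bar>" if "\<bar>z\<bar> \<le> 1" for z :: real
        using abs_sinh_le[of z] that by simp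
    qed
    then show ?thesis by (simp only: Arithmetic diffusion_weight_simps real_norm_def)
  next
    case Entropic
    define f where "f = diffusion_weight Entropic"
    have even: "f \<bar>z\<bar> = f z" for z by (cases "z \<ge> 0") (auto simp: f_def diffusion_weight_even)
    have f_at_0: "f 0 = 1" by (simp add: f_def)
    have f0: "\<bar>f z - 1\<bar> \<le> 18 * r * z" if "0 < z" "z \<le> r" for z
    proof -
      have "\<bar>f z - 1\<bar> \<le> 9 / 2 * (z / 2)\<^sup>2"
        using mult_coth_bounds(1)[of "z / 2"] that assms by (simp add: f_def diffusion_weight_simps)
      also have "\<dots> \<le> 18 * r * z" using that r mult_right_mono[of z r z] by (simp add: power2_eq_square)
      finally show ?thesis .
    qed
    have pos: "\<bar>f u - f v\<bar> \<le> 18 * r * \<bar>u - v\<bar>" if uv: "0 \<le> u" "u \<le> r" "0 \<le> v" "v \<le> r" for u v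
    proof -
      consider "u = 0" "v = 0" | "u = 0" "v > 0" | "v = 0" "u > 0" | "u > 0" "v > 0" using uv by (cases "u = 0"; cases "v = 0") auto
      then show ?thesis
      proof cases
        case 4
        then have "\<bar>f u - f v\<bar> \<le> 18 * (r / 2) * \<bar>u / 2 - v / 2\<bar>"
          using mult_coth_lipschitz[of "u / 2" "r / 2" "v / 2"] uv assms by (simp add: f_def diffusion_weight_simps)
        also have "\<dots> = 18 * r * \<bar>u - v\<bar> / 4" by (simp add: abs_if)
        also have "\<dots> \<le> 18 * r * \<bar>u - v\<bar>" using r by simp
        finally show ?thesis .
      next
        case 2
        then show ?thesis using f0[of v] uv by (simp add: f_at_0 abs_minus_commute[of 1])
      qed (use f0[of u] uv in \<open>simp_all add: f_at_0\<close>)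
    qed
    have "\<bar>f x - f y\<bar> \<le> 18 * r * \<bar>\<bar>x\<bar> - \<bar>y\<bar>\<bar>" using pos[of "\<bar>x\<bar>" "\<bar>y\<bar>"] assms by (simp add: even)
    also have "\<dots> \<le> 18 * r * \<bar>x - y\<bar>" using r by (intro mult_left_mono) auto
    finally show ?thesis by (simp add: f_def Entropic)
  qed
qed

text \<open>The odd weight agrees with the identity to third order, so the derivative of the
  difference is of quadratic size. The 9 comes from the harmonic case: the derivative of
  \<open>2 tanh (x / 2) - x\<close> is minus the square of \<open>(exp x - 1) / (exp x + 1)\<close>,
  whose numerator is at most \<open>3 |x|\<close> in absolute value.\<close>

lemma drift_weight_lipschitz:
  assumes "\<bar>x\<bar> \<le> r" "\<bar>y\<bar> \<le> r" "r \<le> 1"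
  shows "\<bar>(drift_weight avg x - x) - (drift_weight avg y - y)\<bar> \<le> 9 * r\<^sup>2 * \<bar>x - y\<bar>"
proof -
  have r: "0 \<le> r" using assms by linarith
  have bound: "norm (f x - f y) \<le> 9 * r\<^sup>2 * norm (x - y)"
    if "\<And>z. (f has_real_derivative f' z) (at z)" "\<And>z. \<bar>z\<bar> \<le> 1 \<Longrightarrow> \<bar>f' z\<bar> \<le> 9 * z\<^sup>2" for f f'
  proof (rule field_differentiable_bound[of "{-r..r}" f f'])
    show "norm (f' z) \<le> 9 * r\<^sup>2" if "z \<in> {-r..r}" for z
    proof -
      have "norm (f' z) \<le> 9 * z\<^sup>2" using \<open>\<And>z. \<bar>z\<bar> \<le> 1 \<Longrightarrow> \<bar>f' z\<bar> \<le> 9 * z\<^sup>2\<close>[of z] that assms by auto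
      also have "\<dots> \<le> 9 * r\<^sup>2" using that r by (auto simp: abs_le_square_iff[symmetric])
      finally show ?thesis .
    qed
  qed (use assms that(1) in \<open>auto intro: has_field_derivative_at_within\<close>)
  show ?thesis
  proof (cases avg)
    case Harmonic
    have "norm ((2 * (exp x - 1) / (exp x + 1) - x) - (2 * (exp y - 1) / (exp y + 1) - y)) \<le> 9 * r\<^sup>2 * norm (x - y)"
    proof (rule bound[where f = "\<lambda>x. 2 * (exp x - 1) / (exp x + 1) - x"])
      fix z :: real
      have pos: "exp z + 1 > 0" by (intro add_pos_pos) auto
      have "((\<lambda>x. 2 * (exp x - 1) / (exp x + 1) - x) has_real_derivative
          (2 * exp z * (exp z + 1) - 2 * (exp z - 1) * exp z) / ((exp z + 1) * (exp z + 1)) - 1) (at z)"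
        using pos by (auto intro!: derivative_eq_intros)
      also have "(2 * exp z * (exp z + 1) - 2 * (exp z - 1) * exp z) / ((exp z + 1) * (exp z + 1)) - 1 = - ((exp z - 1) / (exp z + 1))\<^sup>2"
        using pos by (simp add: power_divide divide_simps) (simp add: power2_eq_square algebra_simps)
      finally show "((\<lambda>x. 2 * (exp x - 1) / (exp x + 1) - x) has_real_derivative - ((exp z - 1) / (exp z + 1))\<^sup>2) (at z)" .
    next
      fix z :: real assume z: "\<bar>z\<bar> \<le> 1"
      have "norm (exp z - exp 0) \<le> 3 * norm (z - 0)"
      proof (rule field_differentiable_bound[of "{-1..1::real}"])
        show "(exp has_field_derivative exp z) (at z within {-1..1})" for z :: real
          by (auto intro!: derivative_eq_intros)
        show "norm (exp z) \<le> 3" if "z \<in> {-1..1}" for z :: real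
          by (simp, rule order_trans[OF _ exp_le]) (use that in simp)
      qed (use z in auto)
      then have e: "\<bar>exp z - 1\<bar> \<le> 3 * \<bar>z\<bar>" by simp
      have "\<bar>(exp z - 1) / (exp z + 1)\<bar> \<le> (3 * \<bar>z\<bar>) / 1"
        using e by (simp only: abs_divide) (intro frac_le; simp)
      then have "\<bar>(exp z - 1) / (exp z + 1)\<bar>\<^sup>2 \<le> (3 * \<bar>z\<bar>)\<^sup>2" by (intro power_mono) auto
      then have "((exp z - 1) / (exp z + 1))\<^sup>2 \<le> 9 * z\<^sup>2" unfolding power2_abs power_mult_distrib by simp
      then show "\<bar>- ((exp z - 1) / (exp z + 1))\<^sup>2\<bar> \<le> 9 * z\<^sup>2" unfolding abs_minus_cancel abs_power2 .
    qed
    then show ?thesis by (simp only: Harmonic drift_weight_simps real_norm_def)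
  next
    case Geometric
    have "norm ((2 * sinh (x / 2) - x) - (2 * sinh (y / 2) - y)) \<le> 9 * r\<^sup>2 * norm (x - y)"
    proof (rule bound[where f = "\<lambda>x. 2 * sinh (x / 2) - x"])
      show "((\<lambda>x. 2 * sinh (x / 2) - x) has_real_derivative cosh (z / 2) - 1) (at z)" for z :: real
        by (auto intro!: derivative_eq_intros)
      show "\<bar>cosh (z / 2) - 1\<bar> \<le> 9 * z\<^sup>2" if "\<bar>z\<bar> \<le> 1" for z :: real
        using cosh_minus_1_le[of "z / 2"] that cosh_real_ge_1[of "z / 2"] zero_le_power2[of z]
        by (simp add: power_divide)
    qed
    then show ?thesis by (simp only: Geometric drift_weight_simps real_norm_def)
  next
    case Arithmetic
    have "norm ((sinh x - x) - (sinh y - y)) \<le> 9 * r\<^sup>2 * norm (x - y)"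
    proof (rule bound[where f = "\<lambda>x. sinh x - x"])
      show "((\<lambda>x. sinh x - x) has_real_derivative cosh z - 1) (at z)" for z :: real
        by (auto intro!: derivative_eq_intros)
      show "\<bar>cosh z - 1\<bar> \<le> 9 * z\<^sup>2" if "\<bar>z\<bar> \<le> 1" for z :: real
        using cosh_minus_1_le[of z] that cosh_real_ge_1[of z] zero_le_power2[of z] by simp
    qed
    then show ?thesis by (simp only: Arithmetic drift_weight_simps real_norm_def)
  next
    case Entropic
    then show ?thesis by (simp add: drift_weight_simps)
  qed
qed

section \<open>Consistency\<close>

text \<open>Maclaurin expansions at \<open>h\<close> and \<open>- h\<close> with Lagrange remainder:
  adding cancels the odd powers, subtracting the even ones. The factorials in the remainders allow
  the plain constant \<open>B\<close>.\<close>

lemma central_difference_bounds: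
  fixes f f1 f2 f3 f4 :: "real \<Rightarrow> real"
  assumes d: "\<And>s. (f has_real_derivative f1 s) (at s)" "\<And>s. (f1 has_real_derivative f2 s) (at s)"
      "\<And>s. (f2 has_real_derivative f3 s) (at s)" "\<And>s. (f3 has_real_derivative f4 s) (at s)"
    and B: "\<And>s. \<bar>f1 s\<bar> \<le> B" "\<And>s. \<bar>f2 s\<bar> \<le> B" "\<And>s. \<bar>f3 s\<bar> \<le> B" "\<And>s. \<bar>f4 s\<bar> \<le> B"
    and h: "h \<ge> 0"
  shows "\<bar>f h - f 0\<bar> \<le> B * h" "\<bar>f (- h) - f 0\<bar> \<le> B * h"
    and "\<bar>f h + f (- h) - 2 * f 0\<bar> \<le> B * h\<^sup>2"
    and "\<bar>f h - f (- h) - 2 * h * f1 0\<bar> \<le> B * h ^ 3"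
    and "\<bar>f h + f (- h) - 2 * f 0 - h\<^sup>2 * f2 0\<bar> \<le> B * h ^ 4"
proof -
  define D where "D m = (if m = 0 then f else if m = 1 then f1 else if m = 2 then f2 else if m = 3 then f3 else f4)" for m :: nat
  have D: "D 0 = f" "D 1 = f1" "D 2 = f2" "D 3 = f3" "D 4 = f4" "D (Suc 0) = f1" by (simp_all add: D_def)
  have der: "\<forall>m t. m < n \<and> \<bar>t\<bar> \<le> \<bar>x\<bar> \<longrightarrow> (D m has_real_derivative D (Suc m) t) (at t)" if "n \<le> 4" for n x
  proof (intro allI impI)
    fix m t assume "m < n \<and> \<bar>t\<bar> \<le> \<bar>x\<bar>"
    then consider "m = 0" | "m = 1" | "m = 2" | "m = 3" using \<open>n \<le> 4\<close> by linarith
    then show "(D m has_real_derivative D (Suc m) t) (at t)"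
      by cases (use d in \<open>simp_all add: D_def\<close>)
  qed
  have taylor: "\<exists>t. f x = (\<Sum>m<n. D m 0 / fact m * x ^ m) + D n t / fact n * x ^ n" if "n \<le> 4" for n x
    using Maclaurin_bi_le[OF D(1) der[OF that]] by blast
  have B0: "B \<ge> 0" using B(1)[of 0] by linarith
  have mulB: "\<bar>u * h ^ n\<bar> \<le> C * h ^ n" if "\<bar>u\<bar> \<le> C" for u C n
    using that h by (simp add: abs_mult mult_right_mono)
  obtain s1 where "f h = f 0 + f1 s1 * h" using taylor[of 1 h] by (auto simp: D)
  then show "\<bar>f h - f 0\<bar> \<le> B * h" using mulB[OF B(1)[of s1], of 1] by simp
  obtain s2 where "f (- h) = f 0 - f1 s2 * h" using taylor[of 1 "- h"] by (auto simp: D)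
  then show "\<bar>f (- h) - f 0\<bar> \<le> B * h" using mulB[OF B(1)[of s2], of 1] by simp
  have sets: "{..<2::nat} = {0, 1}" "{..<3::nat} = {0, 1, 2}" "{..<4::nat} = {0, 1, 2, 3}" by auto
  obtain t1 where t1: "f h = f 0 + f1 0 * h + f2 t1 / 2 * h\<^sup>2" using taylor[of 2 h] by (auto simp: D sets)
  obtain t2 where t2: "f (- h) = f 0 - f1 0 * h + f2 t2 / 2 * h\<^sup>2" using taylor[of 2 "- h"] by (auto simp: D sets)
  have "\<bar>(f2 t1 / 2 + f2 t2 / 2) * h\<^sup>2\<bar> \<le> B * h\<^sup>2"
    using B(2)[of t1] B(2)[of t2] by (intro mulB) linarith
  then show "\<bar>f h + f (- h) - 2 * f 0\<bar> \<le> B * h\<^sup>2" unfolding t1 t2 by (simp add: algebra_simps)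
  obtain u1 where "f h = (\<Sum>m<3. D m 0 / fact m * h ^ m) + D 3 u1 / fact 3 * h ^ 3"
    using taylor[of 3 "h"] by auto
  then have u1: "f h = f 0 + f1 0 * h + f2 0 / 2 * h\<^sup>2 + f3 u1 / 6 * h ^ 3"
    by (simp add: D sets fact_numeral)
  obtain u2 where "f (- h) = (\<Sum>m<3. D m 0 / fact m * (- h) ^ m) + D 3 u2 / fact 3 * (- h) ^ 3"
    using taylor[of 3 "- h"] by auto
  then have u2: "f (- h) = f 0 - f1 0 * h + f2 0 / 2 * h\<^sup>2 - f3 u2 / 6 * h ^ 3"
    by (simp add: D sets fact_numeral)
  have "\<bar>(f3 u1 / 6 + f3 u2 / 6) * h ^ 3\<bar> \<le> B * h ^ 3"
    using B(3)[of u1] B(3)[of u2] by (intro mulB) linarith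
  then show "\<bar>f h - f (- h) - 2 * h * f1 0\<bar> \<le> B * h ^ 3" unfolding u1 u2 by (simp add: algebra_simps)
  obtain v1 where "f h = (\<Sum>m<4. D m 0 / fact m * h ^ m) + D 4 v1 / fact 4 * h ^ 4"
    using taylor[of 4 "h"] by auto
  then have v1: "f h = f 0 + f1 0 * h + f2 0 / 2 * h\<^sup>2 + f3 0 / 6 * h ^ 3 + f4 v1 / 24 * h ^ 4"
    by (simp add: D sets fact_numeral)
  obtain v2 where "f (- h) = (\<Sum>m<4. D m 0 / fact m * (- h) ^ m) + D 4 v2 / fact 4 * (- h) ^ 4"
    using taylor[of 4 "- h"] by auto
  then have v2: "f (- h) = f 0 - f1 0 * h + f2 0 / 2 * h\<^sup>2 - f3 0 / 6 * h ^ 3 + f4 v2 / 24 * h ^ 4"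
    by (simp add: D sets fact_numeral)
  have "\<bar>(f4 v1 / 24 + f4 v2 / 24) * h ^ 4\<bar> \<le> B * h ^ 4"
    using B(4)[of v1] B(4)[of v2] by (intro mulB) linarith
  then show "\<bar>f h + f (- h) - 2 * f 0 - h\<^sup>2 * f2 0\<bar> \<le> B * h ^ 4" unfolding v1 v2 by (simp add: algebra_simps)
qed

text \<open>This is \<open>h\<close> times the flux through a face, oriented away from the cell with
  value \<open>u\<close>. Exchanging the two cells flips the sign, so the discrete divergence
  becomes a sum of jumps from the centre to its neighbours.\<close>

definition weighted_jump :: "mobility_average \<Rightarrow> real \<Rightarrow> real \<Rightarrow> real \<Rightarrow> real" where
  "weighted_jump avg \<sigma> u u' = diffusion_weight avg \<sigma> * (u' - u) + drift_weight avg \<sigma> * (u' + u) / 2"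

lemma weighted_jump_swap: "weighted_jump avg (- \<sigma>) u' u = - weighted_jump avg \<sigma> u u'"
  by (simp add: weighted_jump_def diffusion_weight_even drift_weight_odd algebra_simps add_divide_distrib diff_divide_distrib)

text \<open>
  The weights satisfy \<open>diffusion_weight = 1 + O(\<sigma>\<^sup>2)\<close> (even) and \<open>drift_weight = \<sigma> + O(\<sigma>\<^sup>3)\<close> (odd). As
  \<open>\<sigma>p + \<sigma>m = O(h\<^sup>2)\<close>, the contributions of the correction terms from both sides cancel up to \<open>O(h\<^sup>4)\<close>.
\<close>

lemma weighted_jump_sum_estimate:
  assumes B: "B \<ge> 1" and h: "0 \<le> h" "B * h \<le> 1"
    and \<sigma>: "\<bar>\<sigma>p\<bar> \<le> B * h" "\<bar>\<sigma>m\<bar> \<le> B * h" "\<bar>\<sigma>p + \<sigma>m\<bar> \<le> B * h\<^sup>2" "\<bar>\<sigma>p - \<sigma>m - 2 * h * S1\<bar> \<le> B * h ^ 3" "\<bar>\<sigma>p + \<sigma>m - h\<^sup>2 * S2\<bar> \<le> B * h ^ 4"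
    and c: "\<bar>cp - c0\<bar> \<le> B * h" "\<bar>cm - c0\<bar> \<le> B * h" "\<bar>cp + cm - 2 * c0\<bar> \<le> B * h\<^sup>2" "\<bar>cp - cm - 2 * h * c1\<bar> \<le> B * h ^ 3" "\<bar>cp + cm - 2 * c0 - h\<^sup>2 * c2\<bar> \<le> B * h ^ 4"
    and bd: "\<bar>cp\<bar> \<le> B" "\<bar>cm\<bar> \<le> B" "\<bar>c0\<bar> \<le> B" "\<bar>S1\<bar> \<le> B" "\<bar>S2\<bar> \<le> B"
  shows "\<bar>weighted_jump avg \<sigma>p c0 cp + weighted_jump avg \<sigma>m c0 cm - h\<^sup>2 * (c2 + S1 * c1 + S2 * c0)\<bar> \<le> 60 * B ^ 4 * h ^ 4"
proof -
  define G where "G = diffusion_weight avg"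
  define H where "H s = drift_weight avg s - s" for s
  have am: "\<bar>x * y\<bar> \<le> X * Y" if "\<bar>x\<bar> \<le> X" "\<bar>y\<bar> \<le> Y" for x y X Y :: real
    using that by (simp add: abs_mult mult_mono)
  have G_lip: "\<bar>G x - G y\<bar> \<le> 18 * (B * h) * \<bar>x - y\<bar>" if "\<bar>x\<bar> \<le> B * h" "\<bar>y\<bar> \<le> B * h" for x y
    unfolding G_def by (rule diffusion_weight_lipschitz[OF that h(2)])
  have H_lip: "\<bar>H x - H y\<bar> \<le> 9 * (B * h)\<^sup>2 * \<bar>x - y\<bar>" if "\<bar>x\<bar> \<le> B * h" "\<bar>y\<bar> \<le> B * h" for x y
    unfolding H_def by (rule drift_weight_lipschitz[OF that h(2)])
  have Bh: "0 \<le> B * h" using B h by simp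
  have "\<bar>G \<sigma>p - 1\<bar> \<le> 18 * (B * h) * \<bar>\<sigma>p\<bar>" using G_lip[of \<sigma>p 0] \<sigma> Bh by (simp add: G_def)
  also have "\<dots> \<le> 18 * (B * h) * (B * h)" using \<sigma> Bh by (intro mult_left_mono) auto
  finally have G1: "\<bar>G \<sigma>p - 1\<bar> \<le> 18 * (B * h) * (B * h)" .
  have "\<bar>G \<sigma>p - G \<sigma>m\<bar> \<le> 18 * (B * h) * \<bar>\<sigma>p + \<sigma>m\<bar>" using G_lip[of \<sigma>p "- \<sigma>m"] \<sigma> by (simp add: G_def diffusion_weight_even)
  also have "\<dots> \<le> 18 * (B * h) * (B * h\<^sup>2)" using \<sigma> Bh by (intro mult_left_mono) auto
  finally have G2: "\<bar>G \<sigma>p - G \<sigma>m\<bar> \<le> 18 * (B * h) * (B * h\<^sup>2)" .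
  have "\<bar>H \<sigma>m\<bar> \<le> 9 * (B * h)\<^sup>2 * \<bar>\<sigma>m\<bar>" using H_lip[of \<sigma>m 0] \<sigma> Bh by (simp add: H_def)
  also have "\<dots> \<le> 9 * (B * h)\<^sup>2 * (B * h)" using \<sigma> by (intro mult_left_mono) auto
  finally have H1: "\<bar>H \<sigma>m\<bar> \<le> 9 * (B * h)\<^sup>2 * (B * h)" .
  have "\<bar>H \<sigma>p + H \<sigma>m\<bar> \<le> 9 * (B * h)\<^sup>2 * \<bar>\<sigma>p + \<sigma>m\<bar>"
    using H_lip[of \<sigma>p "- \<sigma>m"] \<sigma> by (simp add: H_def drift_weight_odd algebra_simps)
  also have "\<dots> \<le> 9 * (B * h)\<^sup>2 * (B * h\<^sup>2)" using \<sigma> by (intro mult_left_mono) auto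
  finally have H2: "\<bar>H \<sigma>p + H \<sigma>m\<bar> \<le> 9 * (B * h)\<^sup>2 * (B * h\<^sup>2)" .
  \<comment> \<open>\<open>e1 - e2\<close> is the correction of the diffusion weight and
    \<open>(e3 + e4) / 2\<close> that of the drift weight. The linear drift is regrouped into sums
    and differences of the two sides, which gives \<open>e5\<close> to \<open>e8\<close>;
    \<open>e9\<close> is the error of the plain second difference.\<close>
  define e1 where "e1 = (G \<sigma>p - 1) * (cp + cm - 2 * c0)"
  define e2 where "e2 = (G \<sigma>p - G \<sigma>m) * (cm - c0)"
  define e3 where "e3 = (H \<sigma>p + H \<sigma>m) * (cp + c0)"
  define e4 where "e4 = H \<sigma>m * (cm - cp)"
  define e5 where "e5 = (\<sigma>p + \<sigma>m - h\<^sup>2 * S2) * (cp + cm + 2 * c0)"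
  define e6 where "e6 = h\<^sup>2 * S2 * (cp + cm - 2 * c0)"
  define e7 where "e7 = (\<sigma>p - \<sigma>m - 2 * h * S1) * (cp - cm)"
  define e8 where "e8 = 2 * h * S1 * (cp - cm - 2 * h * c1)"
  define e9 where "e9 = cp + cm - 2 * c0 - h\<^sup>2 * c2"
  have split: "weighted_jump avg \<sigma>p c0 cp + weighted_jump avg \<sigma>m c0 cm - h\<^sup>2 * (c2 + S1 * c1 + S2 * c0) =
    e1 - e2 + (e3 + e4) / 2 + (e5 + e6 + e7 + e8) / 4 + e9"
    unfolding weighted_jump_def e1_def e2_def e3_def e4_def e5_def e6_def e7_def e8_def e9_def H_def G_def
    by (simp add: field_simps power2_eq_square)
  have hB: "B ^ k * h ^ 4 \<le> B ^ 4 * h ^ 4" if "k \<le> 4" for k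
    using that B h by (intro mult_right_mono power_increasing) auto
  have "\<bar>e1\<bar> \<le> 18 * (B * h) * (B * h) * (B * h\<^sup>2)" unfolding e1_def by (rule am[OF G1 c(3)])
  then have 1: "\<bar>e1\<bar> \<le> 18 * (B ^ 3 * h ^ 4)" by (simp add: power_numeral_reduce algebra_simps)
  have "\<bar>e2\<bar> \<le> 18 * (B * h) * (B * h\<^sup>2) * (B * h)" unfolding e2_def by (rule am[OF G2 c(2)])
  then have 2: "\<bar>e2\<bar> \<le> 18 * (B ^ 3 * h ^ 4)" by (simp add: power_numeral_reduce algebra_simps)
  have "\<bar>e3\<bar> \<le> 9 * (B * h)\<^sup>2 * (B * h\<^sup>2) * (2 * B)" unfolding e3_def using bd by (intro am[OF H2]) linarith
  then have 3: "\<bar>e3\<bar> \<le> 18 * (B ^ 4 * h ^ 4)" by (simp add: power_numeral_reduce algebra_simps)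
  have "\<bar>e4\<bar> \<le> 9 * (B * h)\<^sup>2 * (B * h) * (2 * (B * h))" unfolding e4_def using c by (intro am[OF H1]) linarith
  then have 4: "\<bar>e4\<bar> \<le> 18 * (B ^ 4 * h ^ 4)" by (simp add: power_numeral_reduce algebra_simps)
  have "\<bar>e5\<bar> \<le> B * h ^ 4 * (4 * B)" unfolding e5_def using bd by (intro am[OF \<sigma>(5)]) linarith
  then have 5: "\<bar>e5\<bar> \<le> 4 * (B ^ 2 * h ^ 4)" by (simp add: power_numeral_reduce algebra_simps)
  have "\<bar>e6\<bar> \<le> h\<^sup>2 * B * (B * h\<^sup>2)" unfolding e6_def using bd by (intro am c(3)) auto
  then have 6: "\<bar>e6\<bar> \<le> B ^ 2 * h ^ 4" by (simp add: power_numeral_reduce algebra_simps)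
  have "\<bar>e7\<bar> \<le> B * h ^ 3 * (2 * (B * h))" unfolding e7_def using c by (intro am[OF \<sigma>(4)]) linarith
  then have 7: "\<bar>e7\<bar> \<le> 2 * (B ^ 2 * h ^ 4)" by (simp add: power_numeral_reduce algebra_simps)
  have "\<bar>e8\<bar> \<le> 2 * h * B * (B * h ^ 3)" unfolding e8_def using bd h by (intro am c(4)) auto
  then have 8: "\<bar>e8\<bar> \<le> 2 * (B ^ 2 * h ^ 4)" by (simp add: power_numeral_reduce algebra_simps)
  have 9: "\<bar>e9\<bar> \<le> B ^ 1 * h ^ 4" unfolding e9_def using c(5) by simp
  define X where "X = B ^ 4 * h ^ 4"
  have X0: "0 \<le> X" using B h by (simp add: X_def)
  have X: "B * h ^ 4 \<le> X" "B ^ 2 * h ^ 4 \<le> X" "B ^ 3 * h ^ 4 \<le> X"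
    using hB[of 1] hB[of 2] hB[of 3] by (simp_all add: X_def)
  have x1: "\<bar>e1\<bar> \<le> 18 * X" using 1 X(3) by linarith
  have x2: "\<bar>e2\<bar> \<le> 18 * X" using 2 X(3) by linarith
  have x3: "\<bar>e3\<bar> \<le> 18 * X" using 3 by (simp add: X_def)
  have x4: "\<bar>e4\<bar> \<le> 18 * X" using 4 by (simp add: X_def)
  have x5: "\<bar>e5\<bar> \<le> 4 * X" using 5 X(2) by linarith
  have x6: "\<bar>e6\<bar> \<le> 1 * X" using 6 X(2) by linarith
  have x7: "\<bar>e7\<bar> \<le> 2 * X" using 7 X(2) by linarith
  have x8: "\<bar>e8\<bar> \<le> 2 * X" using 8 X(2) by linarith
  have x9: "\<bar>e9\<bar> \<le> 1 * X" using 9 X(1) by simp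
  \<comment> \<open>36 + 18 + 3 + 1 = 58, rounded up to 60.\<close>
  have "\<bar>e1 - e2 + (e3 + e4) / 2 + (e5 + e6 + e7 + e8) / 4 + e9\<bar> \<le> 60 * X"
  proof -
    have "\<bar>e1 - e2\<bar> \<le> 36 * X" using x1 x2 by linarith
    moreover have "\<bar>e3 + e4\<bar> \<le> 36 * X" using x3 x4 by linarith
    then have "\<bar>(e3 + e4) / 2\<bar> \<le> 18 * X" by simp
    moreover have "\<bar>e5 + e6\<bar> \<le> 5 * X" "\<bar>e7 + e8\<bar> \<le> 4 * X" using x5 x6 x7 x8 by linarith+
    then have "\<bar>e5 + e6 + e7 + e8\<bar> \<le> 9 * X" by linarith
    then have "\<bar>(e5 + e6 + e7 + e8) / 4\<bar> \<le> 3 * X" using X0 by simp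
    moreover have "\<bar>u - v + y + z + w\<bar> \<le> 60 * X" if "\<bar>u - v\<bar> \<le> 36 * X" "\<bar>y\<bar> \<le> 18 * X" "\<bar>z\<bar> \<le> 3 * X" "\<bar>w\<bar> \<le> 1 * X"
      for u v y z w using that X0 by linarith
    ultimately show ?thesis using x9 by blast
  qed
  then show ?thesis unfolding split X_def by (simp add: mult_ac)
qed

definition grid_flux :: "mobility_average \<Rightarrow> real \<Rightarrow> (int^3 \<Rightarrow> real) \<Rightarrow> (int^3 \<Rightarrow> real) \<Rightarrow> 3 \<Rightarrow> int^3 \<Rightarrow> real" where
  "grid_flux avg h S c d p = weighted_jump avg (S (p + axis d 1) - S p) (c p) (c (p + axis d 1)) / h"

lemma face_mobility_grad_h:
  "face_mobility avg S d p * grad_h h (\<lambda>p. c p * exp (S p)) d p = grid_flux avg h S c d p"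
  using mobility_mult_difference[of avg "S p" "S (p + axis d 1)" "c (p + axis d 1)" "c p"]
  by (simp add: face_mobility_def grad_h_def grid_flux_def weighted_jump_def)

lemma div_h_grid_flux:
  "div_h h (grid_flux avg h S c) p =
    (\<Sum>d\<in>UNIV. (weighted_jump avg (S (p + axis d 1) - S p) (c p) (c (p + axis d 1))
      + weighted_jump avg (S (p - axis d 1) - S p) (c p) (c (p - axis d 1))) / h\<^sup>2)"
proof -
  have "grid_flux avg h S c d (p - axis d 1) = - weighted_jump avg (S (p - axis d 1) - S p) (c p) (c (p - axis d 1)) / h" for d
    using weighted_jump_swap[of avg "S p - S (p - axis d 1)" "c p" "c (p - axis d 1)"]
    by (simp add: grid_flux_def)
  then show ?thesis
    by (simp add: div_h_def grid_flux_def add_divide_distrib power2_eq_square)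
qed

section \<open>Taylor bounds along coordinate lines and in time\<close>

lemma C_spacetime_space_derivative:
  assumes "C_spacetime T (Suc m) f" and per: "\<And>t. t \<in> {0..T} \<Longrightarrow> space_periodic L (f t)"
  obtains fd where
    "\<And>d t x s. t \<in> {0..T} \<Longrightarrow> ((\<lambda>s. f t (x + s *\<^sub>R axis d 1)) has_real_derivative fd d t (x + s *\<^sub>R axis d 1)) (at s)"
    "\<And>d. C_spacetime T m (fd d)" "\<And>d t. t \<in> {0..T} \<Longrightarrow> space_periodic L (fd d t)"
proof -
  have "\<forall>d. \<exists>fd. (\<forall>t\<in>{0..T}. \<forall>x. ((\<lambda>s. f t (x + s *\<^sub>R axis d 1)) has_real_derivative fd t x) (at 0)) \<and> C_spacetime T m fd"
    using assms(1) by simp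
  then obtain fd where fd: "\<And>d t x. t \<in> {0..T} \<Longrightarrow> ((\<lambda>s. f t (x + s *\<^sub>R axis d 1)) has_real_derivative fd d t x) (at 0)"
      "\<And>d. C_spacetime T m (fd d)"
    by metis
  show ?thesis
  proof (rule that[of fd])
    show "((\<lambda>s. f t (x + s *\<^sub>R axis d 1)) has_real_derivative fd d t (x + s *\<^sub>R axis d 1)) (at s)" if "t \<in> {0..T}" for d t x s
      using has_vector_derivative_along_axis[of "f t" d "fd d t" x s UNIV] fd(1)[OF that]
      by (simp add: has_real_derivative_iff_has_vector_derivative)
    show "space_periodic L (fd d t)" if "t \<in> {0..T}" for d t
      by (rule space_periodic_derivative[OF per[OF that] fd(1)[OF that]])
  qed (rule fd(2))
qed

text \<open>Periodicity passes to the time derivative because derivatives within the nondegenerate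
  interval \<open>[0,T]\<close> are unique, also at its end points.\<close>

lemma C_spacetime_time_derivative:
  assumes T: "T > 0" and C: "C_spacetime T (Suc m) f" and per: "\<And>t. t \<in> {0..T} \<Longrightarrow> space_periodic L (f t)"
  obtains ft where
    "\<And>t x. t \<in> {0..T} \<Longrightarrow> ((\<lambda>s. f s x) has_real_derivative ft t x) (at t within {0..T})"
    "C_spacetime T m ft" "\<And>t. t \<in> {0..T} \<Longrightarrow> space_periodic L (ft t)"
proof -
  obtain ft where ft: "\<And>t x. t \<in> {0..T} \<Longrightarrow> ((\<lambda>s. f s x) has_real_derivative ft t x) (at t within {0..T})"
      "C_spacetime T m ft"
  proof -
    have "\<exists>ft. (\<forall>t\<in>{0..T}. \<forall>x. ((\<lambda>s. f s x) has_real_derivative ft t x) (at t within {0..T})) \<and> C_spacetime T m ft"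
      using C by simp
    then show ?thesis using that by blast
  qed
  have "space_periodic L (ft t)" if t: "t \<in> {0..T}" for t
    unfolding space_periodic_def
  proof (intro allI)
    fix x d
    have 1: "((\<lambda>s. f s x) has_vector_derivative ft t x) (at t within {0..T})"
      using ft(1)[OF t] by (simp add: has_real_derivative_iff_has_vector_derivative)
    have "((\<lambda>s. f s (x + axis d L)) has_vector_derivative ft t (x + axis d L)) (at t within {0..T})"
      using ft(1)[OF t] by (simp add: has_real_derivative_iff_has_vector_derivative)
    then have 2: "((\<lambda>s. f s x) has_vector_derivative ft t (x + axis d L)) (at t within {0..T})"
      by (rule has_vector_derivative_transform[OF t, rotated]) (use per in \<open>simp add: space_periodic_def\<close>)
    show "ft t (x + axis d L) = ft t x"
      using vector_derivative_unique_within_closed_interval[OF T, of t] t 1 2 by simp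
  qed
  with ft show ?thesis by (rule that)
qed

lemma C_spacetime_time_lipschitz:
  assumes T: "T > 0" and L: "L > 0" and C: "C_spacetime T (Suc m) f" and per: "\<And>t. t \<in> {0..T} \<Longrightarrow> space_periodic L (f t)"
  obtains B where "B > 0" "\<And>s t x. s \<in> {0..T} \<Longrightarrow> t \<in> {0..T} \<Longrightarrow> \<bar>f s x - f t x\<bar> \<le> B * \<bar>s - t\<bar>"
proof -
  obtain ft where ft: "\<And>t x. t \<in> {0..T} \<Longrightarrow> ((\<lambda>s. f s x) has_real_derivative ft t x) (at t within {0..T})"
    "C_spacetime T m ft" "\<And>t. t \<in> {0..T} \<Longrightarrow> space_periodic L (ft t)"
    using C_spacetime_time_derivative[OF T C per] by blast
  obtain B where B: "B > 0" "\<And>t x. t \<in> {0..T} \<Longrightarrow> \<bar>ft t x\<bar> \<le> B"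
    using C_spacetime_bounded[OF ft(2,3) L] by blast
  have "norm (f s x - f t x) \<le> B * norm (s - t)" if "s \<in> {0..T}" "t \<in> {0..T}" for s t x
    by (rule field_differentiable_bound[OF convex_real_interval(5) ft(1)]) (use B(2) that in auto)
  with B(1) show ?thesis using that[of B] by simp
qed

text \<open>Mean value theorem for \<open>f r x - r * ft t x\<close> with \<open>r\<close> between
  \<open>s\<close> and \<open>t\<close>: its derivative \<open>ft r x - ft t x\<close> is at most a
  constant times \<open>|s - t|\<close>, because \<open>ft\<close> is itself Lipschitz in
  time.\<close>

lemma C_spacetime_time_taylor:
  assumes T: "T > 0" and L: "L > 0" and C: "C_spacetime T (Suc (Suc m)) f" and per: "\<And>t. t \<in> {0..T} \<Longrightarrow> space_periodic L (f t)"
  obtains ft B where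
    "\<And>t x. t \<in> {0..T} \<Longrightarrow> ((\<lambda>s. f s x) has_real_derivative ft t x) (at t within {0..T})"
    "B > 0" "\<And>s t x. s \<in> {0..T} \<Longrightarrow> t \<in> {0..T} \<Longrightarrow> \<bar>f s x - f t x - (s - t) * ft t x\<bar> \<le> B * (s - t)\<^sup>2"
proof -
  obtain ft where ft: "\<And>t x. t \<in> {0..T} \<Longrightarrow> ((\<lambda>s. f s x) has_real_derivative ft t x) (at t within {0..T})"
    "C_spacetime T (Suc m) ft" "\<And>t. t \<in> {0..T} \<Longrightarrow> space_periodic L (ft t)"
    using C_spacetime_time_derivative[OF T C per] by blast
  obtain B where B: "B > 0" "\<And>s t x. s \<in> {0..T} \<Longrightarrow> t \<in> {0..T} \<Longrightarrow> \<bar>ft s x - ft t x\<bar> \<le> B * \<bar>s - t\<bar>"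
    using C_spacetime_time_lipschitz[OF T L ft(2,3)] by blast
  have "\<bar>f s x - f t x - (s - t) * ft t x\<bar> \<le> B * (s - t)\<^sup>2" if st: "s \<in> {0..T}" "t \<in> {0..T}" for s t x
  proof -
    define I where "I = {min s t..max s t}"
    have sub: "I \<subseteq> {0..T}" using st by (auto simp: I_def)
    have "norm ((f s x - s * ft t x) - (f t x - t * ft t x)) \<le> (B * \<bar>s - t\<bar>) * norm (s - t)"
    proof (rule field_differentiable_bound[where f = "\<lambda>r. f r x - r * ft t x" and S = I])
      show "((\<lambda>r. f r x - r * ft t x) has_real_derivative (ft z x - ft t x)) (at z within I)" if "z \<in> I" for z
        using that sub by (auto intro!: derivative_eq_intros DERIV_subset[OF ft(1) sub])
      show "norm (ft z x - ft t x) \<le> B * \<bar>s - t\<bar>" if z: "z \<in> I" for z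
      proof -
        have "\<bar>ft z x - ft t x\<bar> \<le> B * \<bar>z - t\<bar>" using z sub st by (intro B(2)) auto
        also have "\<dots> \<le> B * \<bar>s - t\<bar>" using z B(1) by (intro mult_left_mono) (auto simp: I_def)
        finally show ?thesis by simp
      qed
    qed (auto simp: I_def)
    then show ?thesis by (simp add: algebra_simps power2_eq_square abs_mult[symmetric] mult.assoc flip: abs_mult)
  qed
  with ft(1) B(1) show ?thesis by (rule that)
qed

text \<open>The five difference bounds are those that \<open>weighted_jump_sum_estimate\<close> asks
  of the potential and of the concentration. A single \<open>B\<close> serves the function, its two
  derivatives and all differences.\<close>

definition line_regular where
  "line_regular T f f1 f2 B \<longleftrightarrow> 1 \<le> (B::real) \<and> (\<forall>t\<in>{0..T}. \<forall>d x.
     (\<forall>s. ((\<lambda>s. f t (x + s *\<^sub>R axis d 1)) has_real_derivative f1 d t (x + s *\<^sub>R axis d 1)) (at s)) \<and>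
     (\<forall>s. ((\<lambda>s. f1 d t (x + s *\<^sub>R axis d 1)) has_real_derivative f2 d t (x + s *\<^sub>R axis d 1)) (at s)) \<and>
     \<bar>f t x\<bar> \<le> B \<and> \<bar>f1 d t x\<bar> \<le> B \<and> \<bar>f2 d t x\<bar> \<le> B \<and>
     (\<forall>h\<ge>0. \<bar>f t (x + h *\<^sub>R axis d 1) - f t x\<bar> \<le> B * h \<and>
       \<bar>f t (x + (- h) *\<^sub>R axis d 1) - f t x\<bar> \<le> B * h \<and>
       \<bar>f t (x + h *\<^sub>R axis d 1) + f t (x + (- h) *\<^sub>R axis d 1) - 2 * f t x\<bar> \<le> B * h\<^sup>2 \<and>
       \<bar>f t (x + h *\<^sub>R axis d 1) - f t (x + (- h) *\<^sub>R axis d 1) - 2 * h * f1 d t x\<bar> \<le> B * h ^ 3 \<and>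
       \<bar>f t (x + h *\<^sub>R axis d 1) + f t (x + (- h) *\<^sub>R axis d 1) - 2 * f t x - h\<^sup>2 * f2 d t x\<bar> \<le> B * h ^ 4))"
  for T :: real and f :: "real \<Rightarrow> real^3 \<Rightarrow> real" and f1 f2 :: "3 \<Rightarrow> real \<Rightarrow> real^3 \<Rightarrow> real"

lemma line_regularD:
  assumes "line_regular T f f1 f2 B"
  shows "B \<ge> 1"
    and "\<And>d t x s. t \<in> {0..T} \<Longrightarrow> ((\<lambda>s. f t (x + s *\<^sub>R axis d 1)) has_real_derivative f1 d t (x + s *\<^sub>R axis d 1)) (at s)"
    and "\<And>d t x s. t \<in> {0..T} \<Longrightarrow> ((\<lambda>s. f1 d t (x + s *\<^sub>R axis d 1)) has_real_derivative f2 d t (x + s *\<^sub>R axis d 1)) (at s)"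
    and "\<And>t x. t \<in> {0..T} \<Longrightarrow> \<bar>f t x\<bar> \<le> B"
    and "\<And>d t x. t \<in> {0..T} \<Longrightarrow> \<bar>f1 d t x\<bar> \<le> B"
    and "\<And>d t x. t \<in> {0..T} \<Longrightarrow> \<bar>f2 d t x\<bar> \<le> B"
    and "\<And>d t x h. t \<in> {0..T} \<Longrightarrow> h \<ge> 0 \<Longrightarrow> \<bar>f t (x + h *\<^sub>R axis d 1) - f t x\<bar> \<le> B * h"
    and "\<And>d t x h. t \<in> {0..T} \<Longrightarrow> h \<ge> 0 \<Longrightarrow> \<bar>f t (x + (- h) *\<^sub>R axis d 1) - f t x\<bar> \<le> B * h"
    and "\<And>d t x h. t \<in> {0..T} \<Longrightarrow> h \<ge> 0 \<Longrightarrow> \<bar>f t (x + h *\<^sub>R axis d 1) + f t (x + (- h) *\<^sub>R axis d 1) - 2 * f t x\<bar> \<le> B * h\<^sup>2"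
    and "\<And>d t x h. t \<in> {0..T} \<Longrightarrow> h \<ge> 0 \<Longrightarrow> \<bar>f t (x + h *\<^sub>R axis d 1) - f t (x + (- h) *\<^sub>R axis d 1) - 2 * h * f1 d t x\<bar> \<le> B * h ^ 3"
    and "\<And>d t x h. t \<in> {0..T} \<Longrightarrow> h \<ge> 0 \<Longrightarrow> \<bar>f t (x + h *\<^sub>R axis d 1) + f t (x + (- h) *\<^sub>R axis d 1) - 2 * f t x - h\<^sup>2 * f2 d t x\<bar> \<le> B * h ^ 4"
  using assms unfolding line_regular_def by blast+

text \<open>Four spatial derivatives feed the Taylor bounds. The regularity of \<open>f1\<close> and
  \<open>f2\<close> is exported as well, since those of the potential must also be Lipschitz in
  time.\<close>

lemma C_spacetime_line_regular:
  assumes L: "L > 0" and C: "C_spacetime T (Suc (Suc (Suc (Suc m)))) f"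
    and per: "\<And>t. t \<in> {0..T} \<Longrightarrow> space_periodic L (f t)"
  obtains f1 f2 B where "line_regular T f f1 f2 B"
    "\<And>d. C_spacetime T (Suc (Suc (Suc m))) (f1 d)" "\<And>d t. t \<in> {0..T} \<Longrightarrow> space_periodic L (f1 d t)"
    "\<And>d. C_spacetime T (Suc (Suc m)) (f2 d)" "\<And>d t. t \<in> {0..T} \<Longrightarrow> space_periodic L (f2 d t)"
proof -
  define derivative_of where "derivative_of n g gd \<longleftrightarrow>
    (\<forall>d t x s. t \<in> {0..T} \<longrightarrow> ((\<lambda>s. g d t (x + s *\<^sub>R axis d 1)) has_real_derivative gd d t (x + s *\<^sub>R axis d 1)) (at s)) \<and>
    (\<forall>d. C_spacetime T n (gd d)) \<and> (\<forall>d t. t \<in> {0..T} \<longrightarrow> space_periodic L (gd d t))"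
    for n and g gd :: "3 \<Rightarrow> real \<Rightarrow> real^3 \<Rightarrow> real"
  have derD: "((\<lambda>s. g d t (x + s *\<^sub>R axis d 1)) has_real_derivative gd d t (x + s *\<^sub>R axis d 1)) (at s)"
    if "derivative_of n g gd" "t \<in> {0..T}" for n g gd d t x s
    using that by (simp add: derivative_of_def)
  have ex: "\<exists>gd. derivative_of n g gd"
    if "\<And>d. C_spacetime T (Suc n) (g d)" "\<And>d t. t \<in> {0..T} \<Longrightarrow> space_periodic L (g d t)" for n g
  proof -
    have "\<exists>gd. (\<forall>t x s. t \<in> {0..T} \<longrightarrow> ((\<lambda>s. g d t (x + s *\<^sub>R axis d 1)) has_real_derivative gd t (x + s *\<^sub>R axis d 1)) (at s)) \<and>
       C_spacetime T n gd \<and> (\<forall>t. t \<in> {0..T} \<longrightarrow> space_periodic L (gd t))" for d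
      using C_spacetime_space_derivative[OF that, of d] by metis
    then show ?thesis unfolding derivative_of_def by metis
  qed
  obtain f1 where f1: "derivative_of (Suc (Suc (Suc m))) (\<lambda>_. f) f1" using ex[of "Suc (Suc (Suc m))" "\<lambda>_. f"] C per by blast
  obtain f2 where f2: "derivative_of (Suc (Suc m)) f1 f2" using ex[of "Suc (Suc m)" f1] f1 unfolding derivative_of_def by blast
  obtain f3 where f3: "derivative_of (Suc m) f2 f3" using ex[of "Suc m" f2] f2 unfolding derivative_of_def by blast
  obtain f4 where f4: "derivative_of m f3 f4" using ex[of m f3] f3 unfolding derivative_of_def by blast
  have bd: "\<exists>B>0. \<forall>d t x. t \<in> {0..T} \<longrightarrow> \<bar>gd d t x\<bar> \<le> B" if "derivative_of n g gd" for n g gd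
  proof -
    have "\<exists>B>0. \<forall>t x. t \<in> {0..T} \<longrightarrow> \<bar>gd d t x\<bar> \<le> B" for d
      using C_spacetime_bounded[of T n "gd d" L] that L unfolding derivative_of_def by metis
    then obtain B where B: "\<And>d. B d > 0" "\<And>d t x. t \<in> {0..T} \<Longrightarrow> \<bar>gd d t x\<bar> \<le> B d" by metis
    have "B d \<le> (\<Sum>d\<in>UNIV. B d)" for d by (rule member_le_sum) (use B(1) in \<open>auto intro: less_imp_le\<close>)
    then have "\<bar>gd d t x\<bar> \<le> (\<Sum>d\<in>UNIV. B d)" if "t \<in> {0..T}" for d t x using B(2)[OF that] order_trans by blast
    then show ?thesis using B(1) by (intro exI[of _ "\<Sum>d\<in>UNIV. B d"]) (auto intro!: sum_pos)
  qed
  obtain B0 where B0: "B0 > 0" "\<And>t x. t \<in> {0..T} \<Longrightarrow> \<bar>f t x\<bar> \<le> B0" using C_spacetime_bounded[OF C per L] by blast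
  obtain B1 where B1: "B1 > 0" "\<And>d t x. t \<in> {0..T} \<Longrightarrow> \<bar>f1 d t x\<bar> \<le> B1" using bd[OF f1] by blast
  obtain B2 where B2: "B2 > 0" "\<And>d t x. t \<in> {0..T} \<Longrightarrow> \<bar>f2 d t x\<bar> \<le> B2" using bd[OF f2] by blast
  obtain B3 where B3: "B3 > 0" "\<And>d t x. t \<in> {0..T} \<Longrightarrow> \<bar>f3 d t x\<bar> \<le> B3" using bd[OF f3] by blast
  obtain B4 where B4: "B4 > 0" "\<And>d t x. t \<in> {0..T} \<Longrightarrow> \<bar>f4 d t x\<bar> \<le> B4" using bd[OF f4] by blast
  define B where "B = 1 + B0 + B1 + B2 + B3 + B4"
  have B: "B \<ge> 1" using B0(1) B1(1) B2(1) B3(1) B4(1) by (simp add: B_def)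
  have bounds: "\<bar>f t x\<bar> \<le> B" "\<bar>f1 d t x\<bar> \<le> B" "\<bar>f2 d t x\<bar> \<le> B" "\<bar>f3 d t x\<bar> \<le> B" "\<bar>f4 d t x\<bar> \<le> B" if t: "t \<in> {0..T}" for d t x
    using B0(2)[OF t, of x] B1(2)[OF t, of d x] B2(2)[OF t, of d x] B3(2)[OF t, of d x] B4(2)[OF t, of d x]
      B0(1) B1(1) B2(1) B3(1) B4(1) unfolding B_def by linarith+
  note cd = central_difference_bounds[where f = "\<lambda>s. f t (x + s *\<^sub>R axis d 1)" and ?f1.0 = "\<lambda>s. f1 d t (x + s *\<^sub>R axis d 1)"
      and ?f2.0 = "\<lambda>s. f2 d t (x + s *\<^sub>R axis d 1)" and ?f3.0 = "\<lambda>s. f3 d t (x + s *\<^sub>R axis d 1)" and ?f4.0 = "\<lambda>s. f4 d t (x + s *\<^sub>R axis d 1)"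
      and B = B for t x d]
  have der: "((\<lambda>s. f t (x + s *\<^sub>R axis d 1)) has_real_derivative f1 d t (x + s *\<^sub>R axis d 1)) (at s)"
      "((\<lambda>s. f1 d t (x + s *\<^sub>R axis d 1)) has_real_derivative f2 d t (x + s *\<^sub>R axis d 1)) (at s)"
      "((\<lambda>s. f2 d t (x + s *\<^sub>R axis d 1)) has_real_derivative f3 d t (x + s *\<^sub>R axis d 1)) (at s)"
      "((\<lambda>s. f3 d t (x + s *\<^sub>R axis d 1)) has_real_derivative f4 d t (x + s *\<^sub>R axis d 1)) (at s)" if "t \<in> {0..T}" for d t x s
    by (rule derD[OF f1 that] derD[OF f2 that] derD[OF f3 that] derD[OF f4 that])+
  show ?thesis
  proof (rule that[of f1 f2 B])
    have diff: "\<bar>f t (x + h *\<^sub>R axis d 1) - f t x\<bar> \<le> B * h \<and> \<bar>f t (x + (- h) *\<^sub>R axis d 1) - f t x\<bar> \<le> B * h \<and>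
      \<bar>f t (x + h *\<^sub>R axis d 1) + f t (x + (- h) *\<^sub>R axis d 1) - 2 * f t x\<bar> \<le> B * h\<^sup>2 \<and>
      \<bar>f t (x + h *\<^sub>R axis d 1) - f t (x + (- h) *\<^sub>R axis d 1) - 2 * h * f1 d t x\<bar> \<le> B * h ^ 3 \<and>
      \<bar>f t (x + h *\<^sub>R axis d 1) + f t (x + (- h) *\<^sub>R axis d 1) - 2 * f t x - h\<^sup>2 * f2 d t x\<bar> \<le> B * h ^ 4"
      if t: "t \<in> {0..T}" and h: "h \<ge> 0" for d t x h
      using cd[OF der[OF t] bounds(2-5)[OF t] h, simplified] by simp
    show "line_regular T f f1 f2 B"
      unfolding line_regular_def using B der(1,2) bounds(1-3) diff by blast
  qed (use f1 f2 in \<open>auto simp: derivative_of_def\<close>)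
qed

section \<open>Consistency of the Poisson and Nernst-Planck discretizations\<close>

lemma partial_deriv_eqI:
  "((\<lambda>s. f (x + s *\<^sub>R axis d 1)) has_real_derivative D) (at 0) \<Longrightarrow> partial_deriv d f x = D"
  unfolding partial_deriv_def by (rule DERIV_imp_deriv)

lemma diverg_drift_diffusion:
  assumes c: "\<And>d x. ((\<lambda>s. c (x + s *\<^sub>R axis d 1)) has_real_derivative c1 d x) (at 0)"
      "\<And>d x. ((\<lambda>s. c1 d (x + s *\<^sub>R axis d 1)) has_real_derivative c2 d x) (at 0)"
    and p: "\<And>d x. ((\<lambda>s. p (x + s *\<^sub>R axis d 1)) has_real_derivative p1 d x) (at 0)"
      "\<And>d x. ((\<lambda>s. p1 d (x + s *\<^sub>R axis d 1)) has_real_derivative p2 d x) (at 0)"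
  shows "diverg (\<lambda>y. grad c y + (q * c y) *\<^sub>R grad p y) x = (\<Sum>d\<in>UNIV. c2 d x + q * (c1 d x * p1 d x + c x * p2 d x))"
proof -
  have "(grad c y + (q * c y) *\<^sub>R grad p y) $ d = c1 d y + q * c y * p1 d y" for y d
    using partial_deriv_eqI[OF c(1)] partial_deriv_eqI[OF p(1)] by (simp add: grad_def)
  moreover have "partial_deriv d (\<lambda>y. c1 d y + q * c y * p1 d y) x = c2 d x + q * (c1 d x * p1 d x + c x * p2 d x)" for d
  proof (rule partial_deriv_eqI)
    have "((\<lambda>s. c1 d (x + s *\<^sub>R axis d 1) + q * (c (x + s *\<^sub>R axis d 1) * p1 d (x + s *\<^sub>R axis d 1))) has_real_derivative
       c2 d x + q * (c1 d x * p1 d (x + 0 *\<^sub>R axis d 1) + p2 d x * c (x + 0 *\<^sub>R axis d 1))) (at 0)"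
      by (intro DERIV_add DERIV_cmult DERIV_mult c p)
    then show "((\<lambda>s. c1 d (x + s *\<^sub>R axis d 1) + q * c (x + s *\<^sub>R axis d 1) * p1 d (x + s *\<^sub>R axis d 1)) has_real_derivative
       c2 d x + q * (c1 d x * p1 d x + c x * p2 d x)) (at 0)"
      by (simp add: mult_ac)
  qed
  ultimately show ?thesis by (simp add: diverg_def)
qed

lemma laplacian_eq_sum:
  assumes p: "\<And>d x. ((\<lambda>s. p (x + s *\<^sub>R axis d 1)) has_real_derivative p1 d x) (at 0)"
      "\<And>d x. ((\<lambda>s. p1 d (x + s *\<^sub>R axis d 1)) has_real_derivative p2 d x) (at 0)"
  shows "laplacian p x = (\<Sum>d\<in>UNIV. p2 d x)"
proof -
  have "grad p y $ d = p1 d y" for y d using partial_deriv_eqI[OF p(1)] by (simp add: grad_def)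
  then show ?thesis using partial_deriv_eqI[OF p(2)] by (simp add: laplacian_def diverg_def)
qed

lemma abs_le_divide_square:
  fixes X Y h :: real
  assumes "h > 0" "\<bar>X - h\<^sup>2 * Y\<bar> \<le> C * h ^ 4"
  shows "\<bar>X / h\<^sup>2 - Y\<bar> \<le> C * h\<^sup>2"
proof -
  have "X / h\<^sup>2 - Y = (X - h\<^sup>2 * Y) / h\<^sup>2" using assms(1) by (simp add: field_simps)
  then have "\<bar>X / h\<^sup>2 - Y\<bar> = \<bar>X - h\<^sup>2 * Y\<bar> / h\<^sup>2" by (simp add: abs_divide)
  also have "\<dots> \<le> C * h ^ 4 / h\<^sup>2" using assms by (intro divide_right_mono) auto
  also have "\<dots> = C * h\<^sup>2" using assms(1) by (simp add: power_numeral_reduce)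
  finally show ?thesis .
qed

lemma poisson_consistency:
  assumes L: "L > 0" and p: "C_spacetime T (Suc (Suc (Suc (Suc m)))) p" "\<And>t. t \<in> {0..T} \<Longrightarrow> space_periodic L (p t)"
  obtains C where "C \<ge> 0" "\<And>h t x. 0 < h \<Longrightarrow> t \<in> {0..T} \<Longrightarrow>
    \<bar>(\<Sum>d\<in>UNIV. (p t (x + h *\<^sub>R axis d 1) + p t (x + (- h) *\<^sub>R axis d 1) - 2 * p t x) / h\<^sup>2) - laplacian (p t) x\<bar> \<le> C * h\<^sup>2"
proof -
  obtain p1 p2 B where reg: "line_regular T p p1 p2 B"
    using C_spacetime_line_regular[OF L p] by metis
  note P = line_regularD(1,2,3,11)[OF reg]
  show ?thesis
  proof (rule that[of "3 * B"])
    fix h t x assume h: "(0::real) < h" and t: "t \<in> {0..T}"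
    have "((\<lambda>s. p t (x + s *\<^sub>R axis d 1)) has_real_derivative p1 d t x) (at 0)"
      "((\<lambda>s. p1 d t (x + s *\<^sub>R axis d 1)) has_real_derivative p2 d t x) (at 0)" for d x
      using P(2)[OF t, of x d 0] P(3)[OF t, of d x 0] by simp_all
    then have lap: "laplacian (p t) x = (\<Sum>d\<in>UNIV. p2 d t x)" by (rule laplacian_eq_sum)
    have "\<bar>(\<Sum>d\<in>UNIV. (p t (x + h *\<^sub>R axis d 1) + p t (x + (- h) *\<^sub>R axis d 1) - 2 * p t x) / h\<^sup>2) - laplacian (p t) x\<bar>
      = \<bar>\<Sum>d\<in>UNIV. (p t (x + h *\<^sub>R axis d 1) + p t (x + (- h) *\<^sub>R axis d 1) - 2 * p t x) / h\<^sup>2 - p2 d t x\<bar>"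
      unfolding lap by (simp add: sum_subtractf)
    also have "\<dots> \<le> (\<Sum>d\<in>(UNIV :: 3 set). B * h\<^sup>2)"
      using P(4)[OF t] h by (intro sum_abs[THEN order_trans] sum_mono abs_le_divide_square) auto
    finally show "\<bar>(\<Sum>d\<in>UNIV. (p t (x + h *\<^sub>R axis d 1) + p t (x + (- h) *\<^sub>R axis d 1) - 2 * p t x) / h\<^sup>2) - laplacian (p t) x\<bar> \<le> 3 * B * h\<^sup>2"
      by simp
  qed (use P(1) in simp)
qed

text \<open>The differential equation is taken at the new time \<open>t + dt\<close>, where the
  scheme evaluates the concentration, while the potential of the scheme is older by
  \<open>dt\<close>. The error thus has three sources: the backward difference in time, the jumps in
  space, and the lag of the potential.\<close>

lemma nernst_planck_consistency:
  assumes T: "T > 0" and L: "L > 0"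
    and c: "C_spacetime T (Suc (Suc (Suc (Suc m)))) c" "\<And>t. t \<in> {0..T} \<Longrightarrow> space_periodic L (c t)"
    and p: "C_spacetime T (Suc (Suc (Suc (Suc m)))) p" "\<And>t. t \<in> {0..T} \<Longrightarrow> space_periodic L (p t)"
    and pde: "\<And>t x. t \<in> {0..T} \<Longrightarrow> ((\<lambda>s. c s x) has_real_derivative
       diverg (\<lambda>y. grad (c t) y + (q * c t y) *\<^sub>R grad (p t) y) x) (at t within {0..T})"
  obtains C h0 where "C \<ge> 0" "h0 > 0"
    "\<And>h dt t x. 0 < h \<Longrightarrow> h \<le> h0 \<Longrightarrow> 0 < dt \<Longrightarrow> 0 \<le> t \<Longrightarrow> t + dt \<le> T \<Longrightarrow>
      \<bar>(c (t + dt) x - c t x) / dt - (\<Sum>d\<in>UNIV.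
         (weighted_jump avg (q * p t (x + h *\<^sub>R axis d 1) - q * p t x) (c (t + dt) x) (c (t + dt) (x + h *\<^sub>R axis d 1))
         + weighted_jump avg (q * p t (x + (- h) *\<^sub>R axis d 1) - q * p t x) (c (t + dt) x) (c (t + dt) (x + (- h) *\<^sub>R axis d 1))) / h\<^sup>2)\<bar>
      \<le> C * (dt + h\<^sup>2)"
proof -
  obtain c1 c2 Bc where c_reg: "line_regular T c c1 c2 Bc"
    using C_spacetime_line_regular[OF L c] by metis
  note c_der = line_regularD(2,3)[OF c_reg] and Bc = line_regularD(1,4,5,7,8,9,10,11)[OF c_reg]
  obtain p1 p2 Bp where p_reg: "line_regular T p p1 p2 Bp"
    and p_C: "\<And>d. C_spacetime T (Suc (Suc (Suc m))) (p1 d)" "\<And>d t. t \<in> {0..T} \<Longrightarrow> space_periodic L (p1 d t)"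
    "\<And>d. C_spacetime T (Suc (Suc m)) (p2 d)" "\<And>d t. t \<in> {0..T} \<Longrightarrow> space_periodic L (p2 d t)"
    using C_spacetime_line_regular[OF L p] by metis
  note p_der = line_regularD(2,3)[OF p_reg] and Bp = line_regularD(1,5,6,7,8,9,10,11)[OF p_reg]
  have lip: "\<exists>D. \<forall>d. D d > 0 \<and> (\<forall>s\<in>{0..T}. \<forall>t\<in>{0..T}. \<forall>x. \<bar>f d s x - f d t x\<bar> \<le> D d * \<bar>s - t\<bar>)"
    if f: "\<And>d. C_spacetime T (Suc k) (f d)" "\<And>d t. t \<in> {0..T} \<Longrightarrow> space_periodic L (f d t)" for k and f :: "3 \<Rightarrow> real \<Rightarrow> real^3 \<Rightarrow> real"
  proof (rule choice, rule allI)
    fix d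
    show "\<exists>B. B > 0 \<and> (\<forall>s\<in>{0..T}. \<forall>t\<in>{0..T}. \<forall>x. \<bar>f d s x - f d t x\<bar> \<le> B * \<bar>s - t\<bar>)"
      by (rule C_spacetime_time_lipschitz[OF T L f(1)[of d] f(2)[of _ d]]) auto
  qed
  obtain D1 where D1: "\<And>d. D1 d > 0" "\<And>d s t x. s \<in> {0..T} \<Longrightarrow> t \<in> {0..T} \<Longrightarrow> \<bar>p1 d s x - p1 d t x\<bar> \<le> D1 d * \<bar>s - t\<bar>"
    using lip[where f = p1, OF p_C(1,2)] by metis
  obtain D2 where D2: "\<And>d. D2 d > 0" "\<And>d s t x. s \<in> {0..T} \<Longrightarrow> t \<in> {0..T} \<Longrightarrow> \<bar>p2 d s x - p2 d t x\<bar> \<le> D2 d * \<bar>s - t\<bar>"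
    using lip[where f = p2, OF p_C(3,4)] by metis
  note D = D1 D2
  obtain ct Bt where ct: "\<And>t x. t \<in> {0..T} \<Longrightarrow> ((\<lambda>s. c s x) has_real_derivative ct t x) (at t within {0..T})"
    "Bt > 0" "\<And>s t x. s \<in> {0..T} \<Longrightarrow> t \<in> {0..T} \<Longrightarrow> \<bar>c s x - c t x - (s - t) * ct t x\<bar> \<le> Bt * (s - t)\<^sup>2"
    using C_spacetime_time_taylor[OF T L c] by metis
  define B where "B = Bc + Bp * (1 + \<bar>q\<bar>)"
  have Bcp: "Bp * (1 + \<bar>q\<bar>) \<ge> 1" "Bp * (1 + \<bar>q\<bar>) \<ge> 0"
    using mult_mono[of 1 Bp 1 "1 + \<bar>q\<bar>"] Bp(1) by auto
  have B: "B \<ge> 1" "Bc \<le> B" "\<bar>q\<bar> * Bp \<le> B"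
    using Bc(1) Bcp Bp(1) by (auto simp: B_def algebra_simps)
  define D where "D d = \<bar>q\<bar> * Bc * (D1 d + D2 d)" for d
  define C where "C = Bt + (\<Sum>d\<in>UNIV. 60 * B ^ 4 + D d)"
  have D0: "D d \<ge> 0" for d using Bc(1) D(1)[of d] D(3)[of d] by (simp add: D_def)
  have le_B: "u \<le> B * y" if "u \<le> Bc * y" "0 \<le> y" for u y
    using that B(2) mult_right_mono[of Bc B y] by linarith
  have q_le: "\<bar>q * u\<bar> \<le> B * y" if "\<bar>u\<bar> \<le> Bp * y" "0 \<le> y" for u y
  proof -
    have "\<bar>q * u\<bar> \<le> \<bar>q\<bar> * (Bp * y)" using that by (simp add: abs_mult mult_left_mono)
    also have "\<dots> \<le> B * y" using B(3) that(2) by (simp add: mult_right_mono flip: mult.assoc)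
    finally show ?thesis .
  qed
  show ?thesis
  \<comment> \<open>\<open>h <= 1 / B\<close> keeps the jumps of the potential times
    \<open>q\<close> below 1, the range in which the Lipschitz bounds of the weights hold.\<close>
  proof (rule that[of C "1 / B"])
    have "0 \<le> 60 * B ^ 4" using B(1) by simp
    then show "C \<ge> 0" unfolding C_def using ct(2) D0 by (intro add_nonneg_nonneg sum_nonneg) auto
    show "1 / B > 0" using B(1) by simp
    fix h dt t x assume h: "0 < h" "h \<le> 1 / B" and dt: "0 < dt" and t: "0 \<le> t" "t + dt \<le> (T::real)"
    have Bh: "B * h \<le> 1" using h B(1) by (simp add: pos_le_divide_eq mult.commute)
    have h0: "0 \<le> h" using h by simp
    define s where "s = t + dt"
    have ts: "t \<in> {0..T}" "s \<in> {0..T}" "s - t = dt" using dt t by (auto simp: s_def)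
    define W where "W d = weighted_jump avg (q * p t (x + h *\<^sub>R axis d 1) - q * p t x) (c s x) (c s (x + h *\<^sub>R axis d 1))
         + weighted_jump avg (q * p t (x + (- h) *\<^sub>R axis d 1) - q * p t x) (c s x) (c s (x + (- h) *\<^sub>R axis d 1))" for d
    have "\<bar>W d - h\<^sup>2 * (c2 d s x + (q * p1 d t x) * c1 d s x + (q * p2 d t x) * c s x)\<bar> \<le> 60 * B ^ 4 * h ^ 4" for d
      unfolding W_def
    proof (rule weighted_jump_sum_estimate[OF B(1) h0 Bh])
      let ?xp = "x + h *\<^sub>R axis d 1" and ?xm = "x + (- h) *\<^sub>R axis d 1"
      show "\<bar>q * p t ?xp - q * p t x\<bar> \<le> B * h" "\<bar>q * p t ?xm - q * p t x\<bar> \<le> B * h"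
        using q_le[OF Bp(4)[OF ts(1) h0, of x d] h0] q_le[OF Bp(5)[OF ts(1) h0, of x d] h0]
        by (simp_all only: right_diff_distrib)
      show "\<bar>q * p t ?xp - q * p t x + (q * p t ?xm - q * p t x)\<bar> \<le> B * h\<^sup>2"
        using q_le[OF Bp(6)[OF ts(1) h0, of x d]] by (simp add: algebra_simps)
      show "\<bar>q * p t ?xp - q * p t x - (q * p t ?xm - q * p t x) - 2 * h * (q * p1 d t x)\<bar> \<le> B * h ^ 3"
        using q_le[OF Bp(7)[OF ts(1) h0, of x d]] h0 by (simp add: algebra_simps)
      show "\<bar>q * p t ?xp - q * p t x + (q * p t ?xm - q * p t x) - h\<^sup>2 * (q * p2 d t x)\<bar> \<le> B * h ^ 4"
        using q_le[OF Bp(8)[OF ts(1) h0, of x d]] h0 by (simp add: algebra_simps)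
      show "\<bar>c s ?xp - c s x\<bar> \<le> B * h" "\<bar>c s ?xm - c s x\<bar> \<le> B * h"
        "\<bar>c s ?xp + c s ?xm - 2 * c s x\<bar> \<le> B * h\<^sup>2"
        "\<bar>c s ?xp - c s ?xm - 2 * h * c1 d s x\<bar> \<le> B * h ^ 3"
        "\<bar>c s ?xp + c s ?xm - 2 * c s x - h\<^sup>2 * c2 d s x\<bar> \<le> B * h ^ 4"
        using Bc(4-8)[OF ts(2) h0] h0 by (auto intro!: le_B)
      show "\<bar>c s ?xp\<bar> \<le> B" "\<bar>c s ?xm\<bar> \<le> B" "\<bar>c s x\<bar> \<le> B" using Bc(2)[OF ts(2)] B(2) order_trans by blast+
      show "\<bar>q * p1 d t x\<bar> \<le> B" "\<bar>q * p2 d t x\<bar> \<le> B"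
        using q_le[of "p1 d t x" 1] q_le[of "p2 d t x" 1] Bp(2,3)[OF ts(1)] by simp_all
    qed
    then have W: "\<bar>W d / h\<^sup>2 - (c2 d s x + (q * p1 d t x) * c1 d s x + (q * p2 d t x) * c s x)\<bar> \<le> 60 * B ^ 4 * h\<^sup>2" for d
      using h by (intro abs_le_divide_square) auto
    have lag: "\<bar>(c2 d s x + (q * p1 d t x) * c1 d s x + (q * p2 d t x) * c s x) - (c2 d s x + q * (c1 d s x * p1 d s x + c s x * p2 d s x))\<bar> \<le> D d * dt" for d
    proof -
      have am: "\<bar>y * z\<bar> \<le> Y * Z" if "\<bar>y\<bar> \<le> Y" "\<bar>z\<bar> \<le> Z" for y z Y Z :: real
        using that by (simp add: abs_mult mult_mono)
      have "\<bar>c1 d s x * (p1 d t x - p1 d s x)\<bar> \<le> Bc * (D1 d * dt)" "\<bar>c s x * (p2 d t x - p2 d s x)\<bar> \<le> Bc * (D2 d * dt)"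
        using D(2)[OF ts(1,2), of d x] D(4)[OF ts(1,2), of d x] ts(3) dt
        by (intro am Bc(2,3)[OF ts(2)]; simp add: abs_minus_commute)+
      then have "\<bar>q * (c1 d s x * (p1 d t x - p1 d s x) + c s x * (p2 d t x - p2 d s x))\<bar> \<le> \<bar>q\<bar> * (Bc * (D1 d * dt) + Bc * (D2 d * dt))"
        unfolding abs_mult[of q] by (intro mult_left_mono) linarith+
      then show ?thesis by (simp add: D_def algebra_simps)
    qed
    \<comment> \<open>Two derivatives of \<open>c\<close> within \<open>[0,T]\<close> are equated
      here: the one supplied by regularity and the one supplied by the differential
      equation.\<close>
    have "ct s x = diverg (\<lambda>y. grad (c s) y + (q * c s y) *\<^sub>R grad (p s) y) x"
      using vector_derivative_unique_within_closed_interval[OF T, of s] ts(2) ct(1)[OF ts(2), of x] pde[OF ts(2), of x]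
      by (simp add: has_real_derivative_iff_has_vector_derivative)
    also have "\<dots> = (\<Sum>d\<in>UNIV. c2 d s x + q * (c1 d s x * p1 d s x + c s x * p2 d s x))"
    proof (rule diverg_drift_diffusion)
      show "((\<lambda>r. c s (x + r *\<^sub>R axis d 1)) has_real_derivative c1 d s x) (at 0)"
        "((\<lambda>r. c1 d s (x + r *\<^sub>R axis d 1)) has_real_derivative c2 d s x) (at 0)"
        "((\<lambda>r. p s (x + r *\<^sub>R axis d 1)) has_real_derivative p1 d s x) (at 0)"
        "((\<lambda>r. p1 d s (x + r *\<^sub>R axis d 1)) has_real_derivative p2 d s x) (at 0)" for d x
        using c_der(1)[OF ts(2), of x d 0] c_der(2)[OF ts(2), of d x 0] p_der(1)[OF ts(2), of x d 0] p_der(2)[OF ts(2), of d x 0] by simp_all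
    qed
    finally have cts: "ct s x = (\<Sum>d\<in>UNIV. c2 d s x + q * (c1 d s x * p1 d s x + c s x * p2 d s x))" .
    have time: "\<bar>(c s x - c t x) / dt - ct s x\<bar> \<le> Bt * dt"
    proof -
      have "\<bar>c t x - c s x - (t - s) * ct s x\<bar> \<le> Bt * dt\<^sup>2"
        using ct(3)[OF ts(1,2), of x] ts(3) by (simp add: power2_commute)
      moreover have "(c s x - c t x) / dt - ct s x = - ((c t x - c s x - (t - s) * ct s x) / dt)"
        using dt by (simp add: s_def field_simps)
      ultimately have "\<bar>(c s x - c t x) / dt - ct s x\<bar> \<le> Bt * dt\<^sup>2 / dt"
        using dt by (simp only: abs_minus_cancel abs_divide) (simp add: divide_right_mono)
      then show ?thesis using dt by (simp add: power2_eq_square)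
    qed
    have "\<bar>ct s x - (\<Sum>d\<in>UNIV. W d / h\<^sup>2)\<bar> \<le> (\<Sum>d\<in>UNIV. 60 * B ^ 4 * h\<^sup>2 + D d * dt)"
      unfolding cts sum_subtractf[symmetric]
    proof (rule order_trans[OF sum_abs sum_mono])
      fix d
      show "\<bar>c2 d s x + q * (c1 d s x * p1 d s x + c s x * p2 d s x) - W d / h\<^sup>2\<bar> \<le> 60 * B ^ 4 * h\<^sup>2 + D d * dt"
        using W[of d] lag[of d] by linarith
    qed
    also have "\<dots> \<le> (\<Sum>d\<in>UNIV. 60 * B ^ 4 + D d) * (dt + h\<^sup>2)"
      unfolding sum_distrib_right using D0 dt B(1) by (intro sum_mono) (auto simp: algebra_simps)
    finally have "\<bar>(c s x - c t x) / dt - (\<Sum>d\<in>UNIV. W d / h\<^sup>2)\<bar> \<le> Bt * dt + (\<Sum>d\<in>UNIV. 60 * B ^ 4 + D d) * (dt + h\<^sup>2)"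
      using time by linarith
    also have "\<dots> \<le> C * (dt + h\<^sup>2)"
      unfolding C_def distrib_right using ct(2) by (intro add_right_mono) (simp add: distrib_left)
    finally show "\<bar>(c (t + dt) x - c t x) / dt - (\<Sum>d\<in>UNIV.
         (weighted_jump avg (q * p t (x + h *\<^sub>R axis d 1) - q * p t x) (c (t + dt) x) (c (t + dt) (x + h *\<^sub>R axis d 1))
         + weighted_jump avg (q * p t (x + (- h) *\<^sub>R axis d 1) - q * p t x) (c (t + dt) x) (c (t + dt) (x + (- h) *\<^sub>R axis d 1))) / h\<^sup>2)\<bar>
      \<le> C * (dt + h\<^sup>2)"
      by (simp only: W_def s_def)
  qed
qed

section \<open>Stability\<close>

lemma grid_flux_diff: "grid_flux avg h S (\<lambda>p. u p - v p) d p = grid_flux avg h S u d p - grid_flux avg h S v d p"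
  by (simp add: grid_flux_def weighted_jump_def algebra_simps diff_divide_distrib add_divide_distrib)

lemma grid_flux_eq_grad_h:
  assumes "h \<noteq> 0"
  shows "grid_flux avg h S u d p = diffusion_weight avg (h * grad_h h S d p) * grad_h h u d p
    + drift_weight avg (h * grad_h h S d p) / h * ((u (p + axis d 1) + u p) / 2)"
proof -
  have jump: "h * grad_h h S d p = S (p + axis d 1) - S p" using assms by (simp add: grad_h_def)
  have distrib: "(A * x + D * y / 2) / h = A * (x / h) + D / h * (y / 2)" for A D x y :: real
    by (simp add: add_divide_distrib)
  show ?thesis unfolding jump unfolding grid_flux_def weighted_jump_def grad_h_def by (rule distrib)
qed

lemma weight_bounds:
  assumes "\<bar>\<sigma>\<bar> \<le> r" "r \<le> 1"
  shows "\<bar>diffusion_weight avg \<sigma> - 1\<bar> \<le> 18 * r\<^sup>2" "\<bar>drift_weight avg \<sigma>\<bar> \<le> 10 * \<bar>\<sigma>\<bar>"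
proof -
  have r: "0 \<le> r" using assms by linarith
  have "\<bar>diffusion_weight avg \<sigma> - 1\<bar> \<le> 18 * r * \<bar>\<sigma>\<bar>"
    using diffusion_weight_lipschitz[of \<sigma> r 0 avg] assms r by simp
  also have "\<dots> \<le> 18 * r * r" using assms r by (intro mult_left_mono) auto
  finally show "\<bar>diffusion_weight avg \<sigma> - 1\<bar> \<le> 18 * r\<^sup>2" by (simp add: power2_eq_square)
  have "\<bar>drift_weight avg \<sigma> - \<sigma>\<bar> \<le> 9 * r\<^sup>2 * \<bar>\<sigma>\<bar>"
    using drift_weight_lipschitz[of \<sigma> r 0 avg] assms r by simp
  also have "\<dots> \<le> 9 * 1 * \<bar>\<sigma>\<bar>"
    using assms r by (intro mult_right_mono mult_left_mono) (auto simp: power_le_one)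
  finally show "\<bar>drift_weight avg \<sigma>\<bar> \<le> 10 * \<bar>\<sigma>\<bar>" by linarith
qed

text \<open>The flux error is \<open>F1 + F2\<close>: \<open>F1\<close> is the numerical flux of the
  concentration error, \<open>F2\<close> the change of the flux of the exact concentration when the
  potential changes. In \<open>F1\<close> diffusion has weight at least 1/2, as
  \<open>36 * r^2 <= 1\<close>; half of that is spent on Young's inequality to absorb the drift and
  \<open>F2\<close>, and 1/4 remains. The gradient bound on \<open>\<phi>\<close> makes both jumps
  \<open>O(h)\<close>, so the drift weights stay bounded after division by \<open>h\<close>.\<close>

lemma flux_error_lower_bound:
  assumes h: "0 < h" "h \<le> 1" and B: "B \<ge> 0" and r: "\<bar>q\<bar> * (B + 1) * h \<le> r" "r \<le> 1" "36 * r\<^sup>2 \<le> 1"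
    and C: "\<bar>C p\<bar> \<le> B" "\<bar>C (p + axis d 1)\<bar> \<le> B" "\<bar>grad_h h C d p\<bar> \<le> B"
    and \<Psi>: "\<bar>grad_h h \<Psi> d p\<bar> \<le> B" and \<phi>: "\<bar>grad_h h \<phi> d p\<bar> \<le> 1"
    and K: "K = 28 * \<bar>q\<bar> * (B + 1)"
  shows "(grid_flux avg h (\<lambda>p. q * \<Psi> p) C d p - grid_flux avg h (\<lambda>p. q * (\<Psi> p - \<phi> p)) (\<lambda>p. C p - e p) d p) * grad_h h e d p
    \<ge> (grad_h h e d p)\<^sup>2 / 4 - 2 * K\<^sup>2 * (((e (p + axis d 1))\<^sup>2 + (e p)\<^sup>2) / 2 + (grad_h h \<phi> d p)\<^sup>2)"
proof -
  define X where "X = grad_h h e d p"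
  define g where "g = grad_h h \<phi> d p"
  define \<sigma>1 where "\<sigma>1 = h * grad_h h (\<lambda>p. q * \<Psi> p) d p"
  define \<sigma>2 where "\<sigma>2 = h * grad_h h (\<lambda>p. q * (\<Psi> p - \<phi> p)) d p"
  define a where "a = (\<bar>e (p + axis d 1)\<bar> + \<bar>e p\<bar>) / 2"
  define E where "E = (e (p + axis d 1) + e p) / 2"
  define CE where "CE = (C (p + axis d 1) + C p) / 2"
  have am: "\<bar>x * y\<bar> \<le> X * Y" if "\<bar>x\<bar> \<le> X" "\<bar>y\<bar> \<le> Y" for x y X Y :: real
    using that by (simp add: abs_mult mult_mono)
  have h0: "h \<noteq> 0" using h by simp
  have div_le: "\<bar>x / h\<bar> \<le> y / h" if "\<bar>x\<bar> \<le> y" for x y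
    using divide_right_mono[OF that, of h] h by simp
  have r0: "0 \<le> r" using r B h by (meson abs_ge_zero add_nonneg_nonneg less_imp_le mult_nonneg_nonneg order_trans zero_le_one)
  have s1: "\<sigma>1 = q * (h * grad_h h \<Psi> d p)" and s2: "\<sigma>2 = q * (h * (grad_h h \<Psi> d p - g))"
  proof -
    have "grad_h h (\<lambda>p. q * \<Psi> p) d p = q * grad_h h \<Psi> d p"
      by (simp add: grad_h_def right_diff_distrib)
    then show "\<sigma>1 = q * (h * grad_h h \<Psi> d p)" by (simp add: \<sigma>1_def)
    have "grad_h h (\<lambda>p. q * (\<Psi> p - \<phi> p)) d p = q * (grad_h h \<Psi> d p - g)"
      by (simp add: grad_h_def g_def right_diff_distrib diff_divide_distrib)
    then show "\<sigma>2 = q * (h * (grad_h h \<Psi> d p - g))" by (simp add: \<sigma>2_def)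
  qed
  have diff: "\<sigma>1 - \<sigma>2 = q * h * g" by (simp add: s1 s2 algebra_simps)
  have b1: "\<bar>\<sigma>1\<bar> \<le> \<bar>q\<bar> * (h * (B + 1))"
    unfolding s1 using \<Psi> h by (intro am) (auto simp: abs_mult intro!: mult_left_mono)
  have b2: "\<bar>\<sigma>2\<bar> \<le> \<bar>q\<bar> * (h * (B + 1))"
    unfolding s2 using \<Psi> \<phi> h by (intro am) (auto simp: abs_mult g_def intro!: mult_left_mono order_trans[OF abs_triangle_ineq4] add_mono)
  have sr: "\<bar>\<sigma>1\<bar> \<le> r" "\<bar>\<sigma>2\<bar> \<le> r" using b1 b2 r(1) by (auto simp: mult_ac)
  have dd: "\<bar>\<sigma>1 - \<sigma>2\<bar> = \<bar>q\<bar> * h * \<bar>g\<bar>" using h by (simp add: diff abs_mult)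
  define F1 where "F1 = grid_flux avg h (\<lambda>p. q * (\<Psi> p - \<phi> p)) e d p"
  define F2 where "F2 = grid_flux avg h (\<lambda>p. q * \<Psi> p) C d p - grid_flux avg h (\<lambda>p. q * (\<Psi> p - \<phi> p)) C d p"
  have F: "grid_flux avg h (\<lambda>p. q * \<Psi> p) C d p - grid_flux avg h (\<lambda>p. q * (\<Psi> p - \<phi> p)) (\<lambda>p. C p - e p) d p = F1 + F2"
    by (simp add: F1_def F2_def grid_flux_diff)
  have F1: "F1 = diffusion_weight avg \<sigma>2 * X + drift_weight avg \<sigma>2 / h * E"
    unfolding F1_def X_def E_def \<sigma>2_def by (rule grid_flux_eq_grad_h[OF h0])
  have F2: "F2 = (diffusion_weight avg \<sigma>1 - diffusion_weight avg \<sigma>2) * grad_h h C d p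
      + (drift_weight avg \<sigma>1 - drift_weight avg \<sigma>2) / h * CE"
    unfolding F2_def grid_flux_eq_grad_h[OF h0] CE_def \<sigma>1_def[symmetric] \<sigma>2_def[symmetric]
    by (simp add: algebra_simps diff_divide_distrib)
  have "\<bar>diffusion_weight avg \<sigma>2 - 1\<bar> \<le> 1 / 2" using weight_bounds(1)[OF sr(2) r(2), of avg] r(3) by linarith
  then have dw: "1 / 2 \<le> diffusion_weight avg \<sigma>2" by linarith
  have "\<bar>drift_weight avg \<sigma>2\<bar> \<le> 10 * (\<bar>q\<bar> * (h * (B + 1)))" using weight_bounds(2)[OF sr(2) r(2), of avg] b2 by linarith
  then have "\<bar>drift_weight avg \<sigma>2 / h\<bar> \<le> 10 * (\<bar>q\<bar> * (h * (B + 1))) / h"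
    by (rule div_le)
  also have "\<dots> = 10 * \<bar>q\<bar> * (B + 1)" using h by simp
  also have "\<dots> \<le> K" using B unfolding K by (intro mult_right_mono) auto
  finally have drift: "\<bar>drift_weight avg \<sigma>2 / h * E\<bar> \<le> K * a"
    by (rule am) (auto simp: E_def a_def intro: order_trans[OF abs_triangle_ineq])
  \<comment> \<open>28 = 18 + 10, from the Lipschitz constants of the two weights: 18 for diffusion,
    and for drift 1 from the identity plus 9 from its correction.\<close>
  have f2: "\<bar>F2\<bar> \<le> K * \<bar>g\<bar>"
  proof -
    have "\<bar>diffusion_weight avg \<sigma>1 - diffusion_weight avg \<sigma>2\<bar> \<le> 18 * r * (\<bar>q\<bar> * h * \<bar>g\<bar>)"
      using diffusion_weight_lipschitz[OF sr r(2), of avg] unfolding dd .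
    also have "\<dots> \<le> 18 * 1 * (\<bar>q\<bar> * 1 * \<bar>g\<bar>)"
      using r r0 h by (intro mult_mono) auto
    finally have 1: "\<bar>(diffusion_weight avg \<sigma>1 - diffusion_weight avg \<sigma>2) * grad_h h C d p\<bar> \<le> 18 * (\<bar>q\<bar> * \<bar>g\<bar>) * B"
      using C(3) by (intro am) auto
    have "\<bar>drift_weight avg \<sigma>1 - drift_weight avg \<sigma>2\<bar> \<le> \<bar>\<sigma>1 - \<sigma>2\<bar> + 9 * r\<^sup>2 * \<bar>\<sigma>1 - \<sigma>2\<bar>"
      using drift_weight_lipschitz[OF sr r(2), of avg] by linarith
    also have "9 * r\<^sup>2 * \<bar>\<sigma>1 - \<sigma>2\<bar> \<le> 9 * 1 * \<bar>\<sigma>1 - \<sigma>2\<bar>"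
      using r r0 by (intro mult_right_mono mult_left_mono) (auto simp: power_le_one)
    finally have "\<bar>drift_weight avg \<sigma>1 - drift_weight avg \<sigma>2\<bar> \<le> 10 * (\<bar>q\<bar> * h * \<bar>g\<bar>)" unfolding dd by (simp add: mult_ac)
    then have "\<bar>(drift_weight avg \<sigma>1 - drift_weight avg \<sigma>2) / h\<bar> \<le> 10 * (\<bar>q\<bar> * h * \<bar>g\<bar>) / h"
      by (rule div_le)
    also have "\<dots> = 10 * (\<bar>q\<bar> * \<bar>g\<bar>)" using h by simp
    finally have 2: "\<bar>(drift_weight avg \<sigma>1 - drift_weight avg \<sigma>2) / h * CE\<bar> \<le> 10 * (\<bar>q\<bar> * \<bar>g\<bar>) * B"
      using C(1,2) by (intro am) (auto simp: CE_def)
    have "\<bar>F2\<bar> \<le> 18 * (\<bar>q\<bar> * \<bar>g\<bar>) * B + 10 * (\<bar>q\<bar> * \<bar>g\<bar>) * B"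
      unfolding F2 by (rule order_trans[OF abs_triangle_ineq add_mono[OF 1 2]])
    also have "\<dots> = 28 * (\<bar>q\<bar> * \<bar>g\<bar>) * B" by simp
    also have "\<dots> \<le> K * \<bar>g\<bar>" using B by (simp add: K algebra_simps)
    finally show ?thesis .
  qed
  have K0: "K \<ge> 0" using B by (simp add: K)
  have a2: "a\<^sup>2 \<le> ((e (p + axis d 1))\<^sup>2 + (e p)\<^sup>2) / 2"
  proof -
    have "0 \<le> (\<bar>e (p + axis d 1)\<bar> - \<bar>e p\<bar>)\<^sup>2" by simp
    then show ?thesis by (simp add: a_def power2_eq_square field_simps)
  qed
  have lower: "(drift_weight avg \<sigma>2 / h * E + F2) * X \<ge> - ((K * a + K * \<bar>g\<bar>) * \<bar>X\<bar>)"
  proof -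
    have "\<bar>drift_weight avg \<sigma>2 / h * E + F2\<bar> \<le> K * a + K * \<bar>g\<bar>" using drift f2 by linarith
    then have "\<bar>(drift_weight avg \<sigma>2 / h * E + F2) * X\<bar> \<le> (K * a + K * \<bar>g\<bar>) * \<bar>X\<bar>" by (intro am) auto
    from abs_le_D2[OF this] show ?thesis by (rule iffD1[OF minus_le_iff])
  qed
  have diffusion: "diffusion_weight avg \<sigma>2 * X\<^sup>2 \<ge> 1 / 2 * X\<^sup>2" using dw by (intro mult_right_mono) auto
  have split: "(F1 + F2) * X = diffusion_weight avg \<sigma>2 * X\<^sup>2 + (drift_weight avg \<sigma>2 / h * E + F2) * X"
    by (simp add: F1 algebra_simps power2_eq_square)
  have young: "(K * a + K * \<bar>g\<bar>) * \<bar>X\<bar> \<le> X\<^sup>2 / 4 + 2 * K\<^sup>2 * (a\<^sup>2 + g\<^sup>2)"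
  proof -
    have "0 \<le> (\<bar>X\<bar> / 2 - (K * a + K * \<bar>g\<bar>))\<^sup>2" by simp
    then have "(K * a + K * \<bar>g\<bar>) * \<bar>X\<bar> \<le> X\<^sup>2 / 4 + (K * a + K * \<bar>g\<bar>)\<^sup>2"
      by (simp add: power2_diff power_divide algebra_simps)
    moreover have "(K * a + K * \<bar>g\<bar>)\<^sup>2 \<le> 2 * K\<^sup>2 * (a\<^sup>2 + g\<^sup>2)"
    proof -
      have "0 \<le> K\<^sup>2 * (a - \<bar>g\<bar>)\<^sup>2" by simp
      then show ?thesis by (simp add: power2_eq_square algebra_simps)
    qed
    ultimately show ?thesis by linarith
  qed
  have mean: "2 * K\<^sup>2 * (a\<^sup>2 + g\<^sup>2) \<le> 2 * K\<^sup>2 * (((e (p + axis d 1))\<^sup>2 + (e p)\<^sup>2) / 2 + g\<^sup>2)"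
    using a2 by (intro mult_left_mono) auto
  have combine: "v \<ge> x / 4 - t'" if "v = u + y" "y \<ge> - z" "u \<ge> 1 / 2 * x" "z \<le> x / 4 + t" "t \<le> t'" for v u x y z t t' :: real
    using that by linarith
  have "(F1 + F2) * X \<ge> X\<^sup>2 / 4 - 2 * K\<^sup>2 * (((e (p + axis d 1))\<^sup>2 + (e p)\<^sup>2) / 2 + g\<^sup>2)"
    by (rule combine[OF split lower diffusion young mean])
  then show ?thesis unfolding F X_def g_def .
qed

text \<open>Testing with the new error makes the implicit diffusion dissipative and, by
  \<open>x^2 - y^2 <= 2 x (x - y)\<close>, leaves a difference of squares that telescopes in time.
  The factor \<open>2 * dt\<close> of this inequality turns the 1/4 of the flux bound into
  \<open>dt / 2\<close> and, summed over the three axes, \<open>2 * K^2\<close> into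
  \<open>12 * K^2\<close>.\<close>

lemma energy_step:
  assumes h: "0 < h" "h \<le> 1" and dt: "dt > 0" and B: "B \<ge> 0" and \<tau>: "\<tau> \<ge> 0"
    and r: "\<bar>q\<bar> * (B + 1) * h \<le> r" "r \<le> 1" "36 * r\<^sup>2 \<le> 1"
    and per: "grid_periodic N C" "grid_periodic N \<Psi>" "grid_periodic N \<phi>" "grid_periodic N e"
    and C: "\<And>p. \<bar>C p\<bar> \<le> B" "\<And>d p. \<bar>grad_h h C d p\<bar> \<le> B"
    and \<Psi>: "\<And>d p. \<bar>grad_h h \<Psi> d p\<bar> \<le> B" and \<phi>: "\<And>d p. \<bar>grad_h h \<phi> d p\<bar> \<le> 1"
    and K: "K = 28 * \<bar>q\<bar> * (B + 1)"
    and res: "\<And>p. \<bar>(e p - e0 p) / dt - div_h h (\<lambda>d r. grid_flux avg h (\<lambda>p. q * \<Psi> p) C d r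
       - grid_flux avg h (\<lambda>p. q * (\<Psi> p - \<phi> p)) (\<lambda>p. C p - e p) d r) p\<bar> \<le> \<tau>"
  shows "(norm2_h h N e)\<^sup>2 - (norm2_h h N e0)\<^sup>2 + dt / 2 * (grad_norm2_h h N e)\<^sup>2
    \<le> dt * ((12 * K\<^sup>2 + 1) * (norm2_h h N e)\<^sup>2 + 4 * K\<^sup>2 * (grad_norm2_h h N \<phi>)\<^sup>2 + (h * real N) ^ 3 * \<tau>\<^sup>2)"
proof -
  have h0: "h \<ge> 0" using h by simp
  define F where "F d r = grid_flux avg h (\<lambda>p. q * \<Psi> p) C d r
       - grid_flux avg h (\<lambda>p. q * (\<Psi> p - \<phi> p)) (\<lambda>p. C p - e p) d r" for d r
  define \<rho> where "\<rho> p = (e p - e0 p) / dt - div_h h F p" for p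
  have perF: "grid_periodic N (F d)" for d
  proof -
    have "grid_periodic N (grid_flux avg h S u d)" if "grid_periodic N S" "grid_periodic N u" for S u
    proof -
      have shift: "p + axis i (int N) + axis d 1 = p + axis d 1 + axis i (int N)" for p :: "int^3" and i
        by (simp add: add_ac)
      show ?thesis
        unfolding grid_periodic_def grid_flux_def shift
        by (simp only: grid_periodicD[OF that(1)] grid_periodicD[OF that(2)] simp_thms)
    qed
    moreover have "grid_periodic N (\<lambda>p. q * \<Psi> p)" "grid_periodic N (\<lambda>p. q * (\<Psi> p - \<phi> p))" "grid_periodic N (\<lambda>p. C p - e p)"
      using per by (simp_all add: grid_periodic_def)
    ultimately show ?thesis unfolding F_def using per(1)
      by (intro grid_periodic_comp2[where f = "(-)"]) auto
  qed
  have \<rho>: "\<bar>\<rho> p\<bar> \<le> \<tau>" for p using res[of p] by (simp add: \<rho>_def F_def[abs_def])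
  have flux: "inner_h h N (F d) (grad_h h e d) \<ge>
     (norm2_h h N (grad_h h e d))\<^sup>2 / 4 - 2 * K\<^sup>2 * ((norm2_h h N e)\<^sup>2 + (norm2_h h N (grad_h h \<phi> d))\<^sup>2)" for d
  proof -
    have "(\<Sum>p\<in>cells N. F d p * grad_h h e d p) \<ge>
       (\<Sum>p\<in>cells N. (grad_h h e d p)\<^sup>2 / 4 - 2 * K\<^sup>2 * (((e (p + axis d 1))\<^sup>2 + (e p)\<^sup>2) / 2 + (grad_h h \<phi> d p)\<^sup>2))"
      unfolding F_def by (intro sum_mono flux_error_lower_bound[OF h B r _ _ _ _ _ K] C \<Psi> \<phi>)
    also have "(\<Sum>p\<in>cells N. (grad_h h e d p)\<^sup>2 / 4 - 2 * K\<^sup>2 * (((e (p + axis d 1))\<^sup>2 + (e p)\<^sup>2) / 2 + (grad_h h \<phi> d p)\<^sup>2))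
      = (\<Sum>p\<in>cells N. (grad_h h e d p)\<^sup>2) / 4 - 2 * K\<^sup>2 * (((\<Sum>p\<in>cells N. (e (p + axis d 1))\<^sup>2) + (\<Sum>p\<in>cells N. (e p)\<^sup>2)) / 2
         + (\<Sum>p\<in>cells N. (grad_h h \<phi> d p)\<^sup>2))"
      by (simp only: sum_subtractf sum.distrib sum_divide_distrib[symmetric] sum_distrib_left[symmetric])
    also have "(\<Sum>p\<in>cells N. (e (p + axis d 1))\<^sup>2) = (\<Sum>p\<in>cells N. (e p)\<^sup>2)"
      by (rule sum_cells_shift[OF grid_periodic_comp[OF per(4), of "\<lambda>x. x\<^sup>2"]])
    finally have "h ^ 3 * (\<Sum>p\<in>cells N. F d p * grad_h h e d p) \<ge> h ^ 3 * ((\<Sum>p\<in>cells N. (grad_h h e d p)\<^sup>2) / 4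
        - 2 * K\<^sup>2 * (((\<Sum>p\<in>cells N. (e p)\<^sup>2) + (\<Sum>p\<in>cells N. (e p)\<^sup>2)) / 2 + (\<Sum>p\<in>cells N. (grad_h h \<phi> d p)\<^sup>2)))"
      using h0 by (intro mult_left_mono) auto
    then show ?thesis unfolding inner_h_def norm2_h_squared[OF h0] by (simp add: algebra_simps)
  qed
  define G where "G = (grad_norm2_h h N e)\<^sup>2"
  define P where "P = (grad_norm2_h h N \<phi>)\<^sup>2"
  define X where "X = (norm2_h h N e)\<^sup>2"
  have "(\<Sum>d\<in>UNIV. inner_h h N (F d) (grad_h h e d)) \<ge>
      (\<Sum>d\<in>UNIV. (norm2_h h N (grad_h h e d))\<^sup>2 / 4 - 2 * K\<^sup>2 * (X + (norm2_h h N (grad_h h \<phi> d))\<^sup>2))"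
    unfolding X_def by (intro sum_mono flux)
  also have "(\<Sum>d\<in>UNIV. (norm2_h h N (grad_h h e d))\<^sup>2 / 4 - 2 * K\<^sup>2 * (X + (norm2_h h N (grad_h h \<phi> d))\<^sup>2))
     = G / 4 - 2 * K\<^sup>2 * (3 * X + P)"
    unfolding G_def P_def grad_norm2_h_squared[OF h0]
    by (simp only: sum_subtractf sum.distrib sum_divide_distrib[symmetric] sum_distrib_left[symmetric] sum_constant) simp
  finally have div: "inner_h h N (div_h h F) e \<le> 2 * K\<^sup>2 * (3 * X + P) - G / 4"
    by (simp add: summation_by_parts[OF perF per(4)])
  have "inner_h h N \<rho> e \<le> ((h * real N) ^ 3 * \<tau>\<^sup>2 + X) / 2"
  proof -
    have "(\<Sum>p\<in>cells N. \<rho> p * e p) \<le> (\<Sum>p\<in>cells N. (\<tau>\<^sup>2 + (e p)\<^sup>2) / 2)"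
    proof (rule sum_mono)
      fix p
      have "0 \<le> (\<rho> p - e p)\<^sup>2" by simp
      moreover have "(\<rho> p)\<^sup>2 \<le> \<tau>\<^sup>2" using \<rho>[of p] \<tau> by (simp add: abs_le_square_iff[symmetric])
      ultimately show "\<rho> p * e p \<le> (\<tau>\<^sup>2 + (e p)\<^sup>2) / 2" by (simp add: power2_diff)
    qed
    then have "h ^ 3 * (\<Sum>p\<in>cells N. \<rho> p * e p) \<le> h ^ 3 * (\<Sum>p\<in>cells N. (\<tau>\<^sup>2 + (e p)\<^sup>2) / 2)"
      using h0 by (intro mult_left_mono) auto
    also have "\<dots> = ((h * real N) ^ 3 * \<tau>\<^sup>2 + X) / 2"
      by (simp add: X_def norm2_h_squared[OF h0] sum.distrib card_cells power_mult_distrib algebra_simps flip: sum_divide_distrib)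
    finally show ?thesis by (simp add: inner_h_def)
  qed
  moreover have "X - (norm2_h h N e0)\<^sup>2 \<le> 2 * dt * (inner_h h N (div_h h F) e + inner_h h N \<rho> e)"
  proof -
    have "(\<Sum>p\<in>cells N. (e p)\<^sup>2 - (e0 p)\<^sup>2) \<le> (\<Sum>p\<in>cells N. 2 * dt * (div_h h F p * e p + \<rho> p * e p))"
    proof (rule sum_mono)
      fix p
      have "dt * (div_h h F p + \<rho> p) = e p - e0 p" using dt by (simp add: \<rho>_def)
      then have "2 * dt * (div_h h F p * e p + \<rho> p * e p) = 2 * (e p - e0 p) * e p" by (metis distrib_right mult.assoc)
      moreover have "0 \<le> (e p - e0 p)\<^sup>2" by simp
      ultimately show "(e p)\<^sup>2 - (e0 p)\<^sup>2 \<le> 2 * dt * (div_h h F p * e p + \<rho> p * e p)"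
        by (simp add: power2_eq_square algebra_simps)
    qed
    then have "h ^ 3 * (\<Sum>p\<in>cells N. (e p)\<^sup>2 - (e0 p)\<^sup>2) \<le> h ^ 3 * (\<Sum>p\<in>cells N. 2 * dt * (div_h h F p * e p + \<rho> p * e p))"
      using h0 by (intro mult_left_mono) auto
    moreover have "h ^ 3 * (\<Sum>p\<in>cells N. 2 * dt * (div_h h F p * e p + \<rho> p * e p)) = 2 * dt * (inner_h h N (div_h h F) e + inner_h h N \<rho> e)"
      by (simp only: inner_h_def sum.distrib sum_distrib_left[symmetric]) (simp add: algebra_simps)
    ultimately show ?thesis by (simp add: X_def norm2_h_squared[OF h0] sum_subtractf right_diff_distrib)
  qed
  ultimately have "X - (norm2_h h N e0)\<^sup>2 \<le> 2 * dt * ((2 * K\<^sup>2 * (3 * X + P) - G / 4) + ((h * real N) ^ 3 * \<tau>\<^sup>2 + X) / 2)"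
  proof -
    have "inner_h h N (div_h h F) e + inner_h h N \<rho> e \<le> (2 * K\<^sup>2 * (3 * X + P) - G / 4) + ((h * real N) ^ 3 * \<tau>\<^sup>2 + X) / 2"
      using div \<open>inner_h h N \<rho> e \<le> ((h * real N) ^ 3 * \<tau>\<^sup>2 + X) / 2\<close> by (rule add_mono)
    then have "2 * dt * (inner_h h N (div_h h F) e + inner_h h N \<rho> e) \<le> 2 * dt * ((2 * K\<^sup>2 * (3 * X + P) - G / 4) + ((h * real N) ^ 3 * \<tau>\<^sup>2 + X) / 2)"
      using dt by (intro mult_left_mono) auto
    with \<open>X - (norm2_h h N e0)\<^sup>2 \<le> 2 * dt * (inner_h h N (div_h h F) e + inner_h h N \<rho> e)\<close> show ?thesis by (rule order_trans)
  qed
  then show ?thesis unfolding X_def[symmetric] G_def[symmetric] P_def[symmetric] by (simp add: algebra_simps add_divide_distrib)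
qed

text \<open>Subtracting the mean changes neither side. The squared gradient norm is the pairing of
  minus the discrete Laplacian with the mean-free part, which Poincare's inequality bounds by the
  gradient norm; one factor of that norm cancels. The 2 dominates the square root of 3/2.\<close>

lemma grad_norm2_h_le_lap_h:
  assumes per: "grid_periodic N u" and h: "h > 0" and N: "N \<ge> 1"
  shows "grad_norm2_h h N u \<le> 2 * (h * real N) * norm2_h h N (lap_h h u)"
proof -
  have h0: "h \<ge> 0" using h by simp
  define m where "m = (\<Sum>p\<in>cells N. u p) / real N ^ 3"
  define v where "v p = u p - m" for p
  have grad: "grad_h h v = grad_h h u" by (simp add: fun_eq_iff grad_h_def v_def)
  have perv: "grid_periodic N v" using per by (simp add: grid_periodic_def v_def)
  have sum0: "(\<Sum>p\<in>cells N. v p) = 0" using N by (simp add: v_def sum_subtractf card_cells m_def)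
  define G where "G = grad_norm2_h h N u"
  define W where "W = norm2_h h N (lap_h h u)"
  have G0: "G \<ge> 0" by (simp add: G_def grad_norm2_h_def sum_nonneg h0)
  have W0: "W \<ge> 0" by (simp add: W_def norm2_h_nonneg h0)
  have "(norm2_h h N v)\<^sup>2 \<le> 3 / 2 * (h * real N)\<^sup>2 * G\<^sup>2"
    using poincare_h[OF perv h N] unfolding sum0 by (simp add: G_def grad_norm2_h_def grad)
  also have "\<dots> \<le> (2 * (h * real N) * G)\<^sup>2" by (simp add: power_mult_distrib mult_right_mono)
  finally have nv: "norm2_h h N v \<le> 2 * (h * real N) * G"
    by (rule power2_le_imp_le) (use G0 h0 in simp)
  have "G\<^sup>2 = (\<Sum>d\<in>UNIV. inner_h h N (grad_h h u d) (grad_h h v d))"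
    unfolding G_def grad_norm2_h_squared[OF h0] grad by (simp add: inner_h_self[OF h0])
  also have "\<dots> = - inner_h h N (lap_h h u) v"
    unfolding lap_h_def by (subst summation_by_parts) (auto intro: grid_periodic_grad_h per perv)
  also have "\<dots> \<le> W * norm2_h h N v"
    using inner_h_Cauchy_Schwarz[OF h0, of N "lap_h h u" v] by (simp add: W_def)
  also have "\<dots> \<le> W * (2 * (h * real N) * G)" using nv W0 by (rule mult_left_mono)
  finally have "G * G \<le> (2 * (h * real N) * W) * G" by (simp add: power2_eq_square mult_ac)
  then have "G \<le> 2 * (h * real N) * W"
    using G0 W0 h0 by (cases "G = 0") auto
  then show ?thesis by (simp add: G_def W_def)
qed

text \<open>The three terms of \<open>grid_max_le\<close> receive 1/3 each. For a Laplacian of size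
  \<open>A * h\<close> the first is at most \<open>sqrt (R * h) * A\<close>, with no further power
  of \<open>h\<close>, so the averaging length itself must be small. The other two retain a factor
  \<open>sqrt h\<close>.\<close>

lemma grad_h_max_le_1:
  assumes A: "A > 0" and L: "L > 0"
  obtains \<delta> where "\<delta> > 0"
    "\<And>h N u d p. 0 < h \<Longrightarrow> h \<le> \<delta> \<Longrightarrow> h * real N = L \<Longrightarrow> grid_periodic N u \<Longrightarrow>
      norm2_h h N (lap_h h u) \<le> A * h \<Longrightarrow> \<bar>grad_h h u d p\<bar> \<le> 1"
proof -
  \<comment> \<open>The target averaging length; the cap \<open>L\<close> keeps the block within one
    period.\<close>
  define \<epsilon> where "\<epsilon> = min L ((1 / (3 * A))\<^sup>2)"
  have \<epsilon>: "\<epsilon> > 0" "\<epsilon> \<le> L" "\<epsilon> \<le> (1 / (3 * A))\<^sup>2" using A L by (auto simp: \<epsilon>_def)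
  \<comment> \<open>12 = 3 * 2 * 2: the share 1/3, the 2 of \<open>grad_norm2_h_le_lap_h\<close>,
    and the 2 lost when \<open>R\<close> is rounded.\<close>
  define \<delta> where "\<delta> = min \<epsilon> (min ((1 / (3 * A))\<^sup>2) ((\<epsilon> / (12 * A * L))\<^sup>2))"
  have \<delta>: "\<delta> > 0" "\<delta> \<le> \<epsilon>" "\<delta> \<le> (1 / (3 * A))\<^sup>2" "\<delta> \<le> (\<epsilon> / (12 * A * L))\<^sup>2" using A L \<epsilon> by (auto simp: \<delta>_def)
  have "\<bar>grad_h h u d p\<bar> \<le> 1" if h: "0 < h" "h \<le> \<delta>" and N: "h * real N = L" and per: "grid_periodic N u"
    and lap: "norm2_h h N (lap_h h u) \<le> A * h" for h N u d p
  proof -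
    \<comment> \<open>Rounding down loses at most a factor 2: \<open>R * h\<close> lies between
      \<open>\<epsilon> / 2\<close> and \<open>\<epsilon>\<close>.\<close>
    define R where "R = nat \<lfloor>\<epsilon> / h\<rfloor>"
    have "1 \<le> \<epsilon> / h" using h \<delta> by simp
    then have R1: "1 \<le> R" unfolding R_def by (simp add: le_nat_iff)
    have "real R \<le> \<epsilon> / h" "\<epsilon> / h < real R + 1" unfolding R_def using \<open>1 \<le> \<epsilon> / h\<close> by linarith+
    then have Rh: "real R * h \<le> \<epsilon>" "\<epsilon> < (real R + 1) * h" using h by (simp_all add: pos_le_divide_eq pos_divide_less_eq)
    have "(real R + 1) * h \<le> 2 * (real R * h)" using R1 h by simp
    then have Rh2: "\<epsilon> \<le> 2 * (real R * h)" using Rh by linarith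
    have "real R * h \<le> real N * h" using Rh(1) \<epsilon>(2) N by (simp add: mult.commute)
    then have RN: "R \<le> N" using h by simp
    have N1: "N \<ge> 1" using RN R1 by simp
    define W where "W = norm2_h h N (lap_h h u)"
    have h0: "h \<ge> 0" using h by simp
    have W0: "W \<ge> 0" by (simp add: W_def norm2_h_nonneg h0)
    have second: "norm2_h h N (grad_h h (grad_h h u d) i) \<le> W" for i
      unfolding W_def by (rule norm2_h_second_difference_le[OF per h0])
    have first: "norm2_h h N (grad_h h u d) \<le> 2 * L * W"
      unfolding W_def using norm2_h_grad_h_le[OF h0] grad_norm2_h_le_lap_h[OF per h(1) N1] N order_trans by metis
    have sh: "sqrt h > 0" "sqrt h * sqrt h = h" using h by simp_all
    have "\<bar>grad_h h u d p\<bar> \<le> sqrt (real R * h) / h * norm2_h h N (grad_h h (grad_h h u d) 1)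
        + norm2_h h N (grad_h h (grad_h h u d) 2) / sqrt h + norm2_h h N (grad_h h u d) / (real R * h * sqrt h)"
      by (rule grid_max_le[OF grid_periodic_grad_h[OF per] h(1) R1 RN])
    also have "sqrt (real R * h) / h * norm2_h h N (grad_h h (grad_h h u d) 1) \<le> 1 / 3"
    proof -
      have "sqrt (real R * h) \<le> sqrt ((1 / (3 * A))\<^sup>2)" using Rh(1) \<epsilon>(3) by (intro real_sqrt_le_mono) linarith
      also have "\<dots> = 1 / (3 * A)" using A by simp
      finally have "sqrt (real R * h) / h * norm2_h h N (grad_h h (grad_h h u d) 1) \<le> 1 / (3 * A) / h * (A * h)"
        using second[of 1] lap h A by (intro mult_mono divide_right_mono) (auto simp: W_def norm2_h_nonneg)
      also have "\<dots> = 1 / 3" using h A by simp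
      finally show ?thesis .
    qed
    also have "norm2_h h N (grad_h h (grad_h h u d) 2) / sqrt h \<le> 1 / 3"
    proof -
      have "sqrt h \<le> sqrt ((1 / (3 * A))\<^sup>2)" using h(2) \<delta>(3) by (intro real_sqrt_le_mono) linarith
      also have "\<dots> = 1 / (3 * A)" using A by simp
      finally have *: "sqrt h \<le> 1 / (3 * A)" .
      have "norm2_h h N (grad_h h (grad_h h u d) 2) \<le> A * h" using second[of 2] lap by (simp add: W_def)
      also have "\<dots> = A * sqrt h * sqrt h" using sh by simp
      also have "\<dots> \<le> A * (1 / (3 * A)) * sqrt h" using * A sh by (intro mult_right_mono mult_left_mono) auto
      also have "\<dots> = 1 / 3 * sqrt h" using A by simp
      finally show ?thesis using sh by (simp add: pos_divide_le_eq)
    qed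
    also have "norm2_h h N (grad_h h u d) / (real R * h * sqrt h) \<le> 1 / 3"
    proof -
      have "sqrt h \<le> sqrt ((\<epsilon> / (12 * A * L))\<^sup>2)" using h(2) \<delta>(4) by (intro real_sqrt_le_mono) linarith
      also have "\<dots> = \<epsilon> / (12 * A * L)" using A L \<epsilon> by simp
      finally have *: "sqrt h \<le> \<epsilon> / (12 * A * L)" .
      have "norm2_h h N (grad_h h u d) \<le> 2 * L * (A * h)"
        using order_trans[OF first mult_left_mono[OF lap[folded W_def], of "2 * L"]] L by simp
      also have "\<dots> = 2 * L * A * sqrt h * sqrt h" using sh by simp
      also have "\<dots> \<le> 2 * L * A * (\<epsilon> / (12 * A * L)) * sqrt h"
        using * A L sh by (intro mult_right_mono mult_left_mono) auto
      also have "\<dots> = \<epsilon> / 6 * sqrt h" using A L by simp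
      also have "\<dots> \<le> 1 / 3 * (real R * h) * sqrt h" using Rh2 sh by (intro mult_right_mono) auto
      finally have "norm2_h h N (grad_h h u d) \<le> 1 / 3 * (real R * h * sqrt h)" by simp
      then show ?thesis using R1 h by (simp add: pos_divide_le_eq)
    qed
    finally show ?thesis by simp
  qed
  with \<delta>(1) show ?thesis by (rule that)
qed

text \<open>
  Here \<open>C\<close>, \<open>\<Psi>\<close> are the exact concentrations and potential on the grid and \<open>e\<close>, \<open>\<phi>\<close> their errors, so
  that \<open>C - e\<close>, \<open>\<Psi> - \<phi>\<close> is the numerical solution; \<open>B\<close> bounds the data and the consistency errors.
\<close>

definition scheme_errors where
  "scheme_errors avg \<kappa> M q T B N h dt e \<phi> C \<Psi> \<longleftrightarrow>
    (\<forall>n. real n * dt \<le> T \<longrightarrow>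
      grid_periodic N (\<phi> n) \<and> grid_periodic N (\<Psi> n) \<and>
      (\<forall>l\<in>{1..M}. grid_periodic N (e l n) \<and> grid_periodic N (C l n)) \<and>
      (\<forall>p. \<bar>- \<kappa> * lap_h h (\<phi> n) p - (\<Sum>l=1..M. q l * e l n p)\<bar> \<le> B * (dt + h\<^sup>2)) \<and>
      \<bar>h ^ 3 * (\<Sum>p\<in>cells N. \<phi> n p)\<bar> \<le> B * (dt + h\<^sup>2) \<and>
      (\<forall>l\<in>{1..M}. \<forall>p. \<bar>C l n p\<bar> \<le> B \<and> (\<forall>d. \<bar>grad_h h (C l n) d p\<bar> \<le> B)) \<and>
      (\<forall>d p. \<bar>grad_h h (\<Psi> n) d p\<bar> \<le> B)) \<and>
    (\<forall>l\<in>{1..M}. \<forall>p. \<bar>e l 0 p\<bar> \<le> B * (dt + h\<^sup>2)) \<and>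
    (\<forall>n. real (Suc n) * dt \<le> T \<longrightarrow> (\<forall>l\<in>{1..M}. \<forall>p.
      \<bar>(e l (Suc n) p - e l n p) / dt - div_h h (\<lambda>d r.
          grid_flux avg h (\<lambda>p. q l * \<Psi> n p) (C l (Suc n)) d r
          - grid_flux avg h (\<lambda>p. q l * (\<Psi> n p - \<phi> n p)) (\<lambda>p. C l (Suc n) p - e l (Suc n) p) d r) p\<bar> \<le> B * (dt + h\<^sup>2)))"
  for M N :: nat and q :: "nat \<Rightarrow> real" and e C :: "nat \<Rightarrow> nat \<Rightarrow> int^3 \<Rightarrow> real" and \<phi> \<Psi> :: "nat \<Rightarrow> int^3 \<Rightarrow> real"

section \<open>Gronwall's inequality and induction over the time levels\<close>

lemma discrete_gronwall_step:
  fixes \<theta> x y :: real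
  assumes "0 \<le> \<theta>" "\<theta> \<le> 1 / 2" "0 \<le> x" "y - x \<le> \<theta> * (y + x)"
  shows "y \<le> exp (4 * \<theta>) * x"
proof -
  \<comment> \<open>The new value \<open>y\<close> also stands on the right because the scheme is
    implicit; \<open>\<theta> <= 1 / 2\<close> lets it be absorbed, at the price of the factor 4 in
    the exponent.\<close>
  have "(1 - \<theta>) * y \<le> (1 + \<theta>) * x" using assms(4) by (simp add: algebra_simps)
  also have "\<dots> \<le> (1 - \<theta>) * (1 + 4 * \<theta>) * x"
  proof (rule mult_right_mono)
    have "\<theta> * \<theta> \<le> \<theta> * (1 / 2)" using assms by (intro mult_left_mono) auto
    then show "1 + \<theta> \<le> (1 - \<theta>) * (1 + 4 * \<theta>)" by (simp add: algebra_simps)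
  qed fact
  finally have "(1 - \<theta>) * y \<le> (1 - \<theta>) * ((1 + 4 * \<theta>) * x)" by (simp only: mult.assoc)
  then have "y \<le> (1 + 4 * \<theta>) * x" using assms(2) by simp
  also have "\<dots> \<le> exp (4 * \<theta>) * x" using assms by (intro mult_right_mono exp_ge_add_one_self) auto
  finally show ?thesis .
qed

lemma norm2_h_lap_h_le:
  fixes q :: "nat \<Rightarrow> real"
  assumes h: "h > 0" and \<kappa>: "\<kappa> > 0" and \<tau>: "\<tau> \<ge> 0" and E: "\<And>l. l \<in> {1..M} \<Longrightarrow> norm2_h h N (e l) \<le> E"
    and res: "\<And>p. \<bar>- \<kappa> * lap_h h \<phi> p - (\<Sum>l=1..M. q l * e l p)\<bar> \<le> \<tau>"
  shows "norm2_h h N (lap_h h \<phi>) \<le> ((\<Sum>l=1..M. \<bar>q l\<bar>) * E + sqrt ((h * real N) ^ 3) * \<tau>) / \<kappa>"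
proof -
  have h0: "h \<ge> 0" using h by simp
  define \<rho> where "\<rho> p = - \<kappa> * lap_h h \<phi> p - (\<Sum>l=1..M. q l * e l p)" for p
  have "\<kappa> * norm2_h h N (lap_h h \<phi>) = norm2_h h N (\<lambda>p. - \<kappa> * lap_h h \<phi> p)"
    using \<kappa> by (subst norm2_h_scale[OF h0]) simp
  also have "(\<lambda>p. - \<kappa> * lap_h h \<phi> p) = (\<lambda>p. (\<Sum>l=1..M. q l * e l p) + \<rho> p)" by (simp add: \<rho>_def)
  also have "norm2_h h N \<dots> \<le> norm2_h h N (\<lambda>p. \<Sum>l=1..M. q l * e l p) + norm2_h h N \<rho>"
    by (rule norm2_h_triangle[OF h0])
  also have "norm2_h h N (\<lambda>p. \<Sum>l=1..M. q l * e l p) \<le> (\<Sum>l=1..M. norm2_h h N (\<lambda>p. q l * e l p))"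
    using norm2_h_sum[OF h0 finite_atLeastAtMost, where u = "\<lambda>l p. q l * e l p"] .
  also have "\<dots> \<le> (\<Sum>l=1..M. \<bar>q l\<bar> * E)"
    by (intro sum_mono) (simp add: norm2_h_scale[OF h0] mult_left_mono E)
  also have "\<dots> = (\<Sum>l=1..M. \<bar>q l\<bar>) * E" by (simp add: sum_distrib_right)
  also have "norm2_h h N \<rho> \<le> sqrt ((h * real N) ^ 3) * \<tau>"
    using res by (intro norm2_h_le_max h0 \<tau>) (simp add: \<rho>_def)
  finally show ?thesis using \<kappa> by (simp add: pos_le_divide_eq mult.commute)
qed

lemma square_add_le: "((x::real) + y)\<^sup>2 \<le> 2 * x\<^sup>2 + 2 * y\<^sup>2"
proof -
  have "0 \<le> (x - y)\<^sup>2" by simp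
  then show ?thesis by (simp add: power2_eq_square algebra_simps)
qed

text \<open>All constants are fixed before the induction: \<open>A0\<close> and \<open>A1\<close>
  are the values that Gronwall's inequality gives at the final time \<open>T\<close>, and
  \<open>A\<close> and \<open>\<delta>\<close> are chosen from them. The gradient bound obtained at
  each level is therefore always the same and does not degrade with the number of steps.\<close>

lemma scheme_stability:
  assumes L: "L > 0" and \<kappa>: "\<kappa> > 0" and T: "T > 0" and C2: "C2 > 0" and B: "B \<ge> 0"
  obtains Cs \<delta> where "Cs > 0" "\<delta> > 0"
    "\<And>h N dt e \<phi> C \<Psi> n. 0 < h \<Longrightarrow> h \<le> \<delta> \<Longrightarrow> h * real N = L \<Longrightarrow> 0 < dt \<Longrightarrow> dt \<le> \<delta> \<Longrightarrow> dt \<le> C2 * h \<Longrightarrow>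
      scheme_errors avg \<kappa> M q T B N h dt e \<phi> C \<Psi> \<Longrightarrow> real n * dt \<le> T \<Longrightarrow>
      (\<Sum>l=1..M. (norm2_h h N (e l n))\<^sup>2) + dt / 2 * (\<Sum>k=1..n. \<Sum>l=1..M. (grad_norm2_h h N (e l k))\<^sup>2) \<le> (Cs * (dt + h\<^sup>2))\<^sup>2 \<and>
      H2_norm_h h N (\<phi> n) \<le> Cs * (dt + h\<^sup>2)"
proof -
  define Q where "Q = (\<Sum>l=1..M. \<bar>q l\<bar>)"
  have Q0: "Q \<ge> 0" by (simp add: Q_def sum_nonneg)
  have qQ: "\<bar>q l\<bar> \<le> Q" if "l \<in> {1..M}" for l unfolding Q_def by (rule member_le_sum[OF that]) auto
  define K where "K = 28 * Q * (B + 1)"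
  define G where "G = 8 * L\<^sup>2 / \<kappa>\<^sup>2"
  \<comment> \<open>The summands are the coefficients of, in turn, the new error, the old error
    entering through the potential, and the squared consistency error.\<close>
  define \<Gamma> where "\<Gamma> = (12 * K\<^sup>2 + 1) + real M * (4 * K\<^sup>2 * (G * Q\<^sup>2)) + real M * (4 * K\<^sup>2 * (G * (L ^ 3 * B\<^sup>2)) + L ^ 3 * B\<^sup>2)"
  have G0: "G \<ge> 0" by (simp add: G_def)
  have terms: "0 \<le> real M * (4 * K\<^sup>2 * (G * Q\<^sup>2))" "0 \<le> real M * (4 * K\<^sup>2 * (G * (L ^ 3 * B\<^sup>2)) + L ^ 3 * B\<^sup>2)" "0 \<le> 12 * K\<^sup>2 + 1"
    using G0 L by (auto intro!: mult_nonneg_nonneg add_nonneg_nonneg)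
  have \<Gamma>: "\<Gamma> \<ge> 1" using terms by (simp add: \<Gamma>_def)
  define A0 where "A0 = sqrt (exp (4 * \<Gamma> * T) * (real M * (L ^ 3 * B\<^sup>2) + 1))"
  have A0: "A0 \<ge> 0" "A0\<^sup>2 = exp (4 * \<Gamma> * T) * (real M * (L ^ 3 * B\<^sup>2) + 1)"
    using L by (simp_all add: A0_def)
  define A1 where "A1 = (Q * A0 + sqrt (L ^ 3) * B) / \<kappa>"
  have A1: "A1 \<ge> 0" using Q0 A0 B L \<kappa> by (simp add: A1_def)
  \<comment> \<open>\<open>dt + h^2 <= (C2 + 1) * h\<close> converts the bound of the discrete
    Laplacian by \<open>A1 * (dt + h^2)\<close> into \<open>A * h\<close>; the 1 added to
    \<open>A1\<close> keeps \<open>A\<close> positive.\<close>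
  define A where "A = (A1 + 1) * (C2 + 1)"
  have A: "A > 0" using A1 C2 by (simp add: A_def)
  obtain \<delta>0 where \<delta>0: "\<delta>0 > 0"
    "\<And>h N u d p. 0 < h \<Longrightarrow> h \<le> \<delta>0 \<Longrightarrow> h * real N = L \<Longrightarrow> grid_periodic N u \<Longrightarrow>
      norm2_h h N (lap_h h u) \<le> A * h \<Longrightarrow> \<bar>grad_h h u d p\<bar> \<le> 1"
    using grad_h_max_le_1[OF A L] by metis
  \<comment> \<open>\<open>1 / (2 * \<Gamma>)\<close> serves the Gronwall step. The last entry makes
    the jumps of the potential at most 1/6, the value of \<open>r\<close> with
    \<open>36 * r^2 = 1\<close>.\<close>
  define \<delta> where "\<delta> = min \<delta>0 (min 1 (min (1 / (2 * \<Gamma>)) (1 / (6 * (Q * (B + 1) + 1)))))"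
  have QB: "Q * (B + 1) \<ge> 0" using Q0 B by simp
  have \<delta>: "\<delta> > 0" "\<delta> \<le> \<delta>0" "\<delta> \<le> 1" "\<delta> \<le> 1 / (2 * \<Gamma>)" "\<delta> \<le> 1 / (6 * (Q * (B + 1) + 1))"
    using \<delta>0(1) \<Gamma> QB by (auto simp: \<delta>_def)
  \<comment> \<open>The summands account for the mean in Poincare's inequality, for the gradient,
    counted once there and once by itself, and for the Laplacian.\<close>
  define H where "H = B\<^sup>2 / L ^ 3 + (3 / 2 * L\<^sup>2 + 1) * (4 * L\<^sup>2 * A1\<^sup>2) + A1\<^sup>2"
  have H0: "H \<ge> 0" using L by (simp add: H_def)
  define Cs where "Cs = A0 + sqrt H + 1"
  have Cs: "Cs > 0" "A0 \<le> Cs" "sqrt H \<le> Cs" using A0 H0 by (auto simp: Cs_def add_nonneg_pos)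
  show ?thesis
  proof (rule that[OF Cs(1) \<delta>(1)])
    fix h N dt e \<phi> C \<Psi> n
    assume h: "(0::real) < h" "h \<le> \<delta>" and N: "h * real N = L" and dt: "0 < dt" "dt \<le> \<delta>" "dt \<le> C2 * h"
      and S: "scheme_errors avg \<kappa> M q T B N h dt e \<phi> C \<Psi>" and n: "real n * dt \<le> T"
    have h0: "h \<ge> 0" "h \<le> 1" using h \<delta> by auto
    have N1: "N \<ge> 1" using N L by (cases N) auto
    define \<epsilon> where "\<epsilon> = dt + h\<^sup>2"
    have \<epsilon>: "\<epsilon> > 0" using dt by (simp add: \<epsilon>_def add_pos_nonneg)
    have \<epsilon>h: "\<epsilon> \<le> (C2 + 1) * h"
    proof -
      have "h\<^sup>2 \<le> h" using h h0 by (simp add: power2_eq_square mult_left_le)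
      then show ?thesis using dt(3) by (simp add: \<epsilon>_def distrib_right)
    qed
    define E where "E n = (\<Sum>l=1..M. (norm2_h h N (e l n))\<^sup>2)" for n
    define D where "D n = (\<Sum>l=1..M. (grad_norm2_h h N (e l n))\<^sup>2)" for n
    \<comment> \<open>Including the accumulated dissipation and the constant
      \<open>\<epsilon>^2\<close> makes the recursion for \<open>Y\<close> homogeneous, so a product
      of exponential factors bounds it.\<close>
    define Y where "Y n = E n + dt / 2 * (\<Sum>k=1..n. D k) + \<epsilon>\<^sup>2" for n
    have E0: "E n \<ge> 0" and D0: "D n \<ge> 0" for n by (simp_all add: E_def D_def sum_nonneg)
    have EY: "E n \<le> Y n" for n using D0 dt by (simp add: Y_def sum_nonneg)
    have Y0: "Y n \<ge> 0" for n using E0[of n] EY[of n] by linarith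
    have lap: "norm2_h h N (lap_h h (\<phi> n)) \<le> (Q * sqrt (E n) + sqrt (L ^ 3) * (B * \<epsilon>)) / \<kappa>" if n: "real n * dt \<le> T" for n
      unfolding Q_def N[symmetric]
    proof (rule norm2_h_lap_h_le[OF h(1) \<kappa>])
      show "0 \<le> B * \<epsilon>" using B \<epsilon> by simp
      show "norm2_h h N (e l n) \<le> sqrt (E n)" if l: "l \<in> {1..M}" for l
      proof (rule real_le_rsqrt)
        show "(norm2_h h N (e l n))\<^sup>2 \<le> E n" unfolding E_def by (rule member_le_sum[OF l]) auto
      qed
      show "\<bar>- \<kappa> * lap_h h (\<phi> n) p - (\<Sum>l=1..M. q l * e l n p)\<bar> \<le> B * \<epsilon>" for p
        using S n unfolding scheme_errors_def \<epsilon>_def by blast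
    qed
    have per\<phi>: "grid_periodic N (\<phi> n)" if "real n * dt \<le> T" for n
      using S that unfolding scheme_errors_def by blast
    have grad: "(grad_norm2_h h N (\<phi> n))\<^sup>2 \<le> G * (Q\<^sup>2 * E n + L ^ 3 * B\<^sup>2 * \<epsilon>\<^sup>2)" if n: "real n * dt \<le> T" for n
    proof -
      have "grad_norm2_h h N (\<phi> n) \<le> 2 * L * norm2_h h N (lap_h h (\<phi> n))"
        using grad_norm2_h_le_lap_h[OF per\<phi>[OF n] h(1) N1] unfolding N .
      also have "\<dots> \<le> 2 * L * ((Q * sqrt (E n) + sqrt (L ^ 3) * (B * \<epsilon>)) / \<kappa>)"
        using lap[OF n] L by (intro mult_left_mono) auto
      finally have "(grad_norm2_h h N (\<phi> n))\<^sup>2 \<le> (2 * L * ((Q * sqrt (E n) + sqrt (L ^ 3) * (B * \<epsilon>)) / \<kappa>))\<^sup>2"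
        by (intro power_mono) (simp_all add: grad_norm2_h_def sum_nonneg h0)
      also have "\<dots> = 4 * L\<^sup>2 / \<kappa>\<^sup>2 * (Q * sqrt (E n) + sqrt (L ^ 3) * (B * \<epsilon>))\<^sup>2"
        by (simp add: power_mult_distrib power_divide)
      also have "\<dots> \<le> 4 * L\<^sup>2 / \<kappa>\<^sup>2 * (2 * (Q * sqrt (E n))\<^sup>2 + 2 * (sqrt (L ^ 3) * (B * \<epsilon>))\<^sup>2)"
        by (intro mult_left_mono square_add_le) simp
      also have "\<dots> = G * (Q\<^sup>2 * E n + L ^ 3 * B\<^sup>2 * \<epsilon>\<^sup>2)"
        using E0[of n] L by (simp add: G_def power_mult_distrib algebra_simps)
      finally show ?thesis .
    qed
    have step: "Y (Suc n) \<le> exp (4 * (\<Gamma> * dt)) * Y n"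
      if n: "real (Suc n) * dt \<le> T" and small: "\<And>d p. \<bar>grad_h h (\<phi> n) d p\<bar> \<le> 1" for n
    proof -
      have n': "real n * dt \<le> T" using n dt by (simp add: algebra_simps)
      define P where "P = G * (Q\<^sup>2 * E n + L ^ 3 * B\<^sup>2 * \<epsilon>\<^sup>2)"
      have P0: "P \<ge> 0" using G0 E0[of n] L by (simp add: P_def)
      have "(norm2_h h N (e l (Suc n)))\<^sup>2 - (norm2_h h N (e l n))\<^sup>2 + dt / 2 * (grad_norm2_h h N (e l (Suc n)))\<^sup>2
         \<le> dt * ((12 * K\<^sup>2 + 1) * (norm2_h h N (e l (Suc n)))\<^sup>2 + (4 * K\<^sup>2 * P + L ^ 3 * B\<^sup>2 * \<epsilon>\<^sup>2))" if l: "l \<in> {1..M}" for l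
      proof -
        define Kl where "Kl = 28 * \<bar>q l\<bar> * (B + 1)"
        have Kl: "Kl\<^sup>2 \<le> K\<^sup>2"
          unfolding Kl_def K_def using qQ[OF l] B by (intro power_mono mult_right_mono mult_left_mono) auto
        have "(norm2_h h N (e l (Suc n)))\<^sup>2 - (norm2_h h N (e l n))\<^sup>2 + dt / 2 * (grad_norm2_h h N (e l (Suc n)))\<^sup>2
          \<le> dt * ((12 * Kl\<^sup>2 + 1) * (norm2_h h N (e l (Suc n)))\<^sup>2 + 4 * Kl\<^sup>2 * (grad_norm2_h h N (\<phi> n))\<^sup>2 + (h * real N) ^ 3 * (B * \<epsilon>)\<^sup>2)"
        proof (rule energy_step[OF h(1) h0(2) dt(1) B])
          show "0 \<le> B * \<epsilon>" using B \<epsilon> by simp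
          show "\<bar>q l\<bar> * (B + 1) * h \<le> 1 / 6"
          proof -
            have "\<bar>q l\<bar> * (B + 1) * h \<le> (Q * (B + 1) + 1) * h"
              using mult_right_mono[OF qQ[OF l], of "B + 1"] B h by (intro mult_right_mono) linarith+
            also have "\<dots> \<le> (Q * (B + 1) + 1) * (1 / (6 * (Q * (B + 1) + 1)))"
              using h \<delta>(5) QB by (intro mult_left_mono) auto
            also have "\<dots> = 1 / 6" using QB by simp
            finally show ?thesis .
          qed
          show "1 / 6 \<le> (1::real)" "36 * (1 / 6)\<^sup>2 \<le> (1::real)" by (simp_all add: power2_eq_square)
          show "grid_periodic N (C l (Suc n))" "grid_periodic N (\<Psi> n)" "grid_periodic N (\<phi> n)" "grid_periodic N (e l (Suc n))"
            using S n n' l unfolding scheme_errors_def by blast+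
          show "\<bar>C l (Suc n) p\<bar> \<le> B" "\<bar>grad_h h (C l (Suc n)) d p\<bar> \<le> B" for d p
            using S n l unfolding scheme_errors_def by blast+
          show "\<bar>grad_h h (\<Psi> n) d p\<bar> \<le> B" for d p using S n' unfolding scheme_errors_def by blast
          show "\<bar>grad_h h (\<phi> n) d p\<bar> \<le> 1" for d p by (rule small)
          show "Kl = 28 * \<bar>q l\<bar> * (B + 1)" by (rule Kl_def)
          show "\<bar>(e l (Suc n) p - e l n p) / dt - div_h h (\<lambda>d r. grid_flux avg h (\<lambda>p. q l * \<Psi> n p) (C l (Suc n)) d r
             - grid_flux avg h (\<lambda>p. q l * (\<Psi> n p - \<phi> n p)) (\<lambda>p. C l (Suc n) p - e l (Suc n) p) d r) p\<bar> \<le> B * \<epsilon>" for p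
            using S n l unfolding scheme_errors_def \<epsilon>_def by blast
        qed
        also have "\<dots> \<le> dt * ((12 * K\<^sup>2 + 1) * (norm2_h h N (e l (Suc n)))\<^sup>2 + 4 * K\<^sup>2 * P + L ^ 3 * (B * \<epsilon>)\<^sup>2)"
          using dt Kl grad[OF n'] P0 unfolding N P_def[symmetric]
          by (intro mult_left_mono add_mono mult_right_mono mult_mono order_refl) auto
        finally show ?thesis by (simp only: power_mult_distrib mult.assoc add.assoc)
      qed
      then have "(\<Sum>l=1..M. (norm2_h h N (e l (Suc n)))\<^sup>2 - (norm2_h h N (e l n))\<^sup>2 + dt / 2 * (grad_norm2_h h N (e l (Suc n)))\<^sup>2)
         \<le> (\<Sum>l=1..M. dt * ((12 * K\<^sup>2 + 1) * (norm2_h h N (e l (Suc n)))\<^sup>2 + (4 * K\<^sup>2 * P + L ^ 3 * B\<^sup>2 * \<epsilon>\<^sup>2)))"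
        by (rule sum_mono)
      then have "E (Suc n) - E n + dt / 2 * D (Suc n) \<le> dt * ((12 * K\<^sup>2 + 1) * E (Suc n) + real M * (4 * K\<^sup>2 * P + L ^ 3 * B\<^sup>2 * \<epsilon>\<^sup>2))"
        unfolding sum.distrib sum_subtractf sum_distrib_left[symmetric] E_def[symmetric] D_def[symmetric]
        by (simp only: sum_constant card_atLeastAtMost diff_Suc_1) (simp add: algebra_simps)
      also have "\<dots> = dt * ((12 * K\<^sup>2 + 1) * E (Suc n) + real M * (4 * K\<^sup>2 * (G * Q\<^sup>2)) * E n
          + real M * (4 * K\<^sup>2 * (G * (L ^ 3 * B\<^sup>2)) + L ^ 3 * B\<^sup>2) * \<epsilon>\<^sup>2)"
        by (simp add: P_def algebra_simps)
      also have "\<dots> \<le> dt * (\<Gamma> * E (Suc n) + \<Gamma> * E n + \<Gamma> * \<epsilon>\<^sup>2)"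
        using dt E0 terms by (intro mult_left_mono add_mono mult_right_mono) (auto simp: \<Gamma>_def)
      also have "\<dots> = (\<Gamma> * dt) * (E (Suc n) + (E n + \<epsilon>\<^sup>2))" by (simp add: algebra_simps)
      also have "\<dots> \<le> (\<Gamma> * dt) * (Y (Suc n) + Y n)"
        using EY[of "Suc n"] D0 dt \<Gamma> by (intro mult_left_mono add_mono) (auto simp: Y_def sum_nonneg)
      finally have "Y (Suc n) - Y n \<le> (\<Gamma> * dt) * (Y (Suc n) + Y n)"
        by (simp add: Y_def algebra_simps)
      moreover have "\<Gamma> * dt \<le> 1 / 2"
      proof -
        have "\<Gamma> * dt \<le> \<Gamma> * (1 / (2 * \<Gamma>))" using dt \<delta>(4) \<Gamma> by (intro mult_left_mono) auto
        then show ?thesis using \<Gamma> by simp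
      qed
      ultimately show ?thesis using Y0 \<Gamma> dt by (intro discrete_gronwall_step) auto
    qed
    have Yinit: "Y 0 \<le> (real M * (L ^ 3 * B\<^sup>2) + 1) * \<epsilon>\<^sup>2"
    proof -
      have "(norm2_h h N (e l 0))\<^sup>2 \<le> L ^ 3 * B\<^sup>2 * \<epsilon>\<^sup>2" if l: "l \<in> {1..M}" for l
      proof -
        have "norm2_h h N (e l 0) \<le> sqrt ((h * real N) ^ 3) * (B * \<epsilon>)"
          using S l B \<epsilon> by (intro norm2_h_le_max h0) (auto simp: scheme_errors_def \<epsilon>_def)
        then have "(norm2_h h N (e l 0))\<^sup>2 \<le> (sqrt (L ^ 3) * (B * \<epsilon>))\<^sup>2"
          unfolding N by (intro power_mono norm2_h_nonneg h0)
        then show ?thesis using L by (simp add: power_mult_distrib)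
      qed
      then have "E 0 \<le> (\<Sum>l=1..M. L ^ 3 * B\<^sup>2 * \<epsilon>\<^sup>2)" unfolding E_def by (rule sum_mono)
      then show ?thesis by (simp add: Y_def algebra_simps)
    qed
    \<comment> \<open>Shared by the induction and the conclusion: it trades the Gronwall bound at
      level \<open>n\<close> for constants that do not depend on \<open>n\<close>.\<close>
    have from_Y: "Y n \<le> (A0 * \<epsilon>)\<^sup>2 \<and> norm2_h h N (lap_h h (\<phi> n)) \<le> A1 * \<epsilon>"
      if n: "real n * dt \<le> T" and Yn: "Y n \<le> exp (4 * (\<Gamma> * dt) * real n) * Y 0" for n
    proof -
      have "Y n \<le> exp (4 * \<Gamma> * T) * ((real M * (L ^ 3 * B\<^sup>2) + 1) * \<epsilon>\<^sup>2)"
      proof (rule order_trans[OF Yn])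
        have "4 * (\<Gamma> * dt) * real n = 4 * \<Gamma> * (real n * dt)" by simp
        also have "\<dots> \<le> 4 * \<Gamma> * T" using n \<Gamma> by (intro mult_left_mono) auto
        finally show "exp (4 * (\<Gamma> * dt) * real n) * Y 0 \<le> exp (4 * \<Gamma> * T) * ((real M * (L ^ 3 * B\<^sup>2) + 1) * \<epsilon>\<^sup>2)"
          using Yinit Y0 by (intro mult_mono) auto
      qed
      also have "\<dots> = (A0 * \<epsilon>)\<^sup>2" by (simp add: power_mult_distrib A0)
      finally have Y_le: "Y n \<le> (A0 * \<epsilon>)\<^sup>2" .
      then have En: "E n \<le> (A0 * \<epsilon>)\<^sup>2" using EY[of n] by linarith
      then have "sqrt (E n) \<le> A0 * \<epsilon>" using A0 \<epsilon> by (intro real_le_lsqrt) (auto simp: E0)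
      then have "(Q * sqrt (E n) + sqrt (L ^ 3) * (B * \<epsilon>)) / \<kappa> \<le> (Q * (A0 * \<epsilon>) + sqrt (L ^ 3) * (B * \<epsilon>)) / \<kappa>"
        using Q0 \<kappa> by (intro divide_right_mono add_right_mono mult_left_mono) auto
      also have "\<dots> = A1 * \<epsilon>" by (simp add: A1_def algebra_simps add_divide_distrib)
      finally show ?thesis using Y_le lap[OF n] by linarith
    qed
    have Y_bound: "Y n \<le> exp (4 * (\<Gamma> * dt) * real n) * Y 0" if "real n * dt \<le> T" for n
      using that
    proof (induction n)
      case (Suc n)
      have n': "real n * dt \<le> T" using Suc.prems dt by (simp add: algebra_simps)
      note IH = Suc.IH[OF n']
      have "norm2_h h N (lap_h h (\<phi> n)) \<le> A1 * \<epsilon>" using from_Y[OF n' IH] by simp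
      also have "\<dots> \<le> (A1 + 1) * ((C2 + 1) * h)" using A1 \<epsilon> \<epsilon>h by (intro mult_mono) auto
      also have "\<dots> = A * h" by (simp add: A_def)
      finally have "\<bar>grad_h h (\<phi> n) d p\<bar> \<le> 1" for d p
        using h \<delta>(2) by (intro \<delta>0(2)[OF h(1) _ N per\<phi>[OF n']]) auto
      from step[OF Suc.prems this] have "Y (Suc n) \<le> exp (4 * (\<Gamma> * dt)) * Y n" .
      also have "\<dots> \<le> exp (4 * (\<Gamma> * dt)) * (exp (4 * (\<Gamma> * dt) * real n) * Y 0)"
        using IH by (intro mult_left_mono) auto
      also have "\<dots> = exp (4 * (\<Gamma> * dt) * real (Suc n)) * Y 0"
      proof -
        have "4 * (\<Gamma> * dt) * real (Suc n) = 4 * (\<Gamma> * dt) + 4 * (\<Gamma> * dt) * real n" by (simp add: distrib_left)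
        then show ?thesis by (simp only: exp_add mult.assoc)
      qed
      finally show ?case .
    qed simp
    note main = from_Y[OF n Y_bound[OF n]]
    have "E n + dt / 2 * (\<Sum>k=1..n. D k) \<le> (Cs * \<epsilon>)\<^sup>2"
    proof -
      have "E n + dt / 2 * (\<Sum>k=1..n. D k) \<le> Y n" by (simp add: Y_def)
      also note main[THEN conjunct1]
      also have "(A0 * \<epsilon>)\<^sup>2 \<le> (Cs * \<epsilon>)\<^sup>2" using Cs A0 \<epsilon> by (intro power_mono mult_right_mono) auto
      finally show ?thesis .
    qed
    moreover have "H2_norm_h h N (\<phi> n) \<le> Cs * \<epsilon>"
    proof -
      define W where "W = norm2_h h N (lap_h h (\<phi> n))"
      have W: "0 \<le> W" "W \<le> A1 * \<epsilon>" using main h0 by (auto simp: W_def norm2_h_nonneg)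
      have W2: "W\<^sup>2 \<le> A1\<^sup>2 * \<epsilon>\<^sup>2" using power_mono[OF W(2,1), of 2] by (simp add: power_mult_distrib)
      have "grad_norm2_h h N (\<phi> n) \<le> 2 * L * W"
        using grad_norm2_h_le_lap_h[OF per\<phi>[OF n] h(1) N1] unfolding N W_def .
      then have "(grad_norm2_h h N (\<phi> n))\<^sup>2 \<le> (2 * L * W)\<^sup>2"
        by (intro power_mono) (simp_all add: grad_norm2_h_def sum_nonneg h0)
      also have "\<dots> = 4 * L\<^sup>2 * W\<^sup>2" by (simp add: power_mult_distrib)
      also have "\<dots> \<le> 4 * L\<^sup>2 * (A1\<^sup>2 * \<epsilon>\<^sup>2)" using W2 by (intro mult_left_mono) auto
      finally have g2: "(grad_norm2_h h N (\<phi> n))\<^sup>2 \<le> 4 * L\<^sup>2 * (A1\<^sup>2 * \<epsilon>\<^sup>2)" .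
      have "\<bar>h ^ 3 * (\<Sum>p\<in>cells N. \<phi> n p)\<bar> \<le> B * \<epsilon>"
        using S n unfolding scheme_errors_def \<epsilon>_def by blast
      then have "(h ^ 3 * (\<Sum>p\<in>cells N. \<phi> n p))\<^sup>2 \<le> (B * \<epsilon>)\<^sup>2" by (metis abs_ge_zero power2_abs power_mono)
      then have "(h ^ 3 * (\<Sum>p\<in>cells N. \<phi> n p))\<^sup>2 / L ^ 3 \<le> (B * \<epsilon>)\<^sup>2 / L ^ 3" using L by (intro divide_right_mono) auto
      moreover have "3 / 2 * L\<^sup>2 * (grad_norm2_h h N (\<phi> n))\<^sup>2 \<le> 3 / 2 * L\<^sup>2 * (4 * L\<^sup>2 * (A1\<^sup>2 * \<epsilon>\<^sup>2))"
        using g2 by (intro mult_left_mono) auto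
      ultimately have p2: "(norm2_h h N (\<phi> n))\<^sup>2 \<le> (B * \<epsilon>)\<^sup>2 / L ^ 3 + 3 / 2 * L\<^sup>2 * (4 * L\<^sup>2 * (A1\<^sup>2 * \<epsilon>\<^sup>2))"
        using poincare_h[OF per\<phi>[OF n] h(1) N1] unfolding N by linarith
      have "(norm2_h h N (\<phi> n))\<^sup>2 + (grad_norm2_h h N (\<phi> n))\<^sup>2 + W\<^sup>2 \<le>
        ((B * \<epsilon>)\<^sup>2 / L ^ 3 + 3 / 2 * L\<^sup>2 * (4 * L\<^sup>2 * (A1\<^sup>2 * \<epsilon>\<^sup>2))) + 4 * L\<^sup>2 * (A1\<^sup>2 * \<epsilon>\<^sup>2) + A1\<^sup>2 * \<epsilon>\<^sup>2"
        using p2 g2 W2 by (intro add_mono)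
      also have "\<dots> = H * \<epsilon>\<^sup>2" by (simp add: H_def power_mult_distrib algebra_simps)
      finally have "H2_norm_h h N (\<phi> n) \<le> sqrt (H * \<epsilon>\<^sup>2)"
        unfolding H2_norm_h_def W_def by (rule real_sqrt_le_mono)
      also have "\<dots> = sqrt H * \<epsilon>" using \<epsilon> by (simp add: real_sqrt_mult)
      also have "\<dots> \<le> Cs * \<epsilon>" using Cs \<epsilon> by (intro mult_right_mono) auto
      finally show ?thesis .
    qed
    ultimately show "(\<Sum>l=1..M. (norm2_h h N (e l n))\<^sup>2) + dt / 2 * (\<Sum>k=1..n. \<Sum>l=1..M. (grad_norm2_h h N (e l k))\<^sup>2) \<le> (Cs * (dt + h\<^sup>2))\<^sup>2 \<and>
      H2_norm_h h N (\<phi> n) \<le> Cs * (dt + h\<^sup>2)"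
      by (simp add: E_def D_def \<epsilon>_def)
  qed
qed

section \<open>Convergence\<close>

lemma norm2_h_diff_squared_le:
  assumes "h \<ge> 0"
  shows "(norm2_h h N (\<lambda>p. u p - v p))\<^sup>2 \<le> 2 * (norm2_h h N u)\<^sup>2 + 2 * (norm2_h h N v)\<^sup>2"
proof -
  have "(\<Sum>p\<in>cells N. (u p - v p)\<^sup>2) \<le> (\<Sum>p\<in>cells N. 2 * (u p)\<^sup>2 + 2 * (v p)\<^sup>2)"
    using square_add_le[of "u p" "- v p" for p] by (intro sum_mono) simp
  then have "h ^ 3 * (\<Sum>p\<in>cells N. (u p - v p)\<^sup>2) \<le> h ^ 3 * (\<Sum>p\<in>cells N. 2 * (u p)\<^sup>2 + 2 * (v p)\<^sup>2)"
    using assms by (intro mult_left_mono) auto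
  then show ?thesis
    by (simp add: norm2_h_squared assms sum.distrib distrib_left mult.left_commute flip: sum_distrib_left)
qed

lemma grad_h_diff: "grad_h h (\<lambda>p. u p - v p) d = (\<lambda>p. grad_h h u d p - grad_h h v d p)"
  by (simp add: grad_h_def fun_eq_iff diff_divide_distrib)

lemma div_h_diff: "div_h h (\<lambda>d p. F d p - G d p) p = div_h h F p - div_h h G p"
  by (simp add: div_h_def diff_divide_distrib sum_subtractf)

lemma lap_h_diff: "lap_h h (\<lambda>p. u p - v p) = (\<lambda>p. lap_h h u p - lap_h h v p)"
proof -
  have "grad_h h (\<lambda>p. u p - v p) = (\<lambda>d p. grad_h h u d p - grad_h h v d p)" by (simp add: fun_eq_iff grad_h_diff)
  then show ?thesis by (intro ext) (simp only: lap_h_def div_h_diff)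
qed

lemma lap_h_eq: "lap_h h u p = (\<Sum>d\<in>UNIV. (u (p + axis d 1) + u (p - axis d 1) - 2 * u p) / h\<^sup>2)"
  by (simp add: lap_h_def div_h_def grad_h_def power2_eq_square diff_divide_distrib add_divide_distrib algebra_simps)

lemma grad_norm2_h_diff_squared_le:
  assumes "h \<ge> 0"
  shows "(grad_norm2_h h N (\<lambda>p. u p - v p))\<^sup>2 \<le> 2 * (grad_norm2_h h N u)\<^sup>2 + 2 * (grad_norm2_h h N v)\<^sup>2"
proof -
  have "(grad_norm2_h h N (\<lambda>p. u p - v p))\<^sup>2 \<le>
      (\<Sum>d\<in>UNIV. 2 * (norm2_h h N (grad_h h u d))\<^sup>2 + 2 * (norm2_h h N (grad_h h v d))\<^sup>2)"
    unfolding grad_norm2_h_squared[OF assms] grad_h_diff by (intro sum_mono norm2_h_diff_squared_le assms)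
  then show ?thesis by (simp add: grad_norm2_h_squared[OF assms] sum.distrib flip: sum_distrib_left)
qed

lemma H2_norm_h_squared: "h \<ge> 0 \<Longrightarrow> (H2_norm_h h N u)\<^sup>2 = (norm2_h h N u)\<^sup>2 + (grad_norm2_h h N u)\<^sup>2 + (norm2_h h N (lap_h h u))\<^sup>2"
  by (simp add: H2_norm_h_def)

lemma H2_norm_h_diff_squared_le:
  assumes "h \<ge> 0"
  shows "(H2_norm_h h N (\<lambda>p. u p - v p))\<^sup>2 \<le> 2 * (H2_norm_h h N u)\<^sup>2 + 2 * (H2_norm_h h N v)\<^sup>2"
  unfolding H2_norm_h_squared[OF assms] lap_h_diff
  using norm2_h_diff_squared_le[OF assms, of N u v] norm2_h_diff_squared_le[OF assms, of N "lap_h h u" "lap_h h v"]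
    grad_norm2_h_diff_squared_le[OF assms, of N u v]
  by (simp add: algebra_simps)

lemma norm2_h_squared_le_max:
  assumes "h \<ge> 0" "\<And>p. \<bar>u p\<bar> \<le> A"
  shows "(norm2_h h N u)\<^sup>2 \<le> (h * real N) ^ 3 * A\<^sup>2"
proof -
  have A: "A \<ge> 0" using assms(2)[of 0] by linarith
  have "(norm2_h h N u)\<^sup>2 \<le> (sqrt ((h * real N) ^ 3) * A)\<^sup>2"
    using norm2_h_le_max[OF assms(1) A assms(2)] by (intro power_mono norm2_h_nonneg assms(1))
  then show ?thesis using assms(1) by (simp add: power_mult_distrib)
qed

text \<open>Every difference quotient costs a factor \<open>1 / h\<close>, so a function of size
  \<open>h^4\<close> has a discrete Laplacian of size \<open>h^2\<close>; this is why the projection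
  error is wanted to fourth order. 157 = 1 + 12 + 144 collects the function, its gradient and its
  Laplacian.\<close>

lemma small_grid_function:
  assumes h: "0 < h" "h \<le> 1" and \<eta>: "\<And>p. \<bar>\<eta> p\<bar> \<le> F * h ^ 4"
  shows "\<bar>grad_h h \<eta> d p\<bar> \<le> 2 * F * h ^ 3" "\<bar>lap_h h \<eta> p\<bar> \<le> 12 * F * h\<^sup>2"
    and "(grad_norm2_h h N \<eta>)\<^sup>2 \<le> 12 * (h * real N) ^ 3 * F\<^sup>2 * h ^ 4"
    and "(H2_norm_h h N \<eta>)\<^sup>2 \<le> 157 * (h * real N) ^ 3 * F\<^sup>2 * h ^ 4"
proof -
  have h0: "h \<ge> 0" using h by simp
  have F: "F \<ge> 0"
  proof -
    have "0 \<le> F * h ^ 4" using \<eta>[of 0] by linarith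
    then show ?thesis using h by (simp add: zero_le_mult_iff)
  qed
  have g: "\<bar>grad_h h \<eta> d p\<bar> \<le> 2 * F * h ^ 3" for d p
  proof -
    have "\<bar>\<eta> (p + axis d 1) - \<eta> p\<bar> \<le> 2 * (F * h ^ 4)" using \<eta>[of "p + axis d 1"] \<eta>[of p] by linarith
    then have "\<bar>grad_h h \<eta> d p\<bar> \<le> 2 * (F * h ^ 4) / h"
      using h divide_right_mono[of _ _ h] unfolding grad_h_def by (simp only: abs_divide) auto
    also have "\<dots> = 2 * F * h ^ 3" using h by (simp add: power_numeral_reduce)
    finally show ?thesis .
  qed
  then show "\<bar>grad_h h \<eta> d p\<bar> \<le> 2 * F * h ^ 3" .
  have l: "\<bar>lap_h h \<eta> p\<bar> \<le> 12 * F * h\<^sup>2" for p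
  proof -
    have "\<bar>lap_h h \<eta> p\<bar> \<le> (\<Sum>d\<in>(UNIV::3 set). 4 * F * h\<^sup>2)"
      unfolding lap_h_def div_h_def
    proof (rule order_trans[OF sum_abs sum_mono])
      fix d :: 3
      have "\<bar>grad_h h \<eta> d p - grad_h h \<eta> d (p - axis d 1)\<bar> \<le> 4 * F * h ^ 3"
        using g[of d p] g[of d "p - axis d 1"] by linarith
      then have "\<bar>(grad_h h \<eta> d p - grad_h h \<eta> d (p - axis d 1)) / h\<bar> \<le> 4 * F * h ^ 3 / h"
        using h divide_right_mono[of _ _ h] by (simp only: abs_divide) auto
      also have "\<dots> = 4 * F * h\<^sup>2" using h by (simp add: power_numeral_reduce)
      finally show "\<bar>(grad_h h \<eta> d p - grad_h h \<eta> d (p - axis d 1)) / h\<bar> \<le> 4 * F * h\<^sup>2" .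
    qed
    then show ?thesis by simp
  qed
  then show "\<bar>lap_h h \<eta> p\<bar> \<le> 12 * F * h\<^sup>2" .
  have pw: "h ^ 6 \<le> h ^ 4" "h ^ 8 \<le> h ^ 4" using h by (auto intro!: power_decreasing)
  define V where "V = (h * real N) ^ 3"
  have V: "V \<ge> 0" using h0 by (simp add: V_def)
  have n1: "(norm2_h h N \<eta>)\<^sup>2 \<le> V * F\<^sup>2 * h ^ 4"
  proof -
    have "(norm2_h h N \<eta>)\<^sup>2 \<le> V * (F * h ^ 4)\<^sup>2" unfolding V_def by (rule norm2_h_squared_le_max[OF h0 \<eta>])
    also have "\<dots> = V * F\<^sup>2 * h ^ 8" by (simp add: power_mult_distrib flip: power_mult)
    also have "\<dots> \<le> V * F\<^sup>2 * h ^ 4" using V pw by (intro mult_left_mono) auto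
    finally show ?thesis .
  qed
  have n2: "(grad_norm2_h h N \<eta>)\<^sup>2 \<le> 12 * V * F\<^sup>2 * h ^ 4"
  proof -
    have "(grad_norm2_h h N \<eta>)\<^sup>2 \<le> (\<Sum>d\<in>(UNIV::3 set). V * (2 * F * h ^ 3)\<^sup>2)"
      unfolding grad_norm2_h_squared[OF h0] V_def by (intro sum_mono norm2_h_squared_le_max h0 g)
    also have "\<dots> = 12 * V * F\<^sup>2 * h ^ 6" by (simp add: power_mult_distrib flip: power_mult)
    also have "\<dots> \<le> 12 * V * F\<^sup>2 * h ^ 4" using V pw by (intro mult_left_mono) auto
    finally show ?thesis .
  qed
  then show "(grad_norm2_h h N \<eta>)\<^sup>2 \<le> 12 * (h * real N) ^ 3 * F\<^sup>2 * h ^ 4" by (simp add: V_def)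
  have n3: "(norm2_h h N (lap_h h \<eta>))\<^sup>2 \<le> 144 * V * F\<^sup>2 * h ^ 4"
  proof -
    have "(norm2_h h N (lap_h h \<eta>))\<^sup>2 \<le> V * (12 * F * h\<^sup>2)\<^sup>2" unfolding V_def by (rule norm2_h_squared_le_max[OF h0 l])
    also have "\<dots> = 144 * V * F\<^sup>2 * h ^ 4" by (simp add: power_mult_distrib flip: power_mult)
    finally show ?thesis .
  qed
  show "(H2_norm_h h N \<eta>)\<^sup>2 \<le> 157 * (h * real N) ^ 3 * F\<^sup>2 * h ^ 4"
    unfolding H2_norm_h_squared[OF h0] V_def[symmetric] using add_mono[OF add_mono[OF n1 n2] n3] by (simp add: algebra_simps)
qed

section \<open>Fourier modes on the grid\<close>

lemma grid_point_shift: "(\<chi> d. a + (real_of_int ((p + axis i j) $ d) - 1 / 2) * h) = (\<chi> d. a + (real_of_int (p $ d) - 1 / 2) * h) + (real_of_int j * h) *\<^sub>R axis i 1"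
  by (simp add: vec_eq_iff axis_def algebra_simps)

lemma restrict_grid_shift:
  "restrict_grid a b N f (p + axis d j) = f ((\<chi> d. a + (real_of_int (p $ d) - 1 / 2) * mesh a b N) + (real_of_int j * mesh a b N) *\<^sub>R axis d 1)"
  unfolding restrict_grid_def grid_point_shift ..

lemma grid_periodic_restrict_grid:
  assumes "N \<ge> 1" and per: "\<And>x d. f (x + axis d (b - a)) = f x"
  shows "grid_periodic N (restrict_grid a b N f)"
  unfolding grid_periodic_def restrict_grid_shift
  using assms(1) per by (simp add: mesh_def scaleR_axis restrict_grid_def)

text \<open>Moving the grid by one cell along an axis with \<open>k $ d\<close> nonzero multiplies
  every term by the \<open>N\<close>-th root of unity \<open>w\<close> and, by periodicity, permutes
  the terms. As \<open>|k $ d| < N\<close>, \<open>w\<close> differs from 1, so the sum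
  vanishes.\<close>

lemma sum_cells_cis_fourier_phase:
  assumes ab: "a < b" and k: "k \<noteq> 0" "\<And>d. \<bar>k $ d\<bar> < int N"
  shows "(\<Sum>p\<in>cells N. cis (fourier_phase a b k (\<chi> d. a + (real_of_int (p $ d) - 1 / 2) * mesh a b N))) = 0"
proof -
  have N: "N \<ge> 1" using k(2)[of 1] by linarith
  define X where "X p = (\<chi> d. a + (real_of_int (p $ d) - 1 / 2) * mesh a b N)" for p :: "int^3"
  obtain d where d: "k $ d \<noteq> 0" using k(1) by (auto simp: vec_eq_iff)
  define w where "w = cis (2 * pi * of_int (k $ d) / real N)"
  have Xs: "X (p + axis d j) = X p + axis d (real_of_int j * mesh a b N)" for p d j
    unfolding X_def grid_point_shift by (simp add: scaleR_axis)
  have step: "cis (fourier_phase a b k (X (p + axis d 1))) = w * cis (fourier_phase a b k (X p))" for p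
  proof -
    have "2 * pi / (b - a) * of_int (k $ d) * (real_of_int 1 * mesh a b N) = 2 * pi * of_int (k $ d) / real N"
      using ab by (simp add: mesh_def)
    then show ?thesis unfolding Xs fourier_phase_axis cis_mult[symmetric] w_def by (simp add: mult.commute)
  qed
  have per: "cis (fourier_phase a b k (X (p + axis i (int N)))) = cis (fourier_phase a b k (X p))" for p i
    unfolding Xs using cis_fourier_phase_periodic[of a b k "X p" i] ab N by (simp add: mesh_def)
  have "(\<Sum>p\<in>cells N. cis (fourier_phase a b k (X (p + axis d 1)))) = (\<Sum>p\<in>cells N. cis (fourier_phase a b k (X p)))"
  \<comment> \<open>\<open>grid_periodic\<close> is stated for real values, hence the separate shift
    of real and imaginary parts.\<close>
  proof (rule complex_eqI)
    have "grid_periodic N (\<lambda>p. Re (cis (fourier_phase a b k (X p))))" "grid_periodic N (\<lambda>p. Im (cis (fourier_phase a b k (X p))))"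
      unfolding grid_periodic_def per by simp_all
    from this[THEN sum_cells_shift_axis]
    show "Re (\<Sum>p\<in>cells N. cis (fourier_phase a b k (X (p + axis d 1)))) = Re (\<Sum>p\<in>cells N. cis (fourier_phase a b k (X p)))"
      "Im (\<Sum>p\<in>cells N. cis (fourier_phase a b k (X (p + axis d 1)))) = Im (\<Sum>p\<in>cells N. cis (fourier_phase a b k (X p)))"
      by (simp_all only: Re_sum Im_sum)
  qed
  then have "(w - 1) * (\<Sum>p\<in>cells N. cis (fourier_phase a b k (X p))) = 0"
    unfolding step by (simp add: left_diff_distrib flip: sum_distrib_left)
  moreover have "w \<noteq> 1"
  proof
    assume "w = 1"
    then have "cos (2 * pi * of_int (k $ d) / real N) = 1" by (simp add: w_def complex_eq_iff)
    then obtain j :: int where "2 * pi * of_int (k $ d) / real N = of_int j * 2 * pi" using cos_one_2pi_int by auto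
    then have "2 * pi * of_int (k $ d) = 2 * pi * (of_int j * real N)" using N by (simp add: field_simps)
    then have "real_of_int (k $ d) = of_int (j * int N)" by simp
    then have kj: "k $ d = j * int N" by (simp only: of_int_eq_iff)
    then have "j \<noteq> 0" using d by auto
    then have "0 < \<bar>j\<bar>" by simp
    then have "1 \<le> \<bar>j\<bar>" by linarith
    then have "int N \<le> \<bar>j\<bar> * int N" using mult_right_mono[of 1 "\<bar>j\<bar>" "int N"] by simp
    then show False using k(2)[of d] by (simp add: kj abs_mult)
  qed
  ultimately show ?thesis by (simp add: X_def)
qed

text \<open>With \<open>N = 2 K + 1\<close> points per axis no nonzero mode of the projection is
  aliased to a constant, so the grid sum sees the zeroth coefficient only. For the potential this
  matches the normalization in the scheme.\<close>

lemma sum_cells_fourier_proj: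
  assumes ab: "a < b" and N: "N = 2 * K + 1" and zero: "integral (cube a b) f = 0"
  shows "(\<Sum>p\<in>cells N. restrict_grid a b N (fourier_proj a b K f) p) = 0"
proof -
  define I where "I = {k :: int^3. \<forall>d. k $ d \<in> {- int K..int K}}"
  define X where "X p = (\<chi> d. a + (real_of_int (p $ d) - 1 / 2) * mesh a b N)" for p :: "int^3"
  have "(\<Sum>p\<in>cells N. \<Sum>k\<in>I. fourier_coeff a b f k * cis (fourier_phase a b k (X p))) =
      (\<Sum>k\<in>I. fourier_coeff a b f k * (\<Sum>p\<in>cells N. cis (fourier_phase a b k (X p))))"
    by (subst sum.swap) (simp add: sum_distrib_left)
  also have "\<dots> = (\<Sum>k\<in>I. if k = 0 then fourier_coeff a b f 0 * of_nat (N ^ 3) else 0)"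
  proof (rule sum.cong)
    fix k assume k: "k \<in> I"
    show "fourier_coeff a b f k * (\<Sum>p\<in>cells N. cis (fourier_phase a b k (X p))) =
        (if k = 0 then fourier_coeff a b f 0 * of_nat (N ^ 3) else 0)"
    proof (cases "k = 0")
      case True
      then show ?thesis by (simp add: fourier_phase_0 card_cells)
    next
      case False
      have "\<bar>k $ d\<bar> < int N" for d
      proof -
        have "- int K \<le> k $ d \<and> k $ d \<le> int K" using k by (simp add: I_def)
        then show ?thesis unfolding N by linarith
      qed
      then show ?thesis using sum_cells_cis_fourier_phase[OF ab False, of N] False by (simp add: X_def)
    qed
  qed simp
  also have "\<dots> = fourier_coeff a b f 0 * of_nat (N ^ 3)"
    using finite_index_box[of "- int K" "int K"] by (simp add: I_def)
  also have "Re \<dots> = 0"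
  proof -
    have "Re (integral (cube a b) (\<lambda>x. complex_of_real (f x))) = 0"
    \<comment> \<open>A vanishing \<open>integral\<close> may also be the default value for a
      function that is not integrable; the complex integral then defaults to 0 as well.\<close>
    proof (cases "f integrable_on cube a b")
      case True
      then have "((\<lambda>x. complex_of_real (f x)) has_integral of_real (integral (cube a b) f)) (cube a b)"
        by (intro has_integral_of_real integrable_integral)
      then show ?thesis using zero by (simp add: integral_unique)
    next
      case False
      have "\<not> (\<lambda>x. complex_of_real (f x)) integrable_on cube a b"
      proof
        assume "(\<lambda>x. complex_of_real (f x)) integrable_on cube a b"
        from has_integral_Re[OF integrable_integral[OF this]] have "f integrable_on cube a b"
          unfolding Re_complex_of_real integrable_on_def by blast
        with False show False ..
      qed
      then show ?thesis by (simp add: not_integrable_integral)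
    qed
    then show ?thesis by (simp add: fourier_coeff_def fourier_phase_0 complex_eq_iff)
  qed
  finally show ?thesis
    unfolding restrict_grid_def X_def[symmetric] fourier_proj_def I_def[symmetric] Re_sum[symmetric] .
qed

section \<open>Error equations of the scheme and the final estimate\<close>

lemma slotboom_step_flux_form:
  assumes "slotboom_step avg a b N M q \<rho> \<kappa> dt \<psi> c \<psi>' c'" "l \<in> {1..M}"
  shows "(c' l p - c l p) / dt = div_h (mesh a b N) (grid_flux avg (mesh a b N) (\<lambda>p. q l * \<psi> p) (c' l)) p"
  using assms unfolding slotboom_step_def Let_def face_mobility_grad_h by blast

lemma slotboom_solution_periodic:
  assumes sol: "slotboom_solution avg a b N M q \<rho> \<kappa> T dt \<psi>0 c0 \<psi> c"
    and init: "grid_periodic N \<psi>0" "\<And>l. l \<in> {1..M} \<Longrightarrow> grid_periodic N (c0 l)"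
    and n: "real n * dt \<le> T"
  shows "grid_periodic N (\<psi> n)" "\<And>l. l \<in> {1..M} \<Longrightarrow> grid_periodic N (c l n)"
proof -
  have "grid_periodic N (\<psi> n) \<and> (\<forall>l\<in>{1..M}. grid_periodic N (c l n))"
  proof (cases n)
    case 0
    then show ?thesis using sol init by (simp add: slotboom_solution_def)
  next
    case (Suc m)
    then have "slotboom_step avg a b N M q \<rho> \<kappa> dt (\<psi> m) (\<lambda>l. c l m) (\<psi> n) (\<lambda>l. c l n)"
      using sol n unfolding slotboom_solution_def by blast
    then show ?thesis by (simp add: slotboom_step_def Let_def)
  qed
  then show "grid_periodic N (\<psi> n)" "\<And>l. l \<in> {1..M} \<Longrightarrow> grid_periodic N (c l n)" by auto
qed

lemma real_sqrt_le_mult: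
  assumes "x \<le> C * y\<^sup>2" "0 \<le> C" "0 \<le> y"
  shows "sqrt x \<le> sqrt C * (y::real)"
  using real_sqrt_le_mono[OF assms(1)] assms by (simp add: real_sqrt_mult)

text \<open>Stability is applied to the errors \<open>e\<close> and \<open>\<phi>\<close> against
  the restricted exact solution. They differ from the errors in the claim by the projection errors
  \<open>\<eta>c\<close> and \<open>\<eta>\<psi>\<close>, which are small in every norm
  involved.\<close>

lemma slotboom_convergence:
  fixes q :: "nat \<Rightarrow> real"
  assumes ab: "a < b" and \<kappa>: "\<kappa> > 0" and T: "T > 0" and C2: "C2 > 0"
    and \<rho>: "C_spacetime T 8 (\<lambda>t. \<rho>)" "space_periodic (b - a) \<rho>"
    and \<psi>e: "C_spacetime T 8 \<psi>e" and ce: "\<And>l. l \<in> {1..M} \<Longrightarrow> C_spacetime T 8 (ce l)"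
    and pnp: "PNP_solution a b \<kappa> M q \<rho> T cin \<psi>e ce"
  obtains C \<delta> where "C > 0" "\<delta> > 0"
    "\<And>K dt \<psi> c n N h. N = 2 * K + 1 \<Longrightarrow> h = mesh a b N \<Longrightarrow> 0 < dt \<Longrightarrow> dt < \<delta> \<Longrightarrow> h < \<delta> \<Longrightarrow> dt \<le> C2 * h \<Longrightarrow>
      slotboom_solution avg a b N M q (restrict_grid a b N (fourier_proj a b K \<rho>)) \<kappa> T dt
        (restrict_grid a b N (fourier_proj a b K (\<psi>e 0))) (\<lambda>l. restrict_grid a b N (fourier_proj a b K (ce l 0))) \<psi> c \<Longrightarrow>
      real n * dt \<le> T \<Longrightarrow>
      (\<Sum>l=1..M. norm2_h h N (\<lambda>p. restrict_grid a b N (fourier_proj a b K (ce l (real n * dt))) p - c l n p))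
      + sqrt (dt * (\<Sum>l=1..M. \<Sum>k=1..n. (grad_norm2_h h N (\<lambda>p. restrict_grid a b N (fourier_proj a b K (ce l (real k * dt))) p - c l k p))\<^sup>2))
      + H2_norm_h h N (\<lambda>p. restrict_grid a b N (fourier_proj a b K (\<psi>e (real n * dt))) p - \<psi> n p)
      \<le> C * (dt + h\<^sup>2)"
proof -
  define L where "L = b - a"
  have L: "L > 0" using ab by (simp add: L_def)
  have eight: "(8::nat) = Suc (Suc (Suc (Suc 4)))" by simp
  have per\<psi>: "space_periodic L (\<psi>e t)" and perc: "l \<in> {1..M} \<Longrightarrow> space_periodic L (ce l t)" if "t \<in> {0..T}" for t l
    using pnp that by (simp_all add: PNP_solution_def L_def)
  have pde: "((\<lambda>s. ce l s x) has_real_derivative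
       diverg (\<lambda>y. grad (ce l t) y + (q l * ce l t y) *\<^sub>R grad (\<psi>e t) y) x) (at t within {0..T})"
    if "t \<in> {0..T}" "l \<in> {1..M}" for t l x
    using pnp that unfolding PNP_solution_def by blast
  have poisson: "- \<kappa> * laplacian (\<psi>e t) x = (\<Sum>l=1..M. q l * ce l t x) + \<rho> x" if "t \<in> {0..T}" for t x
    using pnp that unfolding PNP_solution_def by blast
  have mean: "integral (cube a b) (\<psi>e t) = 0" if "t \<in> {0..T}" for t
    using pnp that unfolding PNP_solution_def by blast

  have four: "\<exists>F\<ge>0. \<forall>t\<in>{0..T}. \<forall>K\<ge>1. \<forall>x. \<bar>f t x - fourier_proj a b K (f t) x\<bar> \<le> F / real K ^ 4"
    if "C_spacetime T 8 f" "\<And>t. t \<in> {0..T} \<Longrightarrow> space_periodic L (f t)" for f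
    using fourier_proj_error[OF ab that(1)] that(2) unfolding L_def by metis
  obtain F\<psi> where F\<psi>: "F\<psi> \<ge> 0" "\<And>t K x. t \<in> {0..T} \<Longrightarrow> K \<ge> 1 \<Longrightarrow> \<bar>\<psi>e t x - fourier_proj a b K (\<psi>e t) x\<bar> \<le> F\<psi> / real K ^ 4"
    using four[OF \<psi>e per\<psi>] by blast
  obtain F\<rho> where F\<rho>: "F\<rho> \<ge> 0" "\<And>t K x. t \<in> {0..T} \<Longrightarrow> K \<ge> 1 \<Longrightarrow> \<bar>\<rho> x - fourier_proj a b K \<rho> x\<bar> \<le> F\<rho> / real K ^ 4"
    using four[OF \<rho>(1)] \<rho>(2) unfolding L_def by blast
  have "\<forall>l\<in>{1..M}. \<exists>F\<ge>0. \<forall>t\<in>{0..T}. \<forall>K\<ge>1. \<forall>x. \<bar>ce l t x - fourier_proj a b K (ce l t) x\<bar> \<le> F / real K ^ 4"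
    using four[OF ce perc] by blast
  then obtain Fc where Fc: "\<And>l. l \<in> {1..M} \<Longrightarrow> Fc l \<ge> 0"
    "\<And>l t K x. l \<in> {1..M} \<Longrightarrow> t \<in> {0..T} \<Longrightarrow> K \<ge> 1 \<Longrightarrow> \<bar>ce l t x - fourier_proj a b K (ce l t) x\<bar> \<le> Fc l / real K ^ 4"
    by metis
  \<comment> \<open>From \<open>h * (2 K + 1) = L\<close> and \<open>2 K + 1 <= 3 K\<close> follows
    \<open>1 / K <= 3 / L * h\<close>; the fourth power of this factor turns the projection errors
    into \<open>F * h^4\<close>.\<close>
  define F where "F = (F\<psi> + F\<rho> + (\<Sum>l=1..M. Fc l)) * (3 / L) ^ 4"
  have sumFc: "(\<Sum>l=1..M. Fc l) \<ge> 0" "\<And>l. l \<in> {1..M} \<Longrightarrow> Fc l \<le> (\<Sum>l=1..M. Fc l)"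
    using Fc(1) by (auto intro!: sum_nonneg member_le_sum)
  have F0: "F \<ge> 0" using F\<psi>(1) F\<rho>(1) sumFc L by (simp add: F_def)

  have reg: "\<exists>B\<ge>0. \<forall>t\<in>{0..T}. \<forall>x. \<bar>f t x\<bar> \<le> B \<and> (\<forall>d. \<forall>h\<ge>0. \<bar>f t (x + h *\<^sub>R axis d 1) - f t x\<bar> \<le> B * h)"
    if f: "C_spacetime T 8 f" "\<And>t. t \<in> {0..T} \<Longrightarrow> space_periodic L (f t)" for f
  proof -
    obtain f1 f2 B where "line_regular T f f1 f2 B"
      using C_spacetime_line_regular[OF L f(1)[unfolded eight] f(2)] by metis
    from line_regularD(1,4,7)[OF this] show ?thesis by (intro exI[of _ B]) auto
  qed
  obtain B\<psi> where B\<psi>: "B\<psi> \<ge> 0" "\<And>t x d h. t \<in> {0..T} \<Longrightarrow> h \<ge> 0 \<Longrightarrow> \<bar>\<psi>e t (x + h *\<^sub>R axis d 1) - \<psi>e t x\<bar> \<le> B\<psi> * h"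
    using reg[OF \<psi>e per\<psi>] by metis
  have "\<forall>l\<in>{1..M}. \<exists>B\<ge>0. \<forall>t\<in>{0..T}. \<forall>x. \<bar>ce l t x\<bar> \<le> B \<and> (\<forall>d. \<forall>h\<ge>0. \<bar>ce l t (x + h *\<^sub>R axis d 1) - ce l t x\<bar> \<le> B * h)"
    using reg[OF ce perc] by blast
  from bchoice[OF this] obtain Bc where
    Bc_all: "\<forall>l\<in>{1..M}. Bc l \<ge> 0 \<and> (\<forall>t\<in>{0..T}. \<forall>x. \<bar>ce l t x\<bar> \<le> Bc l \<and> (\<forall>d. \<forall>h\<ge>0. \<bar>ce l t (x + h *\<^sub>R axis d 1) - ce l t x\<bar> \<le> Bc l * h))" ..
  then have Bc: "\<And>l. l \<in> {1..M} \<Longrightarrow> Bc l \<ge> 0"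
    "\<And>l t x. l \<in> {1..M} \<Longrightarrow> t \<in> {0..T} \<Longrightarrow> \<bar>ce l t x\<bar> \<le> Bc l"
    "\<And>l t x d h. l \<in> {1..M} \<Longrightarrow> t \<in> {0..T} \<Longrightarrow> h \<ge> 0 \<Longrightarrow> \<bar>ce l t (x + h *\<^sub>R axis d 1) - ce l t x\<bar> \<le> Bc l * h"
    by blast+
  have sumBc: "(\<Sum>l=1..M. Bc l) \<ge> 0" "\<And>l. l \<in> {1..M} \<Longrightarrow> Bc l \<le> (\<Sum>l=1..M. Bc l)"
    using Bc(1) by (auto intro!: sum_nonneg member_le_sum)

  define residual where "residual l h dt t x = (ce l (t + dt) x - ce l t x) / dt - (\<Sum>d\<in>UNIV.
         (weighted_jump avg (q l * \<psi>e t (x + h *\<^sub>R axis d 1) - q l * \<psi>e t x) (ce l (t + dt) x) (ce l (t + dt) (x + h *\<^sub>R axis d 1))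
         + weighted_jump avg (q l * \<psi>e t (x + (- h) *\<^sub>R axis d 1) - q l * \<psi>e t x) (ce l (t + dt) x) (ce l (t + dt) (x + (- h) *\<^sub>R axis d 1))) / h\<^sup>2)"
    for l h dt t x
  have "\<exists>C h0. C \<ge> 0 \<and> h0 > 0 \<and> (\<forall>h dt t x. 0 < h \<longrightarrow> h \<le> h0 \<longrightarrow> 0 < dt \<longrightarrow> 0 \<le> t \<longrightarrow> t + dt \<le> T \<longrightarrow>
      \<bar>residual l h dt t x\<bar> \<le> C * (dt + h\<^sup>2))" if l: "l \<in> {1..M}" for l
  proof (rule nernst_planck_consistency[OF T L ce[OF l, unfolded eight] perc[OF _ l] \<psi>e[unfolded eight] per\<psi> pde[OF _ l], of avg, folded residual_def])
    fix C h0 :: real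
    assume "0 \<le> C" "0 < h0" and est: "\<And>h dt t x. 0 < h \<Longrightarrow> h \<le> h0 \<Longrightarrow> 0 < dt \<Longrightarrow> 0 \<le> t \<Longrightarrow> t + dt \<le> T \<Longrightarrow>
      \<bar>residual l h dt t x\<bar> \<le> C * (dt + h\<^sup>2)"
    then show ?thesis by (intro exI[of _ C] exI[of _ h0] conjI allI impI est)
  qed
  then have "\<forall>l\<in>{1..M}. \<exists>C h0. C \<ge> 0 \<and> h0 > 0 \<and> (\<forall>h dt t x. 0 < h \<longrightarrow> h \<le> h0 \<longrightarrow> 0 < dt \<longrightarrow> 0 \<le> t \<longrightarrow> t + dt \<le> T \<longrightarrow>
      \<bar>residual l h dt t x\<bar> \<le> C * (dt + h\<^sup>2))" by blast
  from bchoice[OF this] obtain Cn where "\<forall>l\<in>{1..M}. \<exists>h0. Cn l \<ge> 0 \<and> h0 > 0 \<and> (\<forall>h dt t x. 0 < h \<longrightarrow> h \<le> h0 \<longrightarrow> 0 < dt \<longrightarrow> 0 \<le> t \<longrightarrow> t + dt \<le> T \<longrightarrow>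
      \<bar>residual l h dt t x\<bar> \<le> Cn l * (dt + h\<^sup>2))" ..
  from bchoice[OF this] obtain hn where "\<forall>l\<in>{1..M}. Cn l \<ge> 0 \<and> hn l > 0 \<and> (\<forall>h dt t x. 0 < h \<longrightarrow> h \<le> hn l \<longrightarrow> 0 < dt \<longrightarrow> 0 \<le> t \<longrightarrow> t + dt \<le> T \<longrightarrow>
      \<bar>residual l h dt t x\<bar> \<le> Cn l * (dt + h\<^sup>2))" ..
  then have Cn: "\<And>l. l \<in> {1..M} \<Longrightarrow> Cn l \<ge> 0" "\<And>l. l \<in> {1..M} \<Longrightarrow> hn l > 0"
    "\<And>l h dt t x. l \<in> {1..M} \<Longrightarrow> 0 < h \<Longrightarrow> h \<le> hn l \<Longrightarrow> 0 < dt \<Longrightarrow> 0 \<le> t \<Longrightarrow> t + dt \<le> T \<Longrightarrow>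
      \<bar>residual l h dt t x\<bar> \<le> Cn l * (dt + h\<^sup>2)"
    by blast+
  have sumCn: "(\<Sum>l=1..M. Cn l) \<ge> 0" "\<And>l. l \<in> {1..M} \<Longrightarrow> Cn l \<le> (\<Sum>l=1..M. Cn l)"
    using Cn(1) by (auto intro!: sum_nonneg member_le_sum)
  \<comment> \<open>Inserting 1 keeps the set nonempty for every \<open>M\<close> and bounds
    \<open>h0\<close> by 1.\<close>
  define h0 where "h0 = Min (insert 1 (hn ` {1..M}))"
  have h0: "h0 > 0" "h0 \<le> 1" "\<And>l. l \<in> {1..M} \<Longrightarrow> h0 \<le> hn l"
  proof -
    show "h0 > 0" unfolding h0_def by (subst Min_gr_iff) (use Cn(2) in auto)
    show "h0 \<le> 1" unfolding h0_def by (rule Min_le) auto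
    show "h0 \<le> hn l" if "l \<in> {1..M}" for l unfolding h0_def by (rule Min_le) (use that in auto)
  qed
  define lap_residual where "lap_residual h t x =
    (\<Sum>d\<in>UNIV. (\<psi>e t (x + h *\<^sub>R axis d 1) + \<psi>e t (x + (- h) *\<^sub>R axis d 1) - 2 * \<psi>e t x) / h\<^sup>2) - laplacian (\<psi>e t) x" for h t x
  have "\<exists>C. C \<ge> 0 \<and> (\<forall>h t x. 0 < h \<longrightarrow> t \<in> {0..T} \<longrightarrow> \<bar>lap_residual h t x\<bar> \<le> C * h\<^sup>2)"
  proof (rule poisson_consistency[OF L \<psi>e[unfolded eight] per\<psi>, folded lap_residual_def])
    fix C :: real assume "0 \<le> C" and est: "\<And>h t x. 0 < h \<Longrightarrow> t \<in> {0..T} \<Longrightarrow> \<bar>lap_residual h t x\<bar> \<le> C * h\<^sup>2"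
    then show ?thesis by (intro exI[of _ C] conjI allI impI est)
  qed
  then obtain Cp where Cp: "Cp \<ge> 0" "\<And>h t x. 0 < h \<Longrightarrow> t \<in> {0..T} \<Longrightarrow> \<bar>lap_residual h t x\<bar> \<le> Cp * h\<^sup>2"
    by blast

  define Q where "Q = (\<Sum>l=1..M. \<bar>q l\<bar>)"
  have Q0: "Q \<ge> 0" by (simp add: Q_def sum_nonneg)
  \<comment> \<open>The summands serve the conditions of \<open>scheme_errors\<close>: smoothness of
    the exact solution, consistency of the two equations, and the projection errors, where
    \<open>12 * \<kappa> + Q\<close> stems from the initial Poisson residual, 1 from the charge
    density and the initial concentrations, and \<open>L ^ 3\<close> from the mean of the
    potential.\<close>
  define B where "B = B\<psi> + (\<Sum>l=1..M. Bc l) + (\<Sum>l=1..M. Cn l) + \<kappa> * Cp + F * (12 * \<kappa> + Q + 1 + L ^ 3)"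
  have FB: "0 \<le> F * (12 * \<kappa> + Q)" "0 \<le> F" "0 \<le> F * L ^ 3" "F * (12 * \<kappa> + Q + 1 + L ^ 3) = F * (12 * \<kappa> + Q) + F + F * L ^ 3" "0 \<le> \<kappa> * Cp"
    using F0 \<kappa> Q0 L Cp(1) by (simp_all add: algebra_simps)
  have B: "B \<ge> 0" "B\<psi> \<le> B" "(\<Sum>l=1..M. Bc l) \<le> B" "(\<Sum>l=1..M. Cn l) \<le> B" "\<kappa> * Cp + F \<le> B" "F * (12 * \<kappa> + Q) \<le> B" "F \<le> B" "F * L ^ 3 \<le> B"
    unfolding B_def FB(4) using FB(1-3,5) B\<psi>(1) sumBc(1) sumCn(1) by linarith+
  have "\<exists>Cs \<delta>0. Cs > 0 \<and> \<delta>0 > 0 \<and> (\<forall>h N dt e \<phi> C \<Psi> n. 0 < h \<longrightarrow> h \<le> \<delta>0 \<longrightarrow> h * real N = L \<longrightarrow> 0 < dt \<longrightarrow> dt \<le> \<delta>0 \<longrightarrow> dt \<le> C2 * h \<longrightarrow>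
      scheme_errors avg \<kappa> M q T B N h dt e \<phi> C \<Psi> \<longrightarrow> real n * dt \<le> T \<longrightarrow>
      (\<Sum>l=1..M. (norm2_h h N (e l n))\<^sup>2) + dt / 2 * (\<Sum>k=1..n. \<Sum>l=1..M. (grad_norm2_h h N (e l k))\<^sup>2) \<le> (Cs * (dt + h\<^sup>2))\<^sup>2 \<and>
      H2_norm_h h N (\<phi> n) \<le> Cs * (dt + h\<^sup>2))"
    (is "\<exists>Cs \<delta>0. _ \<and> _ \<and> (\<forall>h N dt e \<phi> C \<Psi> n. ?P Cs \<delta>0 h N dt e \<phi> C \<Psi> n)")
  proof (rule scheme_stability[OF L \<kappa> T C2 B(1), of avg M q])
    fix Cs \<delta>0 :: real
    assume "Cs > 0" "\<delta>0 > 0" and est: "\<And>h N dt e \<phi> C \<Psi> n. 0 < h \<Longrightarrow> h \<le> \<delta>0 \<Longrightarrow> h * real N = L \<Longrightarrow> 0 < dt \<Longrightarrow> dt \<le> \<delta>0 \<Longrightarrow> dt \<le> C2 * h \<Longrightarrow>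
      scheme_errors avg \<kappa> M q T B N h dt e \<phi> C \<Psi> \<Longrightarrow> real n * dt \<le> T \<Longrightarrow>
      (\<Sum>l=1..M. (norm2_h h N (e l n))\<^sup>2) + dt / 2 * (\<Sum>k=1..n. \<Sum>l=1..M. (grad_norm2_h h N (e l k))\<^sup>2) \<le> (Cs * (dt + h\<^sup>2))\<^sup>2 \<and>
      H2_norm_h h N (\<phi> n) \<le> Cs * (dt + h\<^sup>2)"
    have "?P Cs \<delta>0 h N dt e \<phi> C \<Psi> n" for h N dt e \<phi> C \<Psi> n
      by (intro impI est)
    with \<open>Cs > 0\<close> \<open>\<delta>0 > 0\<close> show ?thesis by blast
  qed
  then obtain Cs \<delta>0 where Cs: "Cs > 0" "\<delta>0 > 0"
    "\<And>h N dt e \<phi> C \<Psi> n. 0 < h \<Longrightarrow> h \<le> \<delta>0 \<Longrightarrow> h * real N = L \<Longrightarrow> 0 < dt \<Longrightarrow> dt \<le> \<delta>0 \<Longrightarrow> dt \<le> C2 * h \<Longrightarrow>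
      scheme_errors avg \<kappa> M q T B N h dt e \<phi> C \<Psi> \<Longrightarrow> real n * dt \<le> T \<Longrightarrow>
      (\<Sum>l=1..M. (norm2_h h N (e l n))\<^sup>2) + dt / 2 * (\<Sum>k=1..n. \<Sum>l=1..M. (grad_norm2_h h N (e l k))\<^sup>2) \<le> (Cs * (dt + h\<^sup>2))\<^sup>2 \<and>
      H2_norm_h h N (\<phi> n) \<le> Cs * (dt + h\<^sup>2)"
    by blast
  \<comment> \<open>The last entry excludes \<open>K = 0\<close>, where \<open>h = L\<close> and the
    projection estimate says nothing.\<close>
  define \<delta> where "\<delta> = min \<delta>0 (min h0 (L / 2))"
  have \<delta>: "\<delta> > 0" "\<delta> \<le> \<delta>0" "\<delta> \<le> h0" "\<delta> \<le> L / 2" using Cs(2) h0 L by (auto simp: \<delta>_def)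
  define V where "V = L ^ 3 * F\<^sup>2"
  have V: "V \<ge> 0" using L by (simp add: V_def)
  \<comment> \<open>314 = 2 * 157 and 24 = 2 * 12 double constants of
    \<open>small_grid_function\<close>. In \<open>4 * Cs^2\<close> one factor 2 undoes the weight
    \<open>dt / 2\<close> of the dissipation and the other comes from squaring a sum.\<close>
  define Cf where "Cf = real M * sqrt (2 * Cs\<^sup>2 + 314 * V) + sqrt (4 * Cs\<^sup>2 + 24 * T * real M * V) + sqrt (2 * Cs\<^sup>2 + 314 * V) + 1"
  have Cf: "Cf > 0" unfolding Cf_def using V T Cs(1) by (intro add_nonneg_pos add_nonneg_nonneg mult_nonneg_nonneg) auto
  show ?thesis
  proof (rule that[OF Cf \<delta>(1)])
    fix K dt \<psi> c n N h
    assume N: "N = 2 * K + 1" and h_def: "h = mesh a b N" and dt: "0 < dt" "dt < \<delta>" and h\<delta>: "h < \<delta>" and dth: "dt \<le> C2 * h"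
      and sol: "slotboom_solution avg a b N M q (restrict_grid a b N (fourier_proj a b K \<rho>)) \<kappa> T dt
        (restrict_grid a b N (fourier_proj a b K (\<psi>e 0))) (\<lambda>l. restrict_grid a b N (fourier_proj a b K (ce l 0))) \<psi> c"
      and nT: "real n * dt \<le> T"
    have N1: "N \<ge> 1" by (simp add: N)
    have hN: "h * real N = L" using N1 by (simp add: h_def mesh_def L_def)
    have h: "h > 0" using ab N1 by (simp add: h_def mesh_def)
    have h1: "h \<le> 1" using h\<delta> \<delta> h0 by linarith
    have hnn: "h \<ge> 0" using h by simp
    have K1: "K \<ge> 1"
    proof (rule ccontr)
      assume "\<not> K \<ge> 1"
      then have "K = 0" by simp
      then have "h = L" using hN N by simp
      then show False using h\<delta> \<delta>(4) L by simp
    qed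
    define \<epsilon> where "\<epsilon> = dt + h\<^sup>2"
    have \<epsilon>: "\<epsilon> > 0" "h\<^sup>2 \<le> \<epsilon>" using dt by (simp_all add: \<epsilon>_def add_pos_nonneg)
    have h4: "h ^ 4 \<le> h\<^sup>2" using h h1 by (intro power_decreasing) auto
    have time: "real n * dt \<in> {0..T}" if "real n * dt \<le> T" for n using that dt by simp
    have four_le: "F' / real K ^ 4 \<le> F * h ^ 4" if "F' \<le> F\<psi> + F\<rho> + (\<Sum>l=1..M. Fc l)" for F'
    proof -
      have "1 / real K \<le> 3 / L * h"
      proof -
        have "L = h * (2 * real K + 1)" using hN by (simp add: N add.commute)
        also have "\<dots> \<le> h * (3 * real K)" using K1 hnn by (intro mult_left_mono) auto
        finally have "L \<le> 3 * h * real K" by simp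
        then show ?thesis using K1 L by (simp add: field_simps)
      qed
      then have "(1 / real K) ^ 4 \<le> (3 / L * h) ^ 4" by (intro power_mono) auto
      then have "F' * (1 / real K) ^ 4 \<le> (F\<psi> + F\<rho> + (\<Sum>l=1..M. Fc l)) * (3 / L * h) ^ 4"
        using that F\<psi>(1) F\<rho>(1) sumFc(1) by (intro mult_mono) auto
      moreover have "F' / real K ^ 4 = F' * (1 / real K) ^ 4" by (simp add: power_divide)
      ultimately show ?thesis by (simp only: F_def power_mult_distrib mult.assoc)
    qed
    have err\<psi>: "\<bar>\<psi>e t x - fourier_proj a b K (\<psi>e t) x\<bar> \<le> F * h ^ 4" if "t \<in> {0..T}" for t x
      using F\<psi>(2)[OF that K1, of x] four_le[of F\<psi>] F\<rho>(1) sumFc(1) by linarith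
    have err\<rho>: "\<bar>\<rho> x - fourier_proj a b K \<rho> x\<bar> \<le> F * h ^ 4" for x
      using F\<rho>(2)[OF _ K1, of 0 x] four_le[of F\<rho>] F\<psi>(1) sumFc(1) T by simp
    have errc: "\<bar>ce l t x - fourier_proj a b K (ce l t) x\<bar> \<le> F * h ^ 4" if "l \<in> {1..M}" "t \<in> {0..T}" for l t x
      using Fc(2)[OF that K1, of x] four_le[of "Fc l"] F\<psi>(1) F\<rho>(1) sumFc(2)[OF that(1)] by linarith

    define X where "X p = (\<chi> d. a + (real_of_int (p $ d) - 1 / 2) * h)" for p :: "int^3"
    have R: "restrict_grid a b N f p = f (X p)" for f p
      by (simp add: restrict_grid_def X_def h_def)
    have Xp: "X (p + axis d 1) = X p + h *\<^sub>R axis d 1" and Xm: "X (p - axis d 1) = X p + (- h) *\<^sub>R axis d 1" for p d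
      by (simp_all add: X_def vec_eq_iff axis_def algebra_simps)
    define Cg where "Cg l n p = ce l (real n * dt) (X p)" for l n p
    define \<Psi> where "\<Psi> n p = \<psi>e (real n * dt) (X p)" for n p
    define e where "e l n p = Cg l n p - c l n p" for l n p
    define \<phi> where "\<phi> n p = \<Psi> n p - \<psi> n p" for n p
    define \<eta>c where "\<eta>c l n p = Cg l n p - fourier_proj a b K (ce l (real n * dt)) (X p)" for l n p
    define \<eta>\<psi> where "\<eta>\<psi> n p = \<Psi> n p - fourier_proj a b K (\<psi>e (real n * dt)) (X p)" for n p
    have \<eta>c: "\<bar>\<eta>c l n p\<bar> \<le> F * h ^ 4" if "l \<in> {1..M}" "real n * dt \<le> T" for l n p
      unfolding \<eta>c_def Cg_def by (rule errc[OF that(1) time[OF that(2)]])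
    have \<eta>\<psi>: "\<bar>\<eta>\<psi> n p\<bar> \<le> F * h ^ 4" if "real n * dt \<le> T" for n p
      unfolding \<eta>\<psi>_def \<Psi>_def by (rule err\<psi>[OF time[OF that]])
    have init: "\<phi> 0 = \<eta>\<psi> 0" "l \<in> {1..M} \<Longrightarrow> e l 0 = \<eta>c l 0" for l
      using sol by (auto simp: slotboom_solution_def \<phi>_def \<eta>\<psi>_def e_def \<eta>c_def R fun_eq_iff)
    have step: "slotboom_step avg a b N M q (restrict_grid a b N (fourier_proj a b K \<rho>)) \<kappa> dt (\<psi> n) (\<lambda>l. c l n) (\<psi> (Suc n)) (\<lambda>l. c l (Suc n))"
      if "real (Suc n) * dt \<le> T" for n
      using sol that unfolding slotboom_solution_def by blast
    have fper: "grid_periodic N (restrict_grid a b N (fourier_proj a b K f))" for f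
      by (rule grid_periodic_restrict_grid[OF N1]) (use ab in \<open>simp add: fourier_proj_def cis_fourier_phase_periodic\<close>)
    have gper: "grid_periodic N (\<lambda>p. f (X p))" if "space_periodic L f" for f
    proof -
      have "grid_periodic N (restrict_grid a b N f)"
        by (rule grid_periodic_restrict_grid[OF N1]) (use that in \<open>simp add: space_periodic_def L_def\<close>)
      then show ?thesis by (simp only: R[abs_def])
    qed
    have sum\<psi>: "(\<Sum>p\<in>cells N. fourier_proj a b K (\<psi>e t) (X p)) = 0" if "t \<in> {0..T}" for t
      using sum_cells_fourier_proj[OF ab N mean[OF that]] by (simp add: R)

    have S: "scheme_errors avg \<kappa> M q T B N h dt e \<phi> Cg \<Psi>"
      unfolding scheme_errors_def \<epsilon>_def[symmetric]
    proof (intro conjI allI impI ballI)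
      fix n assume n: "real n * dt \<le> T"
      note t = time[OF n]
      note sper = slotboom_solution_periodic[OF sol fper fper n]
      show per\<Psi>: "grid_periodic N (\<Psi> n)" unfolding \<Psi>_def by (rule gper[OF per\<psi>[OF t]])
      show "grid_periodic N (\<phi> n)" unfolding \<phi>_def by (rule grid_periodic_comp2[OF per\<Psi> sper(1)])
      fix l assume l: "l \<in> {1..M}"
      show perCg: "grid_periodic N (Cg l n)" unfolding Cg_def by (rule gper[OF perc[OF t l]])
      show "grid_periodic N (e l n)" unfolding e_def by (rule grid_periodic_comp2[OF perCg sper(2)[OF l]])
    next
      fix n p assume n: "real n * dt \<le> T"
      note t = time[OF n]
      show "\<bar>- \<kappa> * lap_h h (\<phi> n) p - (\<Sum>l=1..M. q l * e l n p)\<bar> \<le> B * \<epsilon>"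
      \<comment> \<open>At the initial time the numerical potential is projected data and not the
        solution of a discrete Poisson equation; the residual there consists of projection errors
        only.\<close>
      proof (cases n)
        case 0
        have "\<bar>lap_h h (\<phi> 0) p\<bar> \<le> 12 * F * h\<^sup>2"
          unfolding init(1) using n 0 by (intro small_grid_function(2)[OF h h1] \<eta>\<psi>) simp
        then have 1: "\<bar>- \<kappa> * lap_h h (\<phi> 0) p\<bar> \<le> \<kappa> * (12 * F * h\<^sup>2)" using \<kappa> by (simp add: abs_mult)
        have "\<bar>\<Sum>l=1..M. q l * e l 0 p\<bar> \<le> (\<Sum>l=1..M. \<bar>q l\<bar> * (F * h\<^sup>2))"
        proof (rule order_trans[OF sum_abs sum_mono])
          fix l assume l: "l \<in> {1..M}"
          have "\<bar>e l 0 p\<bar> \<le> F * h ^ 4" unfolding init(2)[OF l] using n 0 by (intro \<eta>c[OF l]) simp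
          also have "\<dots> \<le> F * h\<^sup>2" using h4 F0 by (rule mult_left_mono)
          finally show "\<bar>q l * e l 0 p\<bar> \<le> \<bar>q l\<bar> * (F * h\<^sup>2)" by (simp add: abs_mult mult_left_mono)
        qed
        also have "\<dots> = Q * (F * h\<^sup>2)" by (simp add: Q_def sum_distrib_right)
        finally have "\<bar>- \<kappa> * lap_h h (\<phi> 0) p - (\<Sum>l=1..M. q l * e l 0 p)\<bar> \<le> \<kappa> * (12 * F * h\<^sup>2) + Q * (F * h\<^sup>2)"
          using 1 by (rule order_trans[OF abs_triangle_ineq4 add_mono[rotated]])
        also have "\<dots> = F * (12 * \<kappa> + Q) * h\<^sup>2" by (simp add: algebra_simps)
        also have "\<dots> \<le> B * \<epsilon>" using B(1,6) \<epsilon> by (intro mult_mono) auto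
        finally show ?thesis by (simp add: 0)
      next
        case (Suc m)
        have st: "- \<kappa> * lap_h h (\<psi> n) p = (\<Sum>l=1..M. q l * c l n p) + fourier_proj a b K \<rho> (X p)"
          using step[of m] n Suc unfolding slotboom_step_def Let_def h_def[symmetric] R by blast
        have lap\<Psi>: "\<bar>lap_h h (\<Psi> n) p - laplacian (\<psi>e (real n * dt)) (X p)\<bar> \<le> Cp * h\<^sup>2"
          using Cp(2)[OF h t, of "X p"] unfolding lap_residual_def lap_h_eq \<Psi>_def Xp Xm .
        have "\<phi> n = (\<lambda>p. \<Psi> n p - \<psi> n p)" by (simp add: \<phi>_def fun_eq_iff)
        then have "- \<kappa> * lap_h h (\<phi> n) p - (\<Sum>l=1..M. q l * e l n p) =
          - \<kappa> * (lap_h h (\<Psi> n) p - laplacian (\<psi>e (real n * dt)) (X p)) + (\<rho> (X p) - fourier_proj a b K \<rho> (X p))"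
          using st poisson[OF t, of "X p"]
          by (simp add: lap_h_diff e_def Cg_def right_diff_distrib sum_subtractf algebra_simps)
        also have "\<bar>\<dots>\<bar> \<le> \<kappa> * (Cp * h\<^sup>2) + F * h ^ 4"
        proof (rule order_trans[OF abs_triangle_ineq add_mono[OF _ err\<rho>]])
          show "\<bar>- \<kappa> * (lap_h h (\<Psi> n) p - laplacian (\<psi>e (real n * dt)) (X p))\<bar> \<le> \<kappa> * (Cp * h\<^sup>2)"
            using lap\<Psi> \<kappa> by (simp add: abs_mult)
        qed
        also have "\<dots> \<le> \<kappa> * (Cp * h\<^sup>2) + F * h\<^sup>2" using h4 F0 by (intro add_left_mono mult_left_mono)
        also have "\<dots> = (\<kappa> * Cp + F) * h\<^sup>2" by (simp add: algebra_simps)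
        also have "\<dots> \<le> B * \<epsilon>" using B(1,5) \<epsilon> by (intro mult_mono) auto
        finally show ?thesis .
      qed
    next
      fix n assume n: "real n * dt \<le> T"
      have "(\<Sum>p\<in>cells N. \<phi> n p) = (\<Sum>p\<in>cells N. \<eta>\<psi> n p)"
      \<comment> \<open>For \<open>n >= 1\<close> the scheme normalizes its potential, and the
        projected exact potential has grid sum 0 as well; at the initial time \<open>\<phi>\<close>
        is itself the projection error.\<close>
      proof (cases n)
        case 0
        then show ?thesis by (simp add: init)
      next
        case (Suc m)
        have "grid_mean a b N (\<psi> n) = 0" using step[of m] n Suc unfolding slotboom_step_def Let_def by blast
        then have "(\<Sum>p\<in>cells N. \<psi> n p) = 0" using h ab by (simp add: grid_mean_def flip: h_def)
        then show ?thesis using sum\<psi>[OF time[OF n]] by (simp add: \<phi>_def \<eta>\<psi>_def sum_subtractf)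
      qed
      also have "\<bar>\<dots>\<bar> \<le> (\<Sum>p\<in>cells N. F * h ^ 4)" using \<eta>\<psi>[OF n] by (intro sum_abs[THEN order_trans] sum_mono)
      also have "\<dots> = real N ^ 3 * (F * h ^ 4)" by (simp add: card_cells)
      finally have "h ^ 3 * \<bar>\<Sum>p\<in>cells N. \<phi> n p\<bar> \<le> h ^ 3 * (real N ^ 3 * (F * h ^ 4))" using hnn by (intro mult_left_mono) auto
      also have "\<dots> = F * L ^ 3 * h ^ 4" by (simp add: hN[symmetric] power_mult_distrib)
      also have "\<dots> \<le> B * \<epsilon>" using B(1,8) \<epsilon> h4 F0 L by (intro mult_mono) auto
      finally show "\<bar>h ^ 3 * (\<Sum>p\<in>cells N. \<phi> n p)\<bar> \<le> B * \<epsilon>" using hnn by (simp add: abs_mult)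
    next
      fix n l p assume n: "real n * dt \<le> T" and l: "l \<in> {1..M}"
      note t = time[OF n]
      show "\<bar>Cg l n p\<bar> \<le> B" using Bc(2)[OF l t, of "X p"] sumBc(2)[OF l] B(3) by (simp add: Cg_def)
      fix d
      have "\<bar>grad_h h (Cg l n) d p\<bar> = \<bar>ce l (real n * dt) (X p + h *\<^sub>R axis d 1) - ce l (real n * dt) (X p)\<bar> / h"
        using h by (simp add: grad_h_def Cg_def Xp)
      also have "\<dots> \<le> Bc l * h / h" using Bc(3)[OF l t hnn] hnn by (intro divide_right_mono)
      also have "\<dots> \<le> B" using h sumBc(2)[OF l] B(3) by simp
      finally show "\<bar>grad_h h (Cg l n) d p\<bar> \<le> B" .
    next
      fix n d p assume n: "real n * dt \<le> T"
      note t = time[OF n]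
      have "\<bar>grad_h h (\<Psi> n) d p\<bar> = \<bar>\<psi>e (real n * dt) (X p + h *\<^sub>R axis d 1) - \<psi>e (real n * dt) (X p)\<bar> / h"
        using h by (simp add: grad_h_def \<Psi>_def Xp)
      also have "\<dots> \<le> B\<psi> * h / h" using B\<psi>(2)[OF t hnn] hnn by (intro divide_right_mono)
      also have "\<dots> \<le> B" using h B(2) by simp
      finally show "\<bar>grad_h h (\<Psi> n) d p\<bar> \<le> B" .
    next
      fix l p assume l: "l \<in> {1..M}"
      have "\<bar>e l 0 p\<bar> \<le> F * h ^ 4" unfolding init(2)[OF l] using T by (intro \<eta>c[OF l]) simp
      also have "\<dots> \<le> B * \<epsilon>" using B(1,7) \<epsilon> h4 by (intro mult_mono) auto
      finally show "\<bar>e l 0 p\<bar> \<le> B * \<epsilon>" .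
    next
      fix n l p assume n: "real (Suc n) * dt \<le> T" and l: "l \<in> {1..M}"
      have suc: "real (Suc n) * dt = real n * dt + dt" by (simp add: algebra_simps)
      have "(Cg l (Suc n) p - Cg l n p) / dt - div_h h (grid_flux avg h (\<lambda>p. q l * \<Psi> n p) (Cg l (Suc n))) p = residual l h dt (real n * dt) (X p)"
        unfolding div_h_grid_flux residual_def Cg_def \<Psi>_def suc Xp Xm ..
      moreover have "(c l (Suc n) p - c l n p) / dt = div_h h (grid_flux avg h (\<lambda>p. q l * \<psi> n p) (c l (Suc n))) p"
        using slotboom_step_flux_form[OF step[OF n] l] by (simp only: h_def)
      \<comment> \<open>\<open>\<Psi> - \<phi>\<close> and \<open>Cg - e\<close> are the numerical
        solution, whose flux divergence cancels its time difference, so only the consistency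
        residual of the exact solution is left.\<close>
      ultimately have eq: "(e l (Suc n) p - e l n p) / dt - div_h h (\<lambda>d r.
          grid_flux avg h (\<lambda>p. q l * \<Psi> n p) (Cg l (Suc n)) d r
          - grid_flux avg h (\<lambda>p. q l * (\<Psi> n p - \<phi> n p)) (\<lambda>p. Cg l (Suc n) p - e l (Suc n) p) d r) p = residual l h dt (real n * dt) (X p)"
        unfolding div_h_diff e_def \<phi>_def by (simp add: diff_divide_distrib)
      have "\<bar>residual l h dt (real n * dt) (X p)\<bar> \<le> Cn l * (dt + h\<^sup>2)"
        using n[unfolded suc] dt h h\<delta> \<delta>(3) h0(3)[OF l] by (intro Cn(3)[OF l]) auto
      also have "\<dots> \<le> B * \<epsilon>" unfolding \<epsilon>_def[symmetric] using sumCn(2)[OF l] B(4) \<epsilon> by (intro mult_right_mono) auto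
      finally show "\<bar>(e l (Suc n) p - e l n p) / dt - div_h h (\<lambda>d r.
          grid_flux avg h (\<lambda>p. q l * \<Psi> n p) (Cg l (Suc n)) d r
          - grid_flux avg h (\<lambda>p. q l * (\<Psi> n p - \<phi> n p)) (\<lambda>p. Cg l (Suc n) p - e l (Suc n) p) d r) p\<bar> \<le> B * \<epsilon>"
        unfolding eq .
    qed
    have stab: "(\<Sum>l=1..M. (norm2_h h N (e l n))\<^sup>2) + dt / 2 * (\<Sum>k=1..n. \<Sum>l=1..M. (grad_norm2_h h N (e l k))\<^sup>2) \<le> (Cs * \<epsilon>)\<^sup>2"
      "H2_norm_h h N (\<phi> n) \<le> Cs * \<epsilon>"
      using Cs(3)[OF h _ hN dt(1) _ dth S nT] h\<delta> dt(2) \<delta>(2) by (simp_all add: \<epsilon>_def)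
    have hV: "(h * real N) ^ 3 * F\<^sup>2 * h ^ 4 \<le> V * \<epsilon>\<^sup>2"
    proof -
      have "h ^ 4 = (h\<^sup>2)\<^sup>2" by simp
      also have "\<dots> \<le> \<epsilon>\<^sup>2" using \<epsilon> by (intro power_mono) auto
      finally show ?thesis unfolding hN V_def[symmetric] using V by (intro mult_left_mono)
    qed
    have e_true: "(\<lambda>p. restrict_grid a b N (fourier_proj a b K (ce l (real k * dt))) p - c l k p) = (\<lambda>p. e l k p - \<eta>c l k p)" for l k
      by (simp add: R e_def \<eta>c_def fun_eq_iff)
    have \<psi>_true: "(\<lambda>p. restrict_grid a b N (fourier_proj a b K (\<psi>e (real n * dt))) p - \<psi> n p) = (\<lambda>p. \<phi> n p - \<eta>\<psi> n p)"
      by (simp add: R \<phi>_def \<eta>\<psi>_def fun_eq_iff)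
    have gradnn: "0 \<le> dt / 2 * (\<Sum>k=1..n. \<Sum>l=1..M. (grad_norm2_h h N (e l k))\<^sup>2)" using dt by (simp add: sum_nonneg)
    have 1: "norm2_h h N (\<lambda>p. e l n p - \<eta>c l n p) \<le> sqrt (2 * Cs\<^sup>2 + 314 * V) * \<epsilon>" if l: "l \<in> {1..M}" for l
    proof -
      have "(norm2_h h N (e l n))\<^sup>2 \<le> (\<Sum>l=1..M. (norm2_h h N (e l n))\<^sup>2)" by (rule member_le_sum[OF l]) auto
      then have "(norm2_h h N (e l n))\<^sup>2 \<le> (Cs * \<epsilon>)\<^sup>2" using stab(1) gradnn by linarith
      moreover have "(norm2_h h N (\<eta>c l n))\<^sup>2 \<le> 157 * (V * \<epsilon>\<^sup>2)"
      proof -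
        have "(norm2_h h N (\<eta>c l n))\<^sup>2 \<le> (H2_norm_h h N (\<eta>c l n))\<^sup>2" by (simp add: H2_norm_h_squared[OF hnn])
        also have "\<dots> \<le> 157 * (h * real N) ^ 3 * F\<^sup>2 * h ^ 4" by (rule small_grid_function(4)[OF h h1 \<eta>c[OF l nT]])
        finally show ?thesis using hV by simp
      qed
      ultimately have "(norm2_h h N (\<lambda>p. e l n p - \<eta>c l n p))\<^sup>2 \<le> (2 * Cs\<^sup>2 + 314 * V) * \<epsilon>\<^sup>2"
        using norm2_h_diff_squared_le[OF hnn, of N "e l n" "\<eta>c l n"] by (simp add: algebra_simps)
      from real_sqrt_le_mult[OF this] show ?thesis using V \<epsilon> norm2_h_nonneg[OF hnn] by simp
    qed
    have 2: "sqrt (dt * (\<Sum>l=1..M. \<Sum>k=1..n. (grad_norm2_h h N (\<lambda>p. e l k p - \<eta>c l k p))\<^sup>2)) \<le> sqrt (4 * Cs\<^sup>2 + 24 * T * real M * V) * \<epsilon>"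
    proof (rule real_sqrt_le_mult)
      have "(\<Sum>l=1..M. \<Sum>k=1..n. (grad_norm2_h h N (\<lambda>p. e l k p - \<eta>c l k p))\<^sup>2)
        \<le> (\<Sum>l=1..M. \<Sum>k=1..n. 2 * (grad_norm2_h h N (e l k))\<^sup>2 + 24 * (V * \<epsilon>\<^sup>2))"
      proof (intro sum_mono)
        fix l k assume l: "l \<in> {1..M}" and k: "k \<in> {1..n}"
        have "real k * dt \<le> real n * dt" using k dt by (intro mult_right_mono) auto
        then have "real k * dt \<le> T" using nT by linarith
        then have "(grad_norm2_h h N (\<eta>c l k))\<^sup>2 \<le> 12 * (h * real N) ^ 3 * F\<^sup>2 * h ^ 4"
          by (intro small_grid_function(3)[OF h h1] \<eta>c[OF l])
        then have "(grad_norm2_h h N (\<eta>c l k))\<^sup>2 \<le> 12 * (V * \<epsilon>\<^sup>2)" using hV by simp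
        then show "(grad_norm2_h h N (\<lambda>p. e l k p - \<eta>c l k p))\<^sup>2 \<le> 2 * (grad_norm2_h h N (e l k))\<^sup>2 + 24 * (V * \<epsilon>\<^sup>2)"
          using grad_norm2_h_diff_squared_le[OF hnn, of N "e l k" "\<eta>c l k"] by linarith
      qed
      also have "\<dots> = 2 * (\<Sum>k=1..n. \<Sum>l=1..M. (grad_norm2_h h N (e l k))\<^sup>2) + real M * (real n * (24 * (V * \<epsilon>\<^sup>2)))"
        by (subst (2) sum.swap) (simp add: sum.distrib sum_distrib_left)
      finally have "dt * (\<Sum>l=1..M. \<Sum>k=1..n. (grad_norm2_h h N (\<lambda>p. e l k p - \<eta>c l k p))\<^sup>2)
          \<le> dt * (2 * (\<Sum>k=1..n. \<Sum>l=1..M. (grad_norm2_h h N (e l k))\<^sup>2) + real M * (real n * (24 * (V * \<epsilon>\<^sup>2))))"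
        using dt by (intro mult_left_mono) auto
      also have "\<dots> = 4 * (dt / 2 * (\<Sum>k=1..n. \<Sum>l=1..M. (grad_norm2_h h N (e l k))\<^sup>2)) + (real n * dt) * (24 * real M * V * \<epsilon>\<^sup>2)"
        by (simp add: algebra_simps)
      \<comment> \<open>The projection errors are summed over \<open>n\<close> levels;
        \<open>n * dt <= T\<close> replaces their weighted sum by \<open>T\<close> times one of
        them.\<close>
      also have "\<dots> \<le> 4 * (Cs * \<epsilon>)\<^sup>2 + T * (24 * real M * V * \<epsilon>\<^sup>2)"
      proof (intro add_mono mult_left_mono mult_right_mono)
        have "0 \<le> (\<Sum>l=1..M. (norm2_h h N (e l n))\<^sup>2)" by (simp add: sum_nonneg)
        then show "dt / 2 * (\<Sum>k=1..n. \<Sum>l=1..M. (grad_norm2_h h N (e l k))\<^sup>2) \<le> (Cs * \<epsilon>)\<^sup>2" using stab(1) by linarith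
      qed (use nT V in auto)
      also have "\<dots> = (4 * Cs\<^sup>2 + 24 * T * real M * V) * \<epsilon>\<^sup>2" by (simp add: power_mult_distrib algebra_simps)
      finally show "dt * (\<Sum>l=1..M. \<Sum>k=1..n. (grad_norm2_h h N (\<lambda>p. e l k p - \<eta>c l k p))\<^sup>2) \<le> (4 * Cs\<^sup>2 + 24 * T * real M * V) * \<epsilon>\<^sup>2" .
      show "0 \<le> 4 * Cs\<^sup>2 + 24 * T * real M * V" using V T by simp
      show "0 \<le> \<epsilon>" using \<epsilon> by simp
    qed
    have 3: "H2_norm_h h N (\<lambda>p. \<phi> n p - \<eta>\<psi> n p) \<le> sqrt (2 * Cs\<^sup>2 + 314 * V) * \<epsilon>"
    proof -
      have H0: "0 \<le> H2_norm_h h N u" for u by (simp add: H2_norm_h_def)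
      have "(H2_norm_h h N (\<phi> n))\<^sup>2 \<le> (Cs * \<epsilon>)\<^sup>2" using stab(2) H0 by (rule power_mono)
      moreover have "(H2_norm_h h N (\<eta>\<psi> n))\<^sup>2 \<le> 157 * (V * \<epsilon>\<^sup>2)"
      proof -
        have "(H2_norm_h h N (\<eta>\<psi> n))\<^sup>2 \<le> 157 * (h * real N) ^ 3 * F\<^sup>2 * h ^ 4"
          by (rule small_grid_function(4)[OF h h1 \<eta>\<psi>[OF nT]])
        then show ?thesis using hV by simp
      qed
      ultimately have "(H2_norm_h h N (\<lambda>p. \<phi> n p - \<eta>\<psi> n p))\<^sup>2 \<le> (2 * Cs\<^sup>2 + 314 * V) * \<epsilon>\<^sup>2"
        using H2_norm_h_diff_squared_le[OF hnn, of N "\<phi> n" "\<eta>\<psi> n"] by (simp add: algebra_simps)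
      from real_sqrt_le_mult[OF this] show ?thesis using V \<epsilon> H0 by simp
    qed
    have "(\<Sum>l=1..M. norm2_h h N (\<lambda>p. e l n p - \<eta>c l n p)) \<le> (\<Sum>l=1..M. sqrt (2 * Cs\<^sup>2 + 314 * V) * \<epsilon>)"
      by (rule sum_mono[OF 1])
    also have "\<dots> = real M * sqrt (2 * Cs\<^sup>2 + 314 * V) * \<epsilon>" by simp
    finally have "(\<Sum>l=1..M. norm2_h h N (\<lambda>p. e l n p - \<eta>c l n p))
      + sqrt (dt * (\<Sum>l=1..M. \<Sum>k=1..n. (grad_norm2_h h N (\<lambda>p. e l k p - \<eta>c l k p))\<^sup>2))
      + H2_norm_h h N (\<lambda>p. \<phi> n p - \<eta>\<psi> n p) \<le>
      real M * sqrt (2 * Cs\<^sup>2 + 314 * V) * \<epsilon> + sqrt (4 * Cs\<^sup>2 + 24 * T * real M * V) * \<epsilon> + sqrt (2 * Cs\<^sup>2 + 314 * V) * \<epsilon>"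
      using 2 3 by (intro add_mono)
    also have "\<dots> \<le> Cf * \<epsilon>" using \<epsilon> by (simp add: Cf_def algebra_simps)
    finally show "(\<Sum>l=1..M. norm2_h h N (\<lambda>p. restrict_grid a b N (fourier_proj a b K (ce l (real n * dt))) p - c l n p))
      + sqrt (dt * (\<Sum>l=1..M. \<Sum>k=1..n. (grad_norm2_h h N (\<lambda>p. restrict_grid a b N (fourier_proj a b K (ce l (real k * dt))) p - c l k p))\<^sup>2))
      + H2_norm_h h N (\<lambda>p. restrict_grid a b N (fourier_proj a b K (\<psi>e (real n * dt))) p - \<psi> n p)
      \<le> Cf * (dt + h\<^sup>2)"
      unfolding e_true \<psi>_true \<epsilon>_def .
  qed
qed

theorem theorem4p1:
  shows "\<exists>m::nat. \<forall>(avg::mobility_average) (a::real) (b::real) (\<kappa>::real) (M::nat) (q::nat \<Rightarrow> real)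
      (\<rho>::real^3 \<Rightarrow> real) (T::real) (cin::nat \<Rightarrow> real^3 \<Rightarrow> real)
      (\<psi>e::real \<Rightarrow> real^3 \<Rightarrow> real) (ce::nat \<Rightarrow> real \<Rightarrow> real^3 \<Rightarrow> real) (C1::real) (C2::real).
    a < b \<longrightarrow> \<kappa> > 0 \<longrightarrow> M \<ge> 1 \<longrightarrow> T > 0 \<longrightarrow> C1 > 0 \<longrightarrow> C2 > 0 \<longrightarrow>
    space_periodic (b - a) \<rho> \<longrightarrow>
    C_spacetime T m (\<lambda>t. \<rho>) \<longrightarrow> C_spacetime T m \<psi>e \<longrightarrow> (\<forall>l\<in>{1..M}. C_spacetime T m (ce l)) \<longrightarrow>
    PNP_solution a b \<kappa> M q \<rho> T cin \<psi>e ce \<longrightarrow>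
    (\<exists>C>0. \<exists>\<delta>>0. \<forall>(K::nat) (dt::real) (\<psi>::nat \<Rightarrow> int^3 \<Rightarrow> real) (c::nat \<Rightarrow> nat \<Rightarrow> int^3 \<Rightarrow> real).
      let N = 2 * K + 1; h = mesh a b N;
          Ph = restrict_grid a b N; PN = fourier_proj a b K;
          e\<psi> = (\<lambda>n p. Ph (PN (\<psi>e (real n * dt))) p - \<psi> n p);
          e = (\<lambda>l n p. Ph (PN (ce l (real n * dt))) p - c l n p)
      in
        0 < dt \<longrightarrow> dt < \<delta> \<longrightarrow> h < \<delta> \<longrightarrow> C1 * h \<le> dt \<longrightarrow> dt \<le> C2 * h \<longrightarrow>
        slotboom_solution avg a b N M q (Ph (PN \<rho>)) \<kappa> T dt
          (Ph (PN (\<psi>e 0))) (\<lambda>l. Ph (PN (ce l 0))) \<psi> c \<longrightarrow>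
        (\<forall>n\<ge>1. real n * dt \<le> T \<longrightarrow>
          (\<Sum>l=1..M. norm2_h h N (e l n))
          + sqrt (dt * (\<Sum>l=1..M. \<Sum>k=1..n. (grad_norm2_h h N (e l k))\<^sup>2))
          + H2_norm_h h N (e\<psi> n)
          \<le> C * (dt + h\<^sup>2)))"
\<comment> \<open>Eight derivatives are what the tail of the Fourier series asks for; the Taylor
  estimates in space and time draw on four of them.\<close>
proof (rule exI[of _ 8], intro allI impI, goal_cases)
  case (1 avg a b \<kappa> M q \<rho> T cin \<psi>e ce C1 C2)
  then have ce: "\<And>l. l \<in> {1..M} \<Longrightarrow> C_spacetime T 8 (ce l)" by blast
  show ?case
  proof (rule slotboom_convergence[OF 1(1,2,4,6,8,7,9) ce 1(11), of avg])
    fix C \<delta> :: real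
    assume "C > 0" "\<delta> > 0" and est: "\<And>K dt \<psi> c n N h. N = 2 * K + 1 \<Longrightarrow> h = mesh a b N \<Longrightarrow> 0 < dt \<Longrightarrow> dt < \<delta> \<Longrightarrow> h < \<delta> \<Longrightarrow> dt \<le> C2 * h \<Longrightarrow>
      slotboom_solution avg a b N M q (restrict_grid a b N (fourier_proj a b K \<rho>)) \<kappa> T dt
        (restrict_grid a b N (fourier_proj a b K (\<psi>e 0))) (\<lambda>l. restrict_grid a b N (fourier_proj a b K (ce l 0))) \<psi> c \<Longrightarrow>
      real n * dt \<le> T \<Longrightarrow>
      (\<Sum>l=1..M. norm2_h h N (\<lambda>p. restrict_grid a b N (fourier_proj a b K (ce l (real n * dt))) p - c l n p))
      + sqrt (dt * (\<Sum>l=1..M. \<Sum>k=1..n. (grad_norm2_h h N (\<lambda>p. restrict_grid a b N (fourier_proj a b K (ce l (real k * dt))) p - c l k p))\<^sup>2))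
      + H2_norm_h h N (\<lambda>p. restrict_grid a b N (fourier_proj a b K (\<psi>e (real n * dt))) p - \<psi> n p)
      \<le> C * (dt + h\<^sup>2)"
    show ?thesis
      unfolding Let_def
      by (rule exI[of _ C], rule conjI[OF \<open>C > 0\<close>], rule exI[of _ \<delta>], rule conjI[OF \<open>\<delta> > 0\<close>], intro allI impI)
         (rule est[OF refl refl]; assumption)
  qed
qed

end
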